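(* Let $k$ be a field of characteristic $0$, $R = k[t_1, \dots, t_n]$, and $x_1, \dots, x_m \in (k^* )^n$. For $1 \le n' \le n$ let $m'_{n'}$ be the maximum of $\operatorname{rank}(\operatorname{Stab}_X(\mathfrak{p}))$ over prime ideals $\mathfrak{p} \subset \mathfrak{m}$ of height $n'$, assume $m'_{n'} < m$ for every $n'$, and set $\eta_{n'} = n'/(m - m'_{n'})$. Let $f \in R$ be nonzero of total degree $D$ and let $N = D^{\eta_1} + D^{\eta_2} + \cdots + D^{\eta_n}$. Then there exists $z \in X(N)$ with $f(z) \neq 0$.
   Context: $X(N) = \{\prod_{i=1}^m x_i^{a_i} : a_i \in \mathbf{Z},\ 0 \le a_i \le N\} \subset (k^* )^n$, products taken coordinatewise; for $a \in \mathbf{Z}^m$ write $x^a = \prod_i x_i^{a_i}$. $\mathfrak{m} = (t_1 - 1, \dots, t_n - 1)$. An element $z \in (k^* )^n$ acts on $R$ by $(z \cdot g)(t) = g(z_1t_1, \dots, z_nt_n)$, and $\operatorname{Stab}_X(\mathfrak{p}) = \{a \in \mathbf{Z}^m : x^a \cdot \mathfrak{p} = \mathfrak{p}\}$. *)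

theory Defs
  imports "HOL-Library.Poly_Mapping" "HOL-Library.Extended_Nat" "HOL-Library.Cardinality" Complex_Main
begin

text \<open>Polynomials in the variables t_i, i :: 'n (a finite type, n = CARD('n)),
  over a field 'k, are represented as finitely supported maps from monomials
  (exponent vectors) to coefficients.  This type is a commutative ring.\<close>

type_synonym ('n, 'k) mpoly = "('n \<Rightarrow>\<^sub>0 nat) \<Rightarrow>\<^sub>0 'k"

definition mvar :: "'n \<Rightarrow> ('n, 'k::comm_ring_1) mpoly" where
  "mvar i = Poly_Mapping.single (Poly_Mapping.single i 1) 1"

definition mono_val :: "('n::finite \<Rightarrow> 'k::comm_ring_1) \<Rightarrow> ('n \<Rightarrow>\<^sub>0 nat) \<Rightarrow> 'k" where
  "mono_val z \<alpha> = (\<Prod>i\<in>UNIV. z i ^ Poly_Mapping.lookup \<alpha> i)"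

definition meval :: "('n::finite, 'k::comm_ring_1) mpoly \<Rightarrow> ('n \<Rightarrow> 'k) \<Rightarrow> 'k" where
  "meval g z = (\<Sum>\<alpha>\<in>Poly_Mapping.keys g. Poly_Mapping.lookup g \<alpha> * mono_val z \<alpha>)"

definition total_degree :: "('n::finite, 'k::zero) mpoly \<Rightarrow> nat" where
  "total_degree g = Max (insert 0 ((\<lambda>\<alpha>. \<Sum>i\<in>UNIV. Poly_Mapping.lookup \<alpha> i) ` Poly_Mapping.keys g))"

text \<open>Action of z on R: (z \<cdot> g)(t) = g(z_1 t_1, ..., z_n t_n).\<close>
definition act :: "('n::finite \<Rightarrow> 'k::comm_ring_1) \<Rightarrow> ('n, 'k) mpoly \<Rightarrow> ('n, 'k) mpoly" where
  "act z g = Poly_Mapping.mapp (\<lambda>\<alpha> c. c * mono_val z \<alpha>) g"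

definition is_ideal :: "'a::comm_ring_1 set \<Rightarrow> bool" where
  "is_ideal I \<longleftrightarrow> 0 \<in> I \<and> (\<forall>a\<in>I. \<forall>b\<in>I. a + b \<in> I) \<and> (\<forall>r. \<forall>a\<in>I. r * a \<in> I)"

definition is_prime_ideal :: "'a::comm_ring_1 set \<Rightarrow> bool" where
  "is_prime_ideal P \<longleftrightarrow> is_ideal P \<and> P \<noteq> UNIV \<and> (\<forall>a b. a * b \<in> P \<longrightarrow> a \<in> P \<or> b \<in> P)"

definition ideal_gen :: "'a::comm_ring_1 set \<Rightarrow> 'a set" where
  "ideal_gen S = \<Inter>{I. is_ideal I \<and> S \<subseteq> I}"

definition prime_chain_to :: "'a::comm_ring_1 set \<Rightarrow> nat \<Rightarrow> bool" where
  "prime_chain_to P h \<longleftrightarrow> (\<exists>c :: nat \<Rightarrow> 'a set.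
      (\<forall>i\<le>h. is_prime_ideal (c i)) \<and> (\<forall>i<h. c i \<subset> c (Suc i)) \<and> c h = P)"

definition height :: "'a::comm_ring_1 set \<Rightarrow> enat" where
  "height P = (SUP h\<in>{h. prime_chain_to P h}. enat h)"

definition max_ideal_one :: "('n::finite, 'k::comm_ring_1) mpoly set" where
  "max_ideal_one = ideal_gen (range (\<lambda>i. mvar i - 1))"

definition xpow :: "('m::finite \<Rightarrow> 'n \<Rightarrow> 'k::field) \<Rightarrow> ('m \<Rightarrow> int) \<Rightarrow> 'n \<Rightarrow> 'k" where
  "xpow x a = (\<lambda>j. \<Prod>i\<in>UNIV. x i j powi a i)"

definition Stab :: "('m::finite \<Rightarrow> 'n::finite \<Rightarrow> 'k::field) \<Rightarrow> ('n, 'k) mpoly set \<Rightarrow> ('m \<Rightarrow> int) set" where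
  "Stab x P = {a. act (xpow x a) ` P = P}"

definition int_lin_indep :: "('m::finite \<Rightarrow> int) set \<Rightarrow> bool" where
  "int_lin_indep B \<longleftrightarrow> (\<forall>c :: ('m \<Rightarrow> int) \<Rightarrow> int.
      (\<forall>i. (\<Sum>b\<in>B. c b * b i) = 0) \<longrightarrow> (\<forall>b\<in>B. c b = 0))"

definition zrank :: "('m::finite \<Rightarrow> int) set \<Rightarrow> nat" where
  "zrank S = (GREATEST r. \<exists>B\<subseteq>S. finite B \<and> card B = r \<and> int_lin_indep B)"

definition mprime :: "('m::finite \<Rightarrow> 'n::finite \<Rightarrow> 'k::field) \<Rightarrow> nat \<Rightarrow> nat" where
  "mprime x n' = Max {zrank (Stab x P) | P. is_prime_ideal P \<and> P \<subseteq> max_ideal_one \<and> height P = enat n'}"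

end

theory Submission
  imports Defs "HOL-Library.FuncSet" "HOL-Library.Function_Algebras"
begin

text \<open>Suppose \<open>f\<close> vanishes at all \<open>x\<^sup>a\<close> with \<open>a\<close> in the box of side \<open>T\<^sub>1 + \<dots> + T\<^sub>n\<close>, where \<open>T\<^sub>d\<close> is the
  integer part of \<open>D powr \<eta>\<^sub>d\<close>, and let \<open>I\<^sub>j\<close> be generated by the translates of \<open>f\<close> by the box of side
  \<open>T\<^sub>1 + \<dots> + T\<^sub>j\<close>. Comparing the least heights of primes over the \<open>I\<^sub>j\<close> through points of the remaining
  box yields an index \<open>j\<close> and a prime of height \<open>j\<close> over \<open>I\<^sub>j\<close> all of whose translates by the box of
  side \<open>T\<^sub>j\<close> are minimal over the previous ideal. There are more than \<open>D ^ j\<close> of these translates,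
  because the stabilizer has rank at most \<open>m'\<^sub>j\<close>; this contradicts a Bezout bound.

  The Bezout bound is obtained by counting dimensions. If \<open>Q\<close> is minimal of height \<open>j\<close> over an ideal
  \<open>I\<close>, then \<open>j\<close> of the generators of \<open>I\<close> are analytically independent at \<open>Q\<close>; otherwise rewriting
  would show that polynomials of degree less than \<open>S\<close> modulo the \<open>S\<close>-th symbolic power of \<open>Q\<close> have
  dimension \<open>O(S ^ (n - 1))\<close>, whereas in characteristic zero no nonzero polynomial of degree less
  than \<open>S\<close> lies in that power. Power products of such generators and of independent variables,
  multiplied by elements separating the primes, are linearly independent. If there are \<open>q\<close> primes,
  then up to lower order terms the number of these products of a given degree is at least
  \<open>q / D ^ j\<close> times the number of all monomials of that degree, so \<open>q \<le> D ^ j\<close>.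

  Heights are read off maximal sets of variables that are independent modulo the prime.\<close>

section \<open>Polynomials as a vector space over the coefficient field\<close>

lemma (in vector_space) nontrivial_relation:
  assumes fin: "finite Z" "finite \<Omega>" and card: "card Z < card \<Omega>"
    and v: "\<And>i. i \<in> \<Omega> \<Longrightarrow> v i \<in> span Z"
  shows "\<exists>c. (\<exists>i\<in>\<Omega>. c i \<noteq> 0) \<and> (\<Sum>i\<in>\<Omega>. c i *s v i) = 0"
proof (cases "inj_on v \<Omega>")
  case True
  have "dependent (v ` \<Omega>)"
  proof (rule ccontr)
    assume "\<not> dependent (v ` \<Omega>)"
    then have "card (v ` \<Omega>) \<le> card Z"
      using independent_span_bound[OF fin(1)] v by blast
    then show False using card card_image[OF True] by simp
  qed
  then obtain u where "\<exists>w\<in>v ` \<Omega>. u w \<noteq> 0" "(\<Sum>w\<in>v ` \<Omega>. u w *s w) = 0"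
    using fin(2) by (auto simp: dependent_finite)
  then show ?thesis
    by (intro exI[of _ "u \<circ> v"]) (simp add: sum.reindex[OF True])
next
  case False
  then obtain i j where ij: "i \<in> \<Omega>" "j \<in> \<Omega>" "i \<noteq> j" "v i = v j"
    by (auto simp: inj_on_def)
  define c :: "'c \<Rightarrow> 'a" where "c = (\<lambda>_. 0)(i := 1, j := -1)"
  have "(\<Sum>l\<in>\<Omega>. c l *s v l) = (\<Sum>l\<in>{i, j}. c l *s v l)"
    using ij fin by (intro sum.mono_neutral_right) (auto simp: c_def)
  also have "\<dots> = 0" using ij by (simp add: c_def)
  finally show ?thesis using ij by (intro exI[of _ c]) (auto simp: c_def)
qed

lemma (in vector_space) nontrivial_relation_mod_subspace:
  assumes "finite Z" "finite \<Omega>" "card Z < card \<Omega>" and U: "subspace U"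
    and "\<And>i. i \<in> \<Omega> \<Longrightarrow> \<exists>z\<in>span Z. v i - z \<in> U"
  shows "\<exists>c. (\<exists>i\<in>\<Omega>. c i \<noteq> 0) \<and> (\<Sum>i\<in>\<Omega>. c i *s v i) \<in> U"
proof -
  obtain z where z: "\<And>i. i \<in> \<Omega> \<Longrightarrow> z i \<in> span Z" "\<And>i. i \<in> \<Omega> \<Longrightarrow> v i - z i \<in> U"
    using assms(5) by metis
  obtain c where c: "\<exists>i\<in>\<Omega>. c i \<noteq> 0" "(\<Sum>i\<in>\<Omega>. c i *s z i) = 0"
    using nontrivial_relation[OF assms(1-3), of z] z(1) by blast
  have "(\<Sum>i\<in>\<Omega>. c i *s v i) = (\<Sum>i\<in>\<Omega>. c i *s (v i - z i))"
    by (simp add: scale_right_diff_distrib sum_subtractf c(2))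
  also have "\<dots> \<in> U"
    using z(2) by (intro subspace_sum[OF U] subspace_scale[OF U])
  finally show ?thesis using c(1) by blast
qed

lemma (in vector_space) subspace_span_plus:
  assumes U: "subspace U"
  shows "subspace {x. \<exists>z\<in>span Z. x - z \<in> U}"
proof -
  have "{x. \<exists>z\<in>span Z. x - z \<in> U} = {z + u | z u. z \<in> span Z \<and> u \<in> U}"
    by (auto, metis add.commute diff_add_cancel, metis add_diff_cancel_left')
  then show ?thesis
    using subspace_sums[OF subspace_span U] by simp
qed

abbreviation lookup :: "('a \<Rightarrow>\<^sub>0 'b::zero) \<Rightarrow> 'a \<Rightarrow> 'b" where
  "lookup \<equiv> Poly_Mapping.lookup"

abbreviation keys :: "('a \<Rightarrow>\<^sub>0 'b::zero) \<Rightarrow> 'a set" where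
  "keys \<equiv> Poly_Mapping.keys"

abbreviation single :: "'a \<Rightarrow> 'b \<Rightarrow> 'a \<Rightarrow>\<^sub>0 'b::zero" where
  "single \<equiv> Poly_Mapping.single"

definition const :: "'k::comm_ring_1 \<Rightarrow> ('n, 'k) mpoly" where
  "const c = single 0 c"

definition monom :: "('n \<Rightarrow>\<^sub>0 nat) \<Rightarrow> ('n, 'k::comm_ring_1) mpoly" where
  "monom \<gamma> = single \<gamma> 1"

definition smult :: "'k::comm_ring_1 \<Rightarrow> ('n, 'k) mpoly \<Rightarrow> ('n, 'k) mpoly" where
  "smult c p = const c * p"

global_interpretation mpoly: vector_space "smult :: 'k::field \<Rightarrow> ('n, 'k) mpoly \<Rightarrow> _"
  by unfold_locales
     (auto simp: smult_def const_def algebra_simps single_add mult_single mult.assoc[symmetric])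

lemma monom_add: "monom (\<alpha> + \<beta>) = (monom \<alpha> * monom \<beta> :: ('n, 'k::comm_ring_1) mpoly)"
  by (simp add: monom_def mult_single)

lemma monom_zero [simp]: "monom 0 = 1"
  by (simp add: monom_def)

lemma keys_monom [simp]: "keys (monom \<gamma> :: ('n, 'k::comm_ring_1) mpoly) = {\<gamma>}"
  by (simp add: monom_def)

lemma smult_monom: "smult c (monom \<gamma>) = single \<gamma> c"
  by (simp add: smult_def const_def monom_def mult_single)

lemma smult_mult_left: "smult c p * q = smult c (p * q)"
  by (simp add: smult_def mult.assoc)

lemma smult_mult_right: "p * smult c q = smult c (p * q)"
  by (simp add: smult_def mult.left_commute)

lemma lookup_sum_smult_monom:
  assumes "finite \<Omega>" "\<gamma> \<in> \<Omega>"
  shows "lookup (\<Sum>\<gamma>\<in>\<Omega>. smult (c \<gamma>) (monom \<gamma>)) \<gamma> = c \<gamma>"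
  using assms by (simp add: lookup_sum smult_monom lookup_single when_def)

lemma mpoly_expand: "p = (\<Sum>\<gamma>\<in>keys p. smult (lookup p \<gamma>) (monom \<gamma>))"
  for p :: "('n, 'k::comm_ring_1) mpoly"
  by (rule poly_mapping_eqI)
     (auto simp: smult_monom lookup_sum lookup_single when_def in_keys_iff)

lemma mpoly_induct [case_names single add]:
  fixes p :: "('n, 'k::comm_ring_1) mpoly"
  assumes single: "\<And>\<gamma> c. P (single \<gamma> c)" and add: "\<And>p q. P p \<Longrightarrow> P q \<Longrightarrow> P (p + q)"
  shows "P p"
proof -
  have "P (\<Sum>\<gamma>\<in>F. smult (lookup p \<gamma>) (monom \<gamma>))" if "finite F" for F
    using that
  proof induction
    case empty
    then show ?case using single[of 0 0] by simp
  qed (auto simp: smult_monom intro: single add)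
  then show ?thesis using mpoly_expand[of p] by (metis finite_keys)
qed

lemma mpoly_bilinear_induct [case_names single add_left add_right]:
  fixes p q :: "('n, 'k::comm_ring_1) mpoly"
  assumes "\<And>\<gamma> c \<delta> d. P (single \<gamma> c) (single \<delta> d)"
    and "\<And>p p' q. P p q \<Longrightarrow> P p' q \<Longrightarrow> P (p + p') q"
    and "\<And>p q q'. P p q \<Longrightarrow> P p q' \<Longrightarrow> P p (q + q')"
  shows "P p q"
proof (induction p rule: mpoly_induct)
  case (single \<gamma> c)
  show ?case by (induction q rule: mpoly_induct) (fact assms)+
qed (fact assms)

lemma subspace_mult_span:
  fixes T :: "('n, 'k::field) mpoly set"
  assumes T: "mpoly.subspace T" and "x \<in> mpoly.span B" "\<And>b. b \<in> B \<Longrightarrow> u * b \<in> T"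
  shows "u * x \<in> T"
  using assms(2)
proof (induction rule: mpoly.span_induct_alt)
  case base
  then show ?case using mpoly.subspace_0[OF T] by simp
next
  case (step c b y)
  then show ?case
    by (simp add: distrib_left smult_mult_right mpoly.subspace_add[OF T] mpoly.subspace_scale[OF T]
      assms(3))
qed

lemma subspace_mult_monoms:
  fixes T :: "('n, 'k::field) mpoly set"
  assumes "mpoly.subspace T" "\<And>\<kappa>. \<kappa> \<in> keys p \<Longrightarrow> monom \<kappa> * x \<in> T"
  shows "p * x \<in> T"
proof -
  have "p \<in> mpoly.span (monom ` keys p)"
    by (subst mpoly_expand[of p]) (intro mpoly.span_sum mpoly.span_scale mpoly.span_base imageI)
  then have "x * p \<in> T"
    by (rule subspace_mult_span[OF assms(1)]) (auto simp: mult.commute[of x] intro: assms(2))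
  then show ?thesis by (simp only: mult.commute)
qed

section \<open>Partial degrees\<close>

definition mdeg :: "'n set \<Rightarrow> ('n::finite \<Rightarrow>\<^sub>0 nat) \<Rightarrow> nat" where
  "mdeg V \<gamma> = (\<Sum>i\<in>V. lookup \<gamma> i)"

lemma mdeg_zero [simp]: "mdeg V 0 = 0"
  by (simp add: mdeg_def)

lemma mdeg_add [simp]: "mdeg V (\<alpha> + \<beta>) = mdeg V \<alpha> + mdeg V \<beta>"
  by (simp add: mdeg_def lookup_add sum.distrib)

lemma mdeg_single [simp]: "mdeg V (single i e) = (if i \<in> V then e else 0)"
  by (auto simp: mdeg_def lookup_single when_def sum.delta)

lemma mdeg_mono: "V \<subseteq> W \<Longrightarrow> mdeg V \<gamma> \<le> mdeg W \<gamma>"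
  by (simp add: mdeg_def sum_mono2)

lemma mdeg_split: "mdeg UNIV \<gamma> = mdeg V \<gamma> + mdeg (- V) \<gamma>"
  unfolding mdeg_def by (metis Compl_eq_Diff_UNIV finite sum.subset_diff top_greatest add.commute)

lemma mdeg_eq_0_iff: "mdeg V \<gamma> = 0 \<longleftrightarrow> (\<forall>i\<in>V. lookup \<gamma> i = 0)"
  by (simp add: mdeg_def)

lemma lookup_le_mdeg: "i \<in> V \<Longrightarrow> lookup \<gamma> i \<le> mdeg V \<gamma>"
  unfolding mdeg_def by (rule member_le_sum) auto

definition deg_le :: "'n set \<Rightarrow> nat \<Rightarrow> ('n::finite, 'k::zero) mpoly \<Rightarrow> bool" where
  "deg_le V d p \<longleftrightarrow> (\<forall>\<gamma>\<in>keys p. mdeg V \<gamma> \<le> d)"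

lemma deg_le_weaken: "deg_le V d p \<Longrightarrow> d \<le> e \<Longrightarrow> deg_le V e p"
  by (auto simp: deg_le_def)

lemma deg_le_subset: "deg_le V d p \<Longrightarrow> W \<subseteq> V \<Longrightarrow> deg_le W d p"
  by (meson deg_le_def le_trans mdeg_mono)

lemma deg_le_zero [simp]: "deg_le V d 0"
  by (simp add: deg_le_def)

lemma deg_le_one [simp]: "deg_le V d (1 :: ('n::finite, 'k::comm_ring_1) mpoly)"
  by (simp add: deg_le_def)

lemma deg_le_monom: "deg_le V d (monom \<gamma> :: ('n::finite, 'k::comm_ring_1) mpoly) \<longleftrightarrow> mdeg V \<gamma> \<le> d"
  by (simp add: deg_le_def)

lemma deg_le_add: "deg_le V d p \<Longrightarrow> deg_le V d q \<Longrightarrow> deg_le V d (p + q)"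
  using keys_add[of p q] by (auto simp: deg_le_def)

lemma deg_le_mult: "deg_le V d p \<Longrightarrow> deg_le V e q \<Longrightarrow> deg_le V (d + e) (p * q)"
  for p :: "('n::finite, 'k::comm_ring_1) mpoly"
  using keys_mult[of p q] by (fastforce simp: deg_le_def intro: add_mono)

lemma deg_le_power: "deg_le V d p \<Longrightarrow> deg_le V (m * d) (p ^ m)"
  for p :: "('n::finite, 'k::comm_ring_1) mpoly"
  by (induction m) (auto intro: deg_le_mult)

lemma deg_le_sum: "(\<And>i. i \<in> F \<Longrightarrow> deg_le V d (p i)) \<Longrightarrow> deg_le V d (sum p F)"
  by (induction F rule: infinite_finite_induct) (auto intro: deg_le_add)

lemma deg_le_prod:
  fixes p :: "'i \<Rightarrow> ('n::finite, 'k::comm_ring_1) mpoly"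
  assumes "\<And>i. i \<in> F \<Longrightarrow> deg_le V (d i) (p i)"
  shows "deg_le V (sum d F) (prod p F)"
  using assms by (induction F rule: infinite_finite_induct) (auto intro: deg_le_mult)

lemma deg_le_smult: "deg_le V d p \<Longrightarrow> deg_le V d (smult c p)"
  for p :: "('n::finite, 'k::comm_ring_1) mpoly"
  using deg_le_mult[of V 0 "const c" d p]
  by (auto simp: smult_def const_def deg_le_def split: if_splits)

lemma deg_le_total_degree: "deg_le UNIV (total_degree p) p"
  by (auto simp: deg_le_def total_degree_def mdeg_def intro: Max_ge)

lemma finite_deg_le_bound:
  assumes "finite F"
  obtains E where "\<And>p. p \<in> F \<Longrightarrow> deg_le UNIV E p"
proof -
  obtain E where "\<forall>p\<in>F. total_degree p \<le> E"
    using assms finite_nat_set_iff_bounded_le[of "total_degree ` F"] by auto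
  then show thesis
    using that deg_le_weaken deg_le_total_degree by blast
qed

lemma deg_le_imp_span_monom:
  fixes p :: "('n::finite, 'k::field) mpoly"
  assumes "deg_le UNIV d p"
  shows "p \<in> mpoly.span (monom ` {\<gamma>. mdeg UNIV \<gamma> \<le> d})"
  by (subst mpoly_expand[of p], intro mpoly.span_sum mpoly.span_scale mpoly.span_base)
     (use assms in \<open>auto simp: deg_le_def\<close>)

definition deg_lt :: "'n set \<Rightarrow> nat \<Rightarrow> ('n::finite, 'k::zero) mpoly \<Rightarrow> bool" where
  "deg_lt V d p \<longleftrightarrow> (\<forall>\<gamma>\<in>keys p. mdeg V \<gamma> < d)"

lemma deg_lt_imp_le: "deg_lt V d p \<Longrightarrow> deg_le V d p"
  by (auto simp: deg_lt_def deg_le_def intro: less_imp_le)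

lemma deg_le_imp_lt: "deg_le V d p \<Longrightarrow> d < e \<Longrightarrow> deg_lt V e p"
  by (auto simp: deg_lt_def deg_le_def)

lemma deg_lt_zero [simp]: "deg_lt V d 0"
  by (simp add: deg_lt_def)

lemma deg_lt_add: "deg_lt V d p \<Longrightarrow> deg_lt V d q \<Longrightarrow> deg_lt V d (p + q)"
  using keys_add[of p q] by (auto simp: deg_lt_def)

lemma deg_lt_sum: "(\<And>i. i \<in> F \<Longrightarrow> deg_lt V d (p i)) \<Longrightarrow> deg_lt V d (sum p F)"
  by (induction F rule: infinite_finite_induct) (auto intro: deg_lt_add)

lemma deg_lt_mult_deg_le: "deg_lt V d p \<Longrightarrow> deg_le V e q \<Longrightarrow> deg_lt V (d + e) (p * q)"
  for p :: "('n::finite, 'k::comm_ring_1) mpoly"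
  using keys_mult[of p q] by (fastforce simp: deg_lt_def deg_le_def intro: add_less_le_mono)

definition poly_ring :: "'n set \<Rightarrow> ('n::finite, 'k::zero) mpoly set" where
  "poly_ring Y = {p. deg_le (- Y) 0 p}"

lemma poly_ring_iff: "p \<in> poly_ring Y \<longleftrightarrow> (\<forall>\<gamma>\<in>keys p. mdeg (- Y) \<gamma> = 0)"
  by (simp add: poly_ring_def deg_le_def)

lemma poly_ring_mono: "Y \<subseteq> Z \<Longrightarrow> poly_ring Y \<subseteq> poly_ring Z"
  unfolding poly_ring_def using deg_le_subset by blast

lemma zero_in_poly_ring [simp]: "0 \<in> poly_ring Y"
  by (simp add: poly_ring_def)

lemma one_in_poly_ring [simp]: "(1 :: ('n::finite, 'k::comm_ring_1) mpoly) \<in> poly_ring Y"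
  by (simp add: poly_ring_def)

lemma monom_in_poly_ring:
  "(monom \<gamma> :: ('n::finite, 'k::comm_ring_1) mpoly) \<in> poly_ring Y \<longleftrightarrow> mdeg (- Y) \<gamma> = 0"
  by (simp add: poly_ring_iff)

lemma poly_ring_mult: "p \<in> poly_ring Y \<Longrightarrow> q \<in> poly_ring Y \<Longrightarrow> p * q \<in> poly_ring Y"
  for p :: "('n::finite, 'k::comm_ring_1) mpoly"
  using deg_le_mult[of "- Y" 0 p 0 q] by (simp add: poly_ring_def)

lemma poly_ring_power: "p \<in> poly_ring Y \<Longrightarrow> p ^ m \<in> poly_ring Y"
  for p :: "('n::finite, 'k::comm_ring_1) mpoly"
  by (induction m) (auto intro: poly_ring_mult)

lemma poly_ring_sum: "(\<And>i. i \<in> F \<Longrightarrow> p i \<in> poly_ring Y) \<Longrightarrow> sum p F \<in> poly_ring Y"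
  by (simp add: poly_ring_def deg_le_sum)

lemma poly_ring_smult: "p \<in> poly_ring Y \<Longrightarrow> smult c p \<in> poly_ring Y"
  for p :: "('n::finite, 'k::comm_ring_1) mpoly"
  by (simp add: poly_ring_def deg_le_smult)

section \<open>Coefficients with respect to one variable\<close>

lemma add_diff_exponent:
  fixes \<beta> \<gamma> :: "'n \<Rightarrow>\<^sub>0 nat"
  assumes "\<And>i. lookup \<beta> i \<le> lookup \<gamma> i"
  shows "\<beta> + (\<gamma> - \<beta>) = \<gamma>"
  by (rule poly_mapping_eqI) (simp add: assms lookup_add lookup_minus)

lemma single_add_diff_exponent:
  "a \<le> lookup \<gamma> i \<Longrightarrow> single i a + (\<gamma> - single i a) = (\<gamma> :: 'n \<Rightarrow>\<^sub>0 nat)"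
  by (rule add_diff_exponent) (auto simp: lookup_single when_def)

definition var_coeff :: "'n \<Rightarrow> nat \<Rightarrow> ('n, 'k::comm_ring_1) mpoly \<Rightarrow> ('n, 'k) mpoly" where
  "var_coeff i a p =
     (\<Sum>\<gamma>\<in>keys p. if lookup \<gamma> i = a then single (\<gamma> - single i a) (lookup p \<gamma>) else 0)"

lemma var_coeff_zero [simp]: "var_coeff i a 0 = 0"
  by (simp add: var_coeff_def)

lemma var_coeff_add: "var_coeff i a (p + q) = var_coeff i a p + var_coeff i a q"
  unfolding var_coeff_def
  by (rule setsum_keys_plus_distrib[where f = "\<lambda>\<gamma> c.
      if lookup \<gamma> i = a then single (\<gamma> - single i a) c else 0"])
     (simp_all add: single_add)

lemma var_coeff_single:
  "var_coeff i a (single \<gamma> c) = (if lookup \<gamma> i = a then single (\<gamma> - single i a) c else 0)"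
  by (auto simp: var_coeff_def)

lemma var_coeff_mult: "var_coeff i n (p * q) = (\<Sum>a\<le>n. var_coeff i a p * var_coeff i (n - a) q)"
  for p q :: "('n, 'k::comm_ring_1) mpoly"
proof (induction p q rule: mpoly_bilinear_induct)
  case (single \<gamma> c \<delta> d)
  let ?a = "lookup \<gamma> i" and ?b = "lookup \<delta> i"
  have "(\<Sum>a\<le>n. var_coeff i a (single \<gamma> c) * var_coeff i (n - a) (single \<delta> d)) =
      (\<Sum>a\<le>n. if a = ?a then var_coeff i ?a (single \<gamma> c) * var_coeff i (n - ?a) (single \<delta> d) else 0)"
    by (intro sum.cong) (auto simp: var_coeff_single)
  also have "\<dots> =
      (if ?a + ?b = n then single ((\<gamma> - single i ?a) + (\<delta> - single i ?b)) (c * d) else 0)"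
    by (auto simp: var_coeff_single mult_single)
  also have "(\<gamma> - single i ?a) + (\<delta> - single i ?b) = \<gamma> + \<delta> - single i (?a + ?b)"
    by (intro poly_mapping_eqI) (auto simp: lookup_add lookup_minus lookup_single when_def)
  finally show ?case by (auto simp: var_coeff_single mult_single lookup_add)
qed (simp_all add: distrib_left distrib_right var_coeff_add sum.distrib)

lemma var_coeff_expand:
  fixes p :: "('n::finite, 'k::comm_ring_1) mpoly"
  assumes "deg_le {i} d p"
  shows "p = (\<Sum>a\<le>d. var_coeff i a p * monom (single i a))"
proof -
  have "(\<Sum>a\<le>d. var_coeff i a p * monom (single i a)) =
    (\<Sum>a\<le>d. \<Sum>\<gamma>\<in>keys p. if lookup \<gamma> i = a then single \<gamma> (lookup p \<gamma>) else 0)"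
    unfolding var_coeff_def sum_distrib_right
    by (intro sum.cong refl)
       (auto simp: monom_def mult_single add.commute[of "_ - _"] single_add_diff_exponent)
  also have "\<dots> = (\<Sum>\<gamma>\<in>keys p. \<Sum>a\<le>d. if lookup \<gamma> i = a then single \<gamma> (lookup p \<gamma>) else 0)"
    by (rule sum.swap)
  also have "\<dots> = (\<Sum>\<gamma>\<in>keys p. smult (lookup p \<gamma>) (monom \<gamma>))"
    using assms by (intro sum.cong) (auto simp: smult_monom deg_le_def mdeg_def)
  also have "\<dots> = p" by (rule mpoly_expand[symmetric])
  finally show ?thesis ..
qed

lemma var_coeff_of_free:
  assumes "p \<in> poly_ring (- {i})"
  shows "var_coeff i a p = (if a = 0 then p else 0)"
proof -
  have "var_coeff i a p = (\<Sum>\<gamma>\<in>keys p. if a = 0 then smult (lookup p \<gamma>) (monom \<gamma>) else 0)"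
    unfolding var_coeff_def using assms
    by (intro sum.cong) (auto simp: poly_ring_iff mdeg_eq_0_iff smult_monom)
  then show ?thesis using mpoly_expand[of p] by auto
qed

lemma var_coeff_in_poly_ring:
  assumes "p \<in> poly_ring (insert i Y)"
  shows "var_coeff i a p \<in> poly_ring Y"
proof -
  have "single (\<gamma> - single i a) (lookup p \<gamma>) \<in> poly_ring Y" if "\<gamma> \<in> keys p" "lookup \<gamma> i = a" for \<gamma>
  proof -
    have "lookup \<gamma> j = 0" if "j \<notin> insert i Y" for j
      using assms \<open>\<gamma> \<in> keys p\<close> that by (auto simp: poly_ring_iff mdeg_eq_0_iff)
    then have "mdeg (- Y) (\<gamma> - single i a) = 0"
      using that(2) by (auto simp: mdeg_eq_0_iff lookup_minus lookup_single when_def)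
    then show ?thesis
      by (simp add: smult_monom[symmetric] poly_ring_smult monom_in_poly_ring)
  qed
  then show ?thesis
    unfolding var_coeff_def by (intro poly_ring_sum) simp
qed

lemma deg_le_var_coeff_term:
  assumes "p \<in> poly_ring (insert i Y)"
  shows "deg_le (- Y) a (var_coeff i a p * monom (single i a))"
  using deg_le_mult[of "- Y" 0 "var_coeff i a p" a "monom (single i a)"]
    var_coeff_in_poly_ring[OF assms]
  by (simp add: poly_ring_def deg_le_monom)

lemma leading_term:
  fixes p :: "('n::finite, 'k::comm_ring_1) mpoly"
  assumes p: "p \<in> poly_ring (insert i Y)" "p \<noteq> 0"
  obtains e a l where "p = a * monom (single i e) + l" "a \<noteq> 0" "a \<in> poly_ring Y" "deg_lt (- Y) e l"
proof -
  define e where "e = (LEAST d. deg_le {i} d p)"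
  have e: "deg_le {i} e p" unfolding e_def
    by (rule LeastI) (rule deg_le_subset[OF deg_le_total_degree subset_UNIV])
  let ?t = "\<lambda>a. var_coeff i a p * monom (single i a)"
  have expand: "p = ?t e + (\<Sum>a<e. ?t a)"
    by (subst var_coeff_expand[OF e]) (simp add: lessThan_Suc_atMost[symmetric])
  have "var_coeff i e p \<noteq> 0"
  proof
    assume vanish: "var_coeff i e p = 0"
    show False
    proof (cases e)
      case 0
      then show False using expand vanish p(2) by simp
    next
      case (Suc d)
      have "p \<in> poly_ring (insert i (- {i}))" by (auto simp: poly_ring_iff mdeg_eq_0_iff)
      from deg_le_weaken[OF deg_le_var_coeff_term[OF this]]
      have "deg_le {i} d (?t a)" if "a < e" for a
        using that Suc by simp
      then have "deg_le {i} d p"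
        using expand vanish
        by (metis (mono_tags, lifting) add_0 deg_le_sum lessThan_iff mult_zero_left)
      then have "e \<le> d" unfolding e_def by (rule Least_le)
      then show False using Suc by simp
    qed
  qed
  moreover have "deg_lt (- Y) e (\<Sum>a<e. ?t a)"
    by (intro deg_lt_sum deg_le_imp_lt[OF deg_le_var_coeff_term[OF p(1)]]) simp
  ultimately show thesis
    using that[OF expand] var_coeff_in_poly_ring[OF p(1)] by blast
qed

lemma power_add_expand:
  "(x + y) ^ n = x ^ n + y * (\<Sum>i<n. x ^ (n - Suc i) * (x + y) ^ i)" for x y :: "'a::comm_ring_1"
  using power_diff_sumr2[of "x + y" n x] by (simp add: algebra_simps)

lemma leading_term_power:
  fixes a l :: "('n::finite, 'k::comm_ring_1) mpoly"
  assumes a: "a \<in> poly_ring Y" and l: "deg_lt (- Y) e l" and i: "i \<notin> Y"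
  obtains l' where "(a * monom (single i e) + l) ^ m = a ^ m * monom (single i (m * e)) + l'"
    and "deg_lt (- Y) (m * e) l'"
proof -
  let ?x = "a * monom (single i e)"
  have "deg_le (- Y) e ?x"
    using deg_le_mult[of "- Y" 0 a e "monom (single i e)"] a i
    by (simp add: poly_ring_def deg_le_monom)
  then have bound: "deg_le (- Y) ((m - Suc k) * e + k * e) (?x ^ (m - Suc k) * (?x + l) ^ k)" for k
    by (intro deg_le_mult deg_le_power deg_le_add deg_lt_imp_le[OF l])
  have "deg_le (- Y) ((m - 1) * e) (\<Sum>k<m. ?x ^ (m - Suc k) * (?x + l) ^ k)"
    by (rule deg_le_sum, rule deg_le_weaken[OF bound]) (simp add: add_mult_distrib[symmetric])
  from deg_lt_mult_deg_le[OF l this]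
  have "deg_lt (- Y) (m * e) (l * (\<Sum>k<m. ?x ^ (m - Suc k) * (?x + l) ^ k))"
    by (cases m) (simp_all add: deg_lt_def)
  moreover have "?x ^ m = a ^ m * monom (single i (m * e))"
  proof -
    have "monom (single i e) ^ m = (monom (single i (m * e)) :: ('n, 'k) mpoly)"
      by (induction m) (simp_all add: monom_add single_add)
    then show ?thesis by (simp add: power_mult_distrib)
  qed
  ultimately show thesis
    using power_add_expand[of ?x l m] by (intro that) simp_all
qed

section \<open>Ideals\<close>

lemma is_ideal_ideal_gen: "is_ideal (ideal_gen S)"
  unfolding ideal_gen_def is_ideal_def by auto

lemma ideal_gen_superset: "S \<subseteq> ideal_gen S"
  by (auto simp: ideal_gen_def)

lemma ideal_gen_base: "x \<in> S \<Longrightarrow> x \<in> ideal_gen S"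
  using ideal_gen_superset by blast

lemma ideal_gen_least: "is_ideal I \<Longrightarrow> S \<subseteq> I \<Longrightarrow> ideal_gen S \<subseteq> I"
  by (auto simp: ideal_gen_def)

lemma ideal_add: "is_ideal I \<Longrightarrow> a \<in> I \<Longrightarrow> b \<in> I \<Longrightarrow> a + b \<in> I"
  and ideal_zero: "is_ideal I \<Longrightarrow> 0 \<in> I"
  and ideal_mult_left: "is_ideal I \<Longrightarrow> a \<in> I \<Longrightarrow> r * a \<in> I"
  by (auto simp: is_ideal_def)

lemma ideal_mult_right: "is_ideal I \<Longrightarrow> a \<in> I \<Longrightarrow> a * r \<in> I"
  by (metis ideal_mult_left mult.commute)

lemma ideal_uminus: "is_ideal I \<Longrightarrow> a \<in> I \<Longrightarrow> - a \<in> I"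
  using ideal_mult_left[of I a "-1"] by simp

lemma ideal_diff: "is_ideal I \<Longrightarrow> a \<in> I \<Longrightarrow> b \<in> I \<Longrightarrow> a - b \<in> I"
  using ideal_add[of I a "- b"] ideal_uminus[of I b] by simp

lemma ideal_sum: "is_ideal I \<Longrightarrow> (\<And>i. i \<in> F \<Longrightarrow> p i \<in> I) \<Longrightarrow> sum p F \<in> I"
  by (induction F rule: infinite_finite_induct) (auto intro: ideal_add ideal_zero)

lemma is_ideal_quotient: "is_ideal J \<Longrightarrow> is_ideal {a. a * b \<in> J}"
  by (auto simp: is_ideal_def algebra_simps)

lemma subspace_ideal: "is_ideal I \<Longrightarrow> mpoly.subspace (I :: ('n, 'k::field) mpoly set)"
  unfolding mpoly.subspace_def by (auto simp: smult_def ideal_add ideal_zero ideal_mult_left)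

lemma ideal_gen_mult:
  assumes J: "is_ideal J" and ST: "\<And>s t. s \<in> S \<Longrightarrow> t \<in> T \<Longrightarrow> s * t \<in> J"
    and "x \<in> ideal_gen S" "y \<in> ideal_gen T"
  shows "x * y \<in> J"
proof -
  have "ideal_gen T \<subseteq> {t. s * t \<in> J}" if "s \<in> S" for s
  proof (rule ideal_gen_least)
    show "is_ideal {t. s * t \<in> J}" using is_ideal_quotient[OF J, of s] by (simp add: mult.commute)
  qed (use ST that in blast)
  then have "ideal_gen S \<subseteq> {s. s * y \<in> J}"
    using assms(4) by (intro ideal_gen_least is_ideal_quotient[OF J]) auto
  then show ?thesis using assms(3) by blast
qed

fun ideal_power :: "'a::comm_ring_1 set \<Rightarrow> nat \<Rightarrow> 'a set" where
  "ideal_power I 0 = UNIV"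
| "ideal_power I (Suc s) = ideal_gen {a * b | a b. a \<in> I \<and> b \<in> ideal_power I s}"

declare ideal_power.simps(2) [simp del]

lemma is_ideal_ideal_power: "is_ideal (ideal_power I s)"
  by (cases s) (simp_all add: ideal_power.simps(2) is_ideal_ideal_gen, simp add: is_ideal_def)

lemma ideal_power_Suc_mult:
  "a \<in> I \<Longrightarrow> b \<in> ideal_power I s \<Longrightarrow> a * b \<in> ideal_power I (Suc s)"
  unfolding ideal_power.simps(2) by (rule ideal_gen_base) blast

lemma ideal_power_Suc_least:
  assumes "is_ideal J" "\<And>a b. a \<in> I \<Longrightarrow> b \<in> ideal_power I s \<Longrightarrow> a * b \<in> J"
  shows "ideal_power I (Suc s) \<subseteq> J"
  unfolding ideal_power.simps(2) by (rule ideal_gen_least) (use assms in blast)+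

lemma ideal_power_one:
  assumes I: "is_ideal I"
  shows "ideal_power I (Suc 0) = I"
proof
  show "ideal_power I (Suc 0) \<subseteq> I"
    by (rule ideal_power_Suc_least[OF I]) (rule ideal_mult_right[OF I])
  show "I \<subseteq> ideal_power I (Suc 0)"
    using ideal_power_Suc_mult[of _ I 1 0] by auto
qed

lemma ideal_power_mult:
  "a \<in> ideal_power I s \<Longrightarrow> b \<in> ideal_power I r \<Longrightarrow> a * b \<in> ideal_power I (s + r)"
proof (induction s arbitrary: a)
  case 0
  then show ?case by (simp add: ideal_mult_left is_ideal_ideal_power)
next
  case (Suc s)
  have "ideal_power I (Suc s) \<subseteq> {a. a * b \<in> ideal_power I (Suc s + r)}"
  proof (rule ideal_power_Suc_least[OF is_ideal_quotient[OF is_ideal_ideal_power]])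
    fix u v assume "u \<in> I" "v \<in> ideal_power I s"
    then have "u * (v * b) \<in> ideal_power I (Suc (s + r))"
      using Suc by (intro ideal_power_Suc_mult) auto
    then show "u * v \<in> {a. a * b \<in> ideal_power I (Suc s + r)}"
      by (simp only: mult.assoc mem_Collect_eq add_Suc)
  qed
  then show ?case using Suc.prems by blast
qed

lemma ideal_power_mono: "I \<subseteq> J \<Longrightarrow> ideal_power I s \<subseteq> ideal_power J s"
proof (induction s)
  case (Suc s)
  show ?case
    by (rule ideal_power_Suc_least[OF is_ideal_ideal_power])
      (use Suc in \<open>blast intro: ideal_power_Suc_mult\<close>)
qed simp

lemma ideal_power_Suc_subset: "ideal_power I (Suc s) \<subseteq> ideal_power I s"
  by (rule ideal_power_Suc_least[OF is_ideal_ideal_power])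
    (rule ideal_mult_left[OF is_ideal_ideal_power])

lemma ideal_power_antimono: "s \<le> r \<Longrightarrow> ideal_power I r \<subseteq> ideal_power I s"
  by (induction r rule: dec_induct) (use ideal_power_Suc_subset in blast)+

lemma power_in_ideal_power: "a \<in> ideal_power I s \<Longrightarrow> a ^ e \<in> ideal_power I (e * s)"
  by (induction e) (auto intro: ideal_power_mult)

lemma prime_is_ideal: "is_prime_ideal P \<Longrightarrow> is_ideal P"
  by (simp add: is_prime_ideal_def)

lemma prime_ideal_one: "is_prime_ideal P \<Longrightarrow> 1 \<notin> P"
  unfolding is_prime_ideal_def using ideal_mult_left[of P 1] by auto

lemma prime_ideal_mult: "is_prime_ideal P \<Longrightarrow> a * b \<in> P \<longleftrightarrow> a \<in> P \<or> b \<in> P"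
  unfolding is_prime_ideal_def using ideal_mult_left ideal_mult_right by blast

lemma prime_ideal_power: "is_prime_ideal P \<Longrightarrow> a ^ e \<in> P \<Longrightarrow> a \<in> P"
  by (induction e) (auto simp: prime_ideal_one prime_ideal_mult)

lemma prime_ideal_prod:
  assumes "is_prime_ideal P" "finite F"
  shows "prod h F \<in> P \<longleftrightarrow> (\<exists>i\<in>F. h i \<in> P)"
  using assms(2,1) by (induction F rule: finite_induct)
    (auto simp: prime_ideal_one prime_ideal_mult)

section \<open>Minimal primes\<close>

definition nilpotent_at :: "'a::comm_ring_1 set \<Rightarrow> 'a set \<Rightarrow> bool" where
  "nilpotent_at Q I \<longleftrightarrow> (\<forall>q\<in>Q. \<exists>h e. h \<notin> Q \<and> h * q ^ e \<in> I)"

lemma is_ideal_Union_chain: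
  assumes "\<C> \<noteq> {}" "\<And>J. J \<in> \<C> \<Longrightarrow> is_ideal J" "\<And>J K. J \<in> \<C> \<Longrightarrow> K \<in> \<C> \<Longrightarrow> J \<subseteq> K \<or> K \<subseteq> J"
  shows "is_ideal (\<Union>\<C>)"
  unfolding is_ideal_def
proof (intro conjI ballI allI)
  show "0 \<in> \<Union>\<C>" using assms(1,2) ideal_zero by blast
  fix a b assume "a \<in> \<Union>\<C>" "b \<in> \<Union>\<C>"
  then obtain J K where "J \<in> \<C>" "a \<in> J" "K \<in> \<C>" "b \<in> K" by auto
  then obtain L where "L \<in> \<C>" "a \<in> L" "b \<in> L" using assms(3)[of J K] by blast
  then show "a + b \<in> \<Union>\<C>" using assms(2) ideal_add by blast
next
  fix r a assume "a \<in> \<Union>\<C>"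
  then show "r * a \<in> \<Union>\<C>" using assms(2) ideal_mult_left by blast
qed

lemma exists_maximal_disjoint_ideal:
  assumes "is_ideal I" "I \<inter> M = {}"
  shows "\<exists>P. is_ideal P \<and> I \<subseteq> P \<and> P \<inter> M = {} \<and>
    (\<forall>J. is_ideal J \<longrightarrow> P \<subseteq> J \<longrightarrow> J \<inter> M = {} \<longrightarrow> J = P)"
proof -
  let ?\<A> = "{J. is_ideal J \<and> I \<subseteq> J \<and> J \<inter> M = {}}"
  have "\<exists>P\<in>?\<A>. \<forall>J\<in>?\<A>. P \<subseteq> J \<longrightarrow> J = P"
  proof (rule subset_Zorn_nonempty)
    show "?\<A> \<noteq> {}" using assms by blast
    fix \<C> assume \<C>: "\<C> \<noteq> {}" "subset.chain ?\<A> \<C>"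
    have "is_ideal (\<Union>\<C>)"
      by (rule is_ideal_Union_chain[OF \<C>(1)]) (use \<C>(2) in \<open>auto simp: subset_chain_def\<close>)
    then show "\<Union>\<C> \<in> ?\<A>" using \<C> by (fastforce simp: subset_chain_def)
  qed
  then obtain P where "P \<in> ?\<A>" and "\<forall>J\<in>?\<A>. P \<subseteq> J \<longrightarrow> J = P" by (rule bexE)
  then show ?thesis by (intro exI[of _ P]) auto
qed

lemma is_ideal_adjoin:
  assumes P: "is_ideal P"
  shows "is_ideal {p + r * x | p r. p \<in> P}" (is "is_ideal ?X")
  unfolding is_ideal_def
proof (intro conjI ballI allI)
  show "0 \<in> ?X" using ideal_zero[OF P] by (auto intro!: exI[of _ 0])
  fix u v assume "u \<in> ?X" "v \<in> ?X"
  then obtain p r p' r' where "u = p + r * x" "v = p' + r' * x" "p \<in> P" "p' \<in> P" by auto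
  then have "u + v = (p + p') + (r + r') * x" "p + p' \<in> P"
    by (auto simp: algebra_simps ideal_add[OF P])
  then show "u + v \<in> ?X" by blast
next
  fix s u assume "u \<in> ?X"
  then obtain p r where "u = p + r * x" "p \<in> P" by auto
  then have "s * u = s * p + (s * r) * x" "s * p \<in> P"
    by (auto simp: distrib_left mult.assoc ideal_mult_left[OF P])
  then show "s * u \<in> ?X" by blast
qed

lemma prime_of_maximal_disjoint:
  assumes P: "is_ideal P" "P \<inter> M = {}"
    and maximal: "\<And>J. is_ideal J \<Longrightarrow> P \<subseteq> J \<Longrightarrow> J \<inter> M = {} \<Longrightarrow> J = P"
    and M: "M \<noteq> {}" "\<And>x y. x \<in> M \<Longrightarrow> y \<in> M \<Longrightarrow> x * y \<in> M"
  shows "is_prime_ideal P"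
proof -
  have meets: "\<exists>p r. p \<in> P \<and> p + r * x \<in> M" if x: "x \<notin> P" for x
  proof (rule ccontr)
    assume "\<not> ?thesis"
    then have disj: "{p + r * x | p r. p \<in> P} \<inter> M = {}" by auto
    have "p \<in> {p + r * x | p r. p \<in> P}" if "p \<in> P" for p
      using that by (intro CollectI exI[of _ p] exI[of _ 0]) simp
    then have "{p + r * x | p r. p \<in> P} = P"
      by (intro maximal is_ideal_adjoin P disj) blast
    moreover have "0 + 1 * x \<in> {p + r * x | p r. p \<in> P}" using ideal_zero[OF P(1)] by blast
    ultimately show False using x by simp
  qed
  have "a \<in> P \<or> b \<in> P" if ab: "a * b \<in> P" for a b
  proof (rule ccontr)
    assume "\<not> (a \<in> P \<or> b \<in> P)"
    then obtain p r p' r' where pr: "p \<in> P" "p + r * a \<in> M" "p' \<in> P" "p' + r' * b \<in> M"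
      using meets by meson
    have "(p + r * a) * (p' + r' * b) = (p' + r' * b) * p + (r * a) * p' + (r * r') * (a * b)"
      by (simp add: algebra_simps)
    also have "\<dots> \<in> P" by (intro ideal_add[OF P(1)] ideal_mult_left[OF P(1)] pr ab)
    finally show False using M(2)[OF pr(2,4)] P(2) by blast
  qed
  then show ?thesis using P M(1) by (auto simp: is_prime_ideal_def)
qed

lemma nilpotent_at_minimal_prime:
  assumes Q: "is_prime_ideal Q" and I: "is_ideal I"
    and minimal: "\<And>P. is_prime_ideal P \<Longrightarrow> I \<subseteq> P \<Longrightarrow> P \<subseteq> Q \<Longrightarrow> P = Q"
  shows "nilpotent_at Q I"
proof (unfold nilpotent_at_def, rule ballI, rule ccontr)
  fix q assume q: "q \<in> Q" and neg: "\<not> (\<exists>h e. h \<notin> Q \<and> h * q ^ e \<in> I)"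
  let ?M = "{h * q ^ e | h e. h \<notin> Q}"
  have "I \<inter> ?M = {}" using neg by auto
  from exists_maximal_disjoint_ideal[OF I this] obtain P where P: "is_ideal P" "I \<subseteq> P" "P \<inter> ?M = {}"
    and maximal: "\<And>J. is_ideal J \<Longrightarrow> P \<subseteq> J \<Longrightarrow> J \<inter> ?M = {} \<Longrightarrow> J = P"
    by (elim exE conjE) simp
  have "h \<in> ?M" if "h \<notin> Q" for h
    using that by (intro CollectI exI[of _ h] exI[of _ 0]) simp
  then have PQ: "P \<subseteq> Q" using P(3) by blast
  have q_in: "q \<in> ?M"
    using prime_ideal_one[OF Q] by (intro CollectI exI[of _ 1]) simp
  have "is_prime_ideal P"
  proof (rule prime_of_maximal_disjoint[OF P(1,3) maximal])
    show "?M \<noteq> {}" using q_in by blast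
    fix x y assume "x \<in> ?M" "y \<in> ?M"
    then obtain h e h' e' where "x = h * q ^ e" "y = h' * q ^ e'" "h \<notin> Q" "h' \<notin> Q" by auto
    then have "x * y = (h * h') * q ^ (e + e')" "h * h' \<notin> Q"
      by (auto simp: power_add algebra_simps prime_ideal_mult[OF Q])
    then show "x * y \<in> ?M" by blast
  qed
  from minimal[OF this P(2) PQ] show False using q q_in P(3) by blast
qed

text \<open>Elements of the \<open>s\<close>-th power of \<open>I\<close> whose class in the associated graded ring of \<open>I\<close> becomes
  nilpotent after localization at \<open>Q\<close>.\<close>

definition nilpotent_forms :: "'a::comm_ring_1 set \<Rightarrow> 'a set \<Rightarrow> nat \<Rightarrow> 'a set" where
  "nilpotent_forms Q I s =
     {f \<in> ideal_power I s. \<exists>h e. h \<notin> Q \<and> h * f ^ e \<in> ideal_power I (e * s + 1)}"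

lemma nilpotent_formsI:
  "f \<in> ideal_power I s \<Longrightarrow> h \<notin> Q \<Longrightarrow> h * f ^ e \<in> ideal_power I (e * s + 1) \<Longrightarrow>
     f \<in> nilpotent_forms Q I s"
  by (auto simp: nilpotent_forms_def)

lemma nilpotent_formsE:
  assumes "f \<in> nilpotent_forms Q I s"
  obtains h e where "f \<in> ideal_power I s" "h \<notin> Q" "h * f ^ e \<in> ideal_power I (e * s + 1)"
  using assms by (auto simp: nilpotent_forms_def)

lemma nilpotent_form_power_mult:
  assumes "f \<in> ideal_power I s" "h * f ^ e \<in> ideal_power I (e * s + 1)" "e \<le> k"
    and "f' \<in> ideal_power I s"
  shows "h * (f ^ k * f' ^ r) \<in> ideal_power I ((k + r) * s + 1)"
proof -
  have "f ^ k = f ^ e * f ^ (k - e)" using assms(3) by (simp add: power_add[symmetric])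
  then have "h * (f ^ k * f' ^ r) = (h * f ^ e) * (f ^ (k - e) * f' ^ r)" by (simp only: mult.assoc)
  also have "\<dots> \<in> ideal_power I ((e * s + 1) + ((k - e) * s + r * s))"
    by (intro ideal_power_mult power_in_ideal_power assms)
  also have "(e * s + 1) + ((k - e) * s + r * s) = (k + r) * s + 1"
    using assms(3) by (simp add: add_mult_distrib[symmetric])
  finally show ?thesis .
qed

lemma nilpotent_forms_add:
  assumes Q: "is_prime_ideal Q" and "f \<in> nilpotent_forms Q I s" "f' \<in> nilpotent_forms Q I s"
  shows "f + f' \<in> nilpotent_forms Q I s"
proof -
  note ideal = is_ideal_ideal_power[of I]
  obtain h e where f: "f \<in> ideal_power I s" "h \<notin> Q" "h * f ^ e \<in> ideal_power I (e * s + 1)"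
    using assms(2) by (rule nilpotent_formsE)
  obtain h' e' where f': "f' \<in> ideal_power I s" "h' \<notin> Q" "h' * f' ^ e' \<in> ideal_power I (e' * s + 1)"
    using assms(3) by (rule nilpotent_formsE)
  let ?n = "e + e'"
  have summand: "h * h' * (f ^ k * f' ^ (?n - k)) \<in> ideal_power I (?n * s + 1)" if "k \<le> ?n" for k
  proof (cases "e \<le> k")
    case True
    then have "h * (f ^ k * f' ^ (?n - k)) \<in> ideal_power I (?n * s + 1)"
      using nilpotent_form_power_mult[OF f(1,3) True f'(1), of "?n - k"] that by simp
    from ideal_mult_left[OF ideal this, of h'] show ?thesis by (simp add: ac_simps)
  next
    case False
    then have "h' * (f' ^ (?n - k) * f ^ k) \<in> ideal_power I (?n * s + 1)"
      using nilpotent_form_power_mult[OF f'(1,3) _ f(1), of "?n - k" k] that by simp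
    from ideal_mult_left[OF ideal this, of h] show ?thesis by (simp add: ac_simps)
  qed
  have "(h * h') * (f + f') ^ ?n =
      (\<Sum>k\<le>?n. of_nat (?n choose k) * (h * h' * (f ^ k * f' ^ (?n - k))))"
    unfolding binomial_ring by (simp add: sum_distrib_left algebra_simps)
  also have "\<dots> \<in> ideal_power I (?n * s + 1)"
    by (intro ideal_sum[OF ideal] ideal_mult_left[OF ideal] summand) simp
  finally show ?thesis
    using f f' by (intro nilpotent_formsI[of _ _ _ "h * h'" _ ?n] ideal_add[OF ideal])
      (simp_all add: prime_ideal_mult[OF Q])
qed

lemma is_ideal_nilpotent_forms:
  assumes Q: "is_prime_ideal Q"
  shows "is_ideal (nilpotent_forms Q I s)"
  unfolding is_ideal_def
proof (intro conjI ballI allI)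
  note ideal = is_ideal_ideal_power[of I]
  show "0 \<in> nilpotent_forms Q I s"
    using prime_ideal_one[OF Q] ideal_zero[OF ideal]
    by (intro nilpotent_formsI[of _ _ _ 1 _ 1]) auto
  fix r f assume "f \<in> nilpotent_forms Q I s"
  then obtain h e where f: "f \<in> ideal_power I s" "h \<notin> Q" "h * f ^ e \<in> ideal_power I (e * s + 1)"
    by (rule nilpotent_formsE)
  have "h * (r * f) ^ e = r ^ e * (h * f ^ e)" by (simp add: power_mult_distrib algebra_simps)
  then show "r * f \<in> nilpotent_forms Q I s"
    using f ideal_mult_left[OF ideal] by (intro nilpotent_formsI[of _ _ _ h _ e]) auto
qed (rule nilpotent_forms_add[OF Q])

lemma nilpotent_forms_cancel:
  assumes Q: "is_prime_ideal Q" and "b \<notin> Q" "f \<in> ideal_power I s" "b * f \<in> nilpotent_forms Q I s"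
  shows "f \<in> nilpotent_forms Q I s"
proof -
  obtain h e where h: "h \<notin> Q" "h * (b * f) ^ e \<in> ideal_power I (e * s + 1)"
    using assms(4) by (rule nilpotent_formsE)
  then have "(h * b ^ e) * f ^ e \<in> ideal_power I (e * s + 1)"
    by (simp add: power_mult_distrib mult.assoc)
  moreover have "h * b ^ e \<notin> Q"
    using h(1) assms(2) prime_ideal_mult[OF Q] prime_ideal_power[OF Q] by blast
  ultimately show ?thesis using assms(3) by (intro nilpotent_formsI)
qed

lemma ideal_power_Suc_subset_nilpotent_forms:
  assumes Q: "is_prime_ideal Q"
  shows "ideal_power I (Suc s) \<subseteq> nilpotent_forms Q I s"
proof
  fix f assume "f \<in> ideal_power I (Suc s)"
  then show "f \<in> nilpotent_forms Q I s"
    using prime_ideal_one[OF Q] ideal_power_Suc_subset[of I s]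
    by (intro nilpotent_formsI[of _ _ _ 1 _ 1]) auto
qed

lemma nilpotent_at_mult_nilpotent_forms:
  assumes "nilpotent_at Q I" "q \<in> Q" "f \<in> ideal_power I s"
  shows "q * f \<in> nilpotent_forms Q I s"
proof -
  obtain h e where h: "h \<notin> Q" "h * q ^ e \<in> I" using assms(1,2) by (auto simp: nilpotent_at_def)
  have "(h * q ^ e) * f ^ e \<in> ideal_power I (Suc (e * s))"
    by (intro ideal_power_Suc_mult h power_in_ideal_power assms)
  then have "h * (q * f) ^ e \<in> ideal_power I (e * s + 1)"
    by (simp add: power_mult_distrib mult.assoc)
  then show ?thesis
    using h(1) assms(3) by (intro nilpotent_formsI[of _ _ _ h _ e])
      (simp_all add: ideal_mult_left[OF is_ideal_ideal_power])
qed

section \<open>Power products of generators\<close>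

definition power_product :: "'b set \<Rightarrow> ('b \<Rightarrow> 'a::comm_ring_1) \<Rightarrow> ('b \<Rightarrow> nat) \<Rightarrow> 'a" where
  "power_product J g \<alpha> = (\<Prod>i\<in>J. g i ^ \<alpha> i)"

definition weight :: "'b set \<Rightarrow> ('b \<Rightarrow> nat) \<Rightarrow> ('b \<Rightarrow> nat) \<Rightarrow> nat" where
  "weight J w \<alpha> = (\<Sum>i\<in>J. w i * \<alpha> i)"

definition level :: "'b set \<Rightarrow> ('b \<Rightarrow> nat) \<Rightarrow> nat" where
  "level J \<alpha> = (\<Sum>i\<in>J. \<alpha> i)"

definition exponents :: "'b set \<Rightarrow> ('b \<Rightarrow> nat) set" where
  "exponents J = {\<alpha>. \<forall>i. i \<notin> J \<longrightarrow> \<alpha> i = 0}"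

lemma power_product_add: "power_product J g (\<alpha> + \<beta>) = power_product J g \<alpha> * power_product J g \<beta>"
  by (simp add: power_product_def power_add prod.distrib)

lemma power_product_zero [simp]: "power_product J g 0 = 1"
  by (simp add: power_product_def)

lemma power_product_unit: "finite J \<Longrightarrow> j \<in> J \<Longrightarrow> power_product J g (0(j := 1)) = g j"
  by (simp add: power_product_def if_distrib[of "(^) _"] cong: if_cong)

lemma power_product_scale: "power_product J g (\<lambda>i. e * \<alpha> i) = power_product J g \<alpha> ^ e"
  by (simp add: power_product_def prod_power_distrib power_mult[symmetric] mult.commute)

lemma weight_add: "weight J w (\<alpha> + \<beta>) = weight J w \<alpha> + weight J w \<beta>"
  by (simp add: weight_def sum.distrib algebra_simps)

lemma weight_zero [simp]: "weight J w 0 = 0"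
  by (simp add: weight_def)

lemma weight_scale: "weight J w (\<lambda>i. e * \<alpha> i) = e * weight J w \<alpha>"
  by (simp add: weight_def sum_distrib_left mult.left_commute)

lemma level_add: "level J (\<alpha> + \<beta>) = level J \<alpha> + level J \<beta>"
  by (simp add: level_def sum.distrib)

lemma level_zero [simp]: "level J 0 = 0"
  by (simp add: level_def)

lemma level_unit: "finite J \<Longrightarrow> j \<in> J \<Longrightarrow> level J (0(j := 1)) = 1"
  by (simp add: level_def cong: if_cong)

lemma level_scale: "level J (\<lambda>i. e * \<alpha> i) = e * level J \<alpha>"
  by (simp add: level_def sum_distrib_left)

lemma weight_scale_weights: "weight J (\<lambda>i. K * w i) \<alpha> = K * weight J w \<alpha>"
  by (simp add: weight_def sum_distrib_left mult.assoc)

lemma level_ge: "finite J \<Longrightarrow> i \<in> J \<Longrightarrow> \<alpha> i \<le> level J \<alpha>"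
  using member_le_sum[of i J \<alpha>] by (simp add: level_def)

lemma exponents_mono: "J \<subseteq> K \<Longrightarrow> exponents J \<subseteq> exponents K"
  by (auto simp: exponents_def)

lemma zero_in_exponents [simp]: "0 \<in> exponents J"
  by (simp add: exponents_def)

lemma exponents_add: "\<alpha> \<in> exponents J \<Longrightarrow> \<beta> \<in> exponents J \<Longrightarrow> \<alpha> + \<beta> \<in> exponents J"
  by (simp add: exponents_def)

lemma exponents_scale: "\<alpha> \<in> exponents J \<Longrightarrow> (\<lambda>i. e * \<alpha> i) \<in> exponents J"
  by (simp add: exponents_def)

lemma unit_in_exponents: "j \<in> J \<Longrightarrow> 0(j := 1) \<in> exponents J"
  by (auto simp: exponents_def)

lemma exponents_eqI: "\<alpha> \<in> exponents J \<Longrightarrow> \<beta> \<in> exponents J \<Longrightarrow> (\<And>i. i \<in> J \<Longrightarrow> \<alpha> i = \<beta> i) \<Longrightarrow> \<alpha> = \<beta>"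
  unfolding exponents_def by fastforce

lemma power_product_in_ideal_power:
  "power_product J g \<alpha> \<in> ideal_power (ideal_gen (g ` J)) (level J \<alpha>)"
proof -
  let ?I = "ideal_gen (g ` J)"
  have "(\<Prod>i\<in>F. g i ^ \<alpha> i) \<in> ideal_power ?I (\<Sum>i\<in>F. \<alpha> i)" if "F \<subseteq> J" for F
    using that
  proof (induction F rule: infinite_finite_induct)
    case (insert j F)
    have "g j \<in> ideal_power ?I (Suc 0)"
      unfolding ideal_power_one[OF is_ideal_ideal_gen]
      using insert.prems by (intro ideal_gen_base) simp
    from power_in_ideal_power[OF this, of "\<alpha> j"] show ?case
      using insert by (auto intro: ideal_power_mult)
  qed simp_all
  then show ?thesis by (simp add: power_product_def level_def)
qed

lemma ideal_power_subset_power_products: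
  assumes fin: "finite J"
  shows "ideal_power (ideal_gen (g ` J)) s \<subseteq>
      ideal_gen (power_product J g ` {\<nu> \<in> exponents J. level J \<nu> = s})"
proof (induction s)
  case 0
  have "power_product J g 0 \<in> ideal_gen (power_product J g ` {\<nu> \<in> exponents J. level J \<nu> = 0})"
    by (intro ideal_gen_base image_eqI[of _ _ 0]) simp_all
  from ideal_mult_left[OF is_ideal_ideal_gen this] show ?case by auto
next
  case (Suc s)
  show ?case
  proof (rule ideal_power_Suc_least[OF is_ideal_ideal_gen],
      rule ideal_gen_mult[OF is_ideal_ideal_gen])
    fix u v assume "u \<in> g ` J" "v \<in> power_product J g ` {\<nu> \<in> exponents J. level J \<nu> = s}"
    then obtain j \<nu> where j: "j \<in> J" "u = g j"
      and \<nu>: "\<nu> \<in> exponents J" "level J \<nu> = s" "v = power_product J g \<nu>"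
      by auto
    let ?\<nu> = "0(j := 1) + \<nu>"
    have "u * v = power_product J g ?\<nu>"
      by (simp add: power_product_add power_product_unit[OF fin] j \<nu> del: One_nat_def)
    moreover have "?\<nu> \<in> exponents J" by (intro exponents_add unit_in_exponents j \<nu>)
    moreover have "level J ?\<nu> = Suc s"
      by (simp add: level_add level_unit[OF fin j(1)] \<nu>(2) del: One_nat_def)
    ultimately show "u * v \<in> ideal_gen (power_product J g ` {\<nu> \<in> exponents J. level J \<nu> = Suc s})"
      by (intro ideal_gen_base) auto
  qed (use Suc in blast)+
qed

definition lower_forms :: "'b set \<Rightarrow> ('b \<Rightarrow> 'a::comm_ring_1) \<Rightarrow> ('b \<Rightarrow> nat) \<Rightarrow> nat \<Rightarrow> nat \<Rightarrow> 'a set" where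
  "lower_forms J g w s m =
      ideal_gen (power_product J g ` {\<nu> \<in> exponents J. level J \<nu> = s \<and> weight J w \<nu> < m})"

lemma is_ideal_lower_forms: "is_ideal (lower_forms J g w s m)"
  unfolding lower_forms_def by (rule is_ideal_ideal_gen)

lemma power_product_in_lower_forms:
  "\<nu> \<in> exponents J \<Longrightarrow> level J \<nu> = s \<Longrightarrow> weight J w \<nu> < m \<Longrightarrow> power_product J g \<nu> \<in> lower_forms J g w s m"
  unfolding lower_forms_def by (intro ideal_gen_base) auto

lemma lower_forms_mono: "m \<le> m' \<Longrightarrow> lower_forms J g w s m \<subseteq> lower_forms J g w s m'"
  unfolding lower_forms_def
  by (rule ideal_gen_least[OF is_ideal_ideal_gen]) (auto intro!: ideal_gen_base)

lemma lower_forms_mult: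
  assumes "x \<in> lower_forms J g w s m" "y \<in> lower_forms J g w s' (Suc m')"
  shows "x * y \<in> lower_forms J g w (s + s') (m + m')"
proof (rule ideal_gen_mult[OF is_ideal_lower_forms _ assms[unfolded lower_forms_def]])
  fix u v assume "u \<in> power_product J g ` {\<nu> \<in> exponents J. level J \<nu> = s \<and> weight J w \<nu> < m}"
    "v \<in> power_product J g ` {\<nu> \<in> exponents J. level J \<nu> = s' \<and> weight J w \<nu> < Suc m'}"
  then obtain \<nu> \<nu>' where "\<nu> \<in> exponents J" "level J \<nu> = s" "weight J w \<nu> < m"
    "\<nu>' \<in> exponents J" "level J \<nu>' = s'" "weight J w \<nu>' \<le> m'"
    and uv: "u * v = power_product J g (\<nu> + \<nu>')" by (auto simp: power_product_add)
  then show "u * v \<in> lower_forms J g w (s + s') (m + m')"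
    unfolding uv by (intro power_product_in_lower_forms exponents_add)
      (simp_all add: level_add weight_add)
qed

lemma lower_forms_power:
  assumes "x \<in> lower_forms J g w s (Suc m)"
  shows "x ^ k \<in> lower_forms J g w (k * s) (Suc (k * m))"
proof (induction k)
  case 0
  show ?case using power_product_in_lower_forms[of 0 J 0 w 1 g] by simp
next
  case (Suc k)
  from lower_forms_mult[OF assms Suc] show ?case by simp
qed

lemma leading_form_power:
  assumes \<alpha>: "\<alpha> \<in> exponents J" "level J \<alpha> = s" and l: "l \<in> lower_forms J g w s (weight J w \<alpha>)"
  obtains l' where "l' \<in> lower_forms J g w (e * s) (e * weight J w \<alpha>)"
    "(c * power_product J g \<alpha> + l) ^ e = c ^ e * power_product J g (\<lambda>i. e * \<alpha> i) + l'"
proof -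
  let ?L = "lower_forms J g w" and ?m = "weight J w \<alpha>" and ?x = "c * power_product J g \<alpha>"
  let ?l' = "l * (\<Sum>k<e. ?x ^ (e - Suc k) * (?x + l) ^ k)"
  have x: "?x \<in> ?L s (Suc ?m)"
    by (intro ideal_mult_left[OF is_ideal_lower_forms] power_product_in_lower_forms \<alpha>) simp
  have xl: "?x + l \<in> ?L s (Suc ?m)"
    using l lower_forms_mono[of ?m "Suc ?m" J g w s]
    by (intro ideal_add[OF is_ideal_lower_forms] x) auto
  have "?l' \<in> ?L (e * s) (e * ?m)"
  proof (cases e)
    case 0
    then show ?thesis by (simp add: ideal_zero[OF is_ideal_lower_forms])
  next
    case (Suc n)
    have "?x ^ (n - k) * (?x + l) ^ k \<in> ?L (n * s) (Suc (n * ?m))" if "k \<le> n" for k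
      using lower_forms_mult[OF lower_forms_power[OF x, of "n - k"] lower_forms_power[OF xl, of k]]
        that
      by (simp add: add_mult_distrib[symmetric])
    then have "(\<Sum>k<Suc n. ?x ^ (n - k) * (?x + l) ^ k) \<in> ?L (n * s) (Suc (n * ?m))"
      by (intro ideal_sum[OF is_ideal_lower_forms]) simp
    from lower_forms_mult[OF l this] show ?thesis by (simp add: Suc)
  qed
  moreover have "?x ^ e = c ^ e * power_product J g (\<lambda>i. e * \<alpha> i)"
    by (simp add: power_mult_distrib power_product_scale)
  ultimately show thesis
    using power_add_expand[of ?x l e] by (intro that) simp_all
qed

lemma ideal_gen_image_bounded_span:
  fixes G :: "'i \<Rightarrow> ('n::finite, 'k::field) mpoly" and d :: "'i \<Rightarrow> nat"
  assumes "x \<in> ideal_gen (G ` X)"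
  obtains E where "x \<in> mpoly.span {monom \<kappa> * G \<nu> | \<kappa> \<nu>. \<nu> \<in> X \<and> mdeg UNIV \<kappa> + d \<nu> \<le> E}"
proof -
  let ?B = "\<lambda>E. {monom \<kappa> * G \<nu> | \<kappa> \<nu>. \<nu> \<in> X \<and> mdeg UNIV \<kappa> + d \<nu> \<le> E}"
  have mono: "mpoly.span (?B E) \<subseteq> mpoly.span (?B F)" if "E \<le> F" for E F
    using that by (intro mpoly.span_mono) fastforce
  have "is_ideal {x. \<exists>E. x \<in> mpoly.span (?B E)}"
    unfolding is_ideal_def
  proof (intro conjI ballI allI)
    show "0 \<in> {x. \<exists>E. x \<in> mpoly.span (?B E)}" using mpoly.span_zero by blast
    fix a b assume "a \<in> {x. \<exists>E. x \<in> mpoly.span (?B E)}" "b \<in> {x. \<exists>E. x \<in> mpoly.span (?B E)}"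
    then obtain E F where "a \<in> mpoly.span (?B E)" "b \<in> mpoly.span (?B F)" by blast
    then have "a \<in> mpoly.span (?B (max E F))" "b \<in> mpoly.span (?B (max E F))"
      using mono[of E "max E F"] mono[of F "max E F"] by auto
    then show "a + b \<in> {x. \<exists>E. x \<in> mpoly.span (?B E)}" using mpoly.span_add by blast
  next
    fix r a assume "a \<in> {x. \<exists>E. x \<in> mpoly.span (?B E)}"
    then obtain E where a: "a \<in> mpoly.span (?B E)" by blast
    have "r * a \<in> mpoly.span (?B (total_degree r + E))"
    proof (rule subspace_mult_span[OF mpoly.subspace_span a],
        rule subspace_mult_monoms[OF mpoly.subspace_span])
      fix b \<kappa> assume "b \<in> ?B E" "\<kappa> \<in> keys r"
      then obtain \<kappa>' \<nu> where "b = monom \<kappa>' * G \<nu>" "\<nu> \<in> X" "mdeg UNIV \<kappa>' + d \<nu> \<le> E" by blast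
      moreover have "mdeg UNIV \<kappa> \<le> total_degree r"
        using deg_le_total_degree[of r] \<open>\<kappa> \<in> keys r\<close> by (simp add: deg_le_def)
      ultimately show "monom \<kappa> * b \<in> mpoly.span (?B (total_degree r + E))"
        by (intro mpoly.span_base CollectI exI[of _ "\<kappa> + \<kappa>'"] exI[of _ \<nu>])
          (simp add: monom_add mult.assoc)
    qed
    then show "r * a \<in> {x. \<exists>E. x \<in> mpoly.span (?B E)}" by blast
  qed
  moreover have "G \<nu> \<in> {x. \<exists>E. x \<in> mpoly.span (?B E)}" if "\<nu> \<in> X" for \<nu>
    using that by (intro CollectI exI[of _ "d \<nu>"] mpoly.span_base exI[of _ 0] exI[of _ \<nu>]) simp
  ultimately have "ideal_gen (G ` X) \<subseteq> {x. \<exists>E. x \<in> mpoly.span (?B E)}"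
    by (intro ideal_gen_least) auto
  then show thesis using assms that by blast
qed

section \<open>Rewriting power products\<close>

definition power_terms :: "'b set \<Rightarrow> ('b \<Rightarrow> ('n, 'k::comm_ring_1) mpoly) \<Rightarrow> nat \<Rightarrow>
    (('n \<Rightarrow>\<^sub>0 nat) \<Rightarrow> ('b \<Rightarrow> nat) \<Rightarrow> bool) \<Rightarrow> ('n, 'k) mpoly set" where
  "power_terms J g s P =
     {monom \<kappa> * power_product J g \<nu> | \<kappa> \<nu>. \<nu> \<in> exponents J \<and> level J \<nu> = s \<and> P \<kappa> \<nu>}"

lemma span_power_terms_mult:
  fixes p :: "('n::finite, 'k::field) mpoly"
  assumes "x \<in> mpoly.span (power_terms J g s P)"
    and "\<And>\<kappa> \<kappa>' \<nu>. \<kappa>' \<in> keys p \<Longrightarrow> P \<kappa> \<nu> \<Longrightarrow> P' (\<kappa>' + \<kappa>) \<nu>"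
  shows "p * x \<in> mpoly.span (power_terms J g s P')"
proof (rule subspace_mult_span[OF mpoly.subspace_span assms(1)],
    rule subspace_mult_monoms[OF mpoly.subspace_span])
  fix b \<kappa>' assume "b \<in> power_terms J g s P" "\<kappa>' \<in> keys p"
  then show "monom \<kappa>' * b \<in> mpoly.span (power_terms J g s P')"
    using assms(2) unfolding power_terms_def
    by (intro mpoly.span_base) (force simp: monom_add mult.assoc)
qed

text \<open>After multiplication by \<open>A * H\<close>, the term with exponents \<open>\<gamma>\<close> and \<open>\<alpha>\<close> becomes a combination of
  terms of the same level but of smaller weighted degree, up to terms of higher level.\<close>

definition rewrite_rule :: "'n set \<Rightarrow> 'b set \<Rightarrow> ('b \<Rightarrow> ('n::finite, 'k::field) mpoly) \<Rightarrow> ('b \<Rightarrow> nat) \<Rightarrow>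
    nat \<Rightarrow> ('n, 'k) mpoly \<Rightarrow> ('n, 'k) mpoly \<Rightarrow> ('n \<Rightarrow>\<^sub>0 nat) \<Rightarrow> ('b \<Rightarrow> nat) \<Rightarrow> bool" where
  "rewrite_rule Y J g w E A H \<gamma> \<alpha> \<longleftrightarrow>
     (\<exists>x \<in> mpoly.span (power_terms J g (level J \<alpha>)
         (\<lambda>\<kappa> \<nu>. mdeg UNIV \<kappa> \<le> E \<and> mdeg (- Y) \<kappa> + weight J w \<nu> < mdeg (- Y) \<gamma> + weight J w \<alpha>)).
      \<exists>y \<in> mpoly.span (power_terms J g (Suc (level J \<alpha>)) (\<lambda>\<kappa> \<nu>. mdeg UNIV \<kappa> + weight J w \<nu> \<le> E)).
        A * H * (monom \<gamma> * power_product J g \<alpha>) = H * x + y)"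

lemma rewrite_rule_mult:
  fixes A' H' :: "('n::finite, 'k::field) mpoly"
  assumes "rewrite_rule Y J g w E A H \<gamma> \<alpha>" and A': "A' \<in> poly_ring Y"
    and F: "deg_le UNIV F A'" "deg_le UNIV F (A' * H')"
  shows "rewrite_rule Y J g w (F + E) (A * A') (H * H') \<gamma> \<alpha>"
proof -
  let ?lower = "\<lambda>\<kappa> \<nu>. mdeg (- Y) \<kappa> + weight J w \<nu> < mdeg (- Y) \<gamma> + weight J w \<alpha>"
  obtain x y where x:
      "x \<in> mpoly.span (power_terms J g (level J \<alpha>) (\<lambda>\<kappa> \<nu>. mdeg UNIV \<kappa> \<le> E \<and> ?lower \<kappa> \<nu>))"
    and y: "y \<in> mpoly.span (power_terms J g (Suc (level J \<alpha>))
        (\<lambda>\<kappa> \<nu>. mdeg UNIV \<kappa> + weight J w \<nu> \<le> E))"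
    and eq: "A * H * (monom \<gamma> * power_product J g \<alpha>) = H * x + y"
    using assms(1) unfolding rewrite_rule_def by blast
  have "A' * x \<in> mpoly.span (power_terms J g (level J \<alpha>) (\<lambda>\<kappa> \<nu>. mdeg UNIV \<kappa> \<le> F + E \<and> ?lower \<kappa> \<nu>))"
    using A' F(1) by (intro span_power_terms_mult[OF x])
      (auto simp: poly_ring_iff deg_le_def intro: add_mono)
  moreover have "(A' * H') * y \<in> mpoly.span (power_terms J g (Suc (level J \<alpha>))
      (\<lambda>\<kappa> \<nu>. mdeg UNIV \<kappa> + weight J w \<nu> \<le> F + E))"
    using F(2) by (intro span_power_terms_mult[OF y])
      (auto simp: deg_le_def add.assoc intro: add_mono)
  moreover have "A * A' * (H * H') * (monom \<gamma> * power_product J g \<alpha>) =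
      H * H' * (A' * x) + (A' * H') * y"
  proof -
    have "A * A' * (H * H') * (monom \<gamma> * power_product J g \<alpha>) =
        A' * H' * (A * H * (monom \<gamma> * power_product J g \<alpha>))" by (simp only: ac_simps)
    then show ?thesis unfolding eq by (simp add: algebra_simps)
  qed
  ultimately show ?thesis unfolding rewrite_rule_def by blast
qed

lemma rewrite_rule_mono:
  assumes "rewrite_rule Y J g w E A H \<gamma> \<alpha>" "E \<le> F"
  shows "rewrite_rule Y J g w F A H \<gamma> \<alpha>"
  using rewrite_rule_mult[OF assms(1), of 1 "F - E" 1] assms(2) by simp

lemma box_card:
  fixes b :: "'n::finite \<Rightarrow> nat"
  shows "finite {\<gamma> :: 'n \<Rightarrow>\<^sub>0 nat. \<forall>i. lookup \<gamma> i < b i}"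
    and "card {\<gamma> :: 'n \<Rightarrow>\<^sub>0 nat. \<forall>i. lookup \<gamma> i < b i} = (\<Prod>i\<in>UNIV. b i)"
proof -
  let ?B = "{\<gamma> :: 'n \<Rightarrow>\<^sub>0 nat. \<forall>i. lookup \<gamma> i < b i}" and ?P = "PiE UNIV (\<lambda>i. {..<b i})"
  have "inj_on lookup ?B" by (rule inj_onI) (simp only: poly_mapping_eq_iff)
  moreover have "lookup ` ?B = ?P"
  proof (intro equalityI subsetI)
    fix f assume "f \<in> ?P"
    then show "f \<in> lookup ` ?B"
      by (intro image_eqI[of _ _ "Abs_poly_mapping f"]) (auto simp: PiE_iff)
  qed (auto simp: PiE_iff)
  ultimately have bij: "bij_betw lookup ?B ?P" by (rule bij_betw_imageI)
  show "finite ?B" using bij_betw_finite[OF bij] by (simp add: finite_PiE)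
  show "card ?B = (\<Prod>i\<in>UNIV. b i)" using bij_betw_same_card[OF bij] by (simp add: card_PiE)
qed

lemma prod_if_mem:
  fixes b :: "'n::finite \<Rightarrow> nat"
  shows "(\<Prod>i\<in>UNIV. if i \<in> Y then c else b i) = c ^ card Y * (\<Prod>i\<in>-Y. b i)"
  by (simp add: prod.If_cases Compl_eq)

lemma exponents_box:
  assumes "finite J"
  shows "finite {\<alpha> \<in> exponents J. \<forall>i\<in>J. \<alpha> i < b i}"
    and "card {\<alpha> \<in> exponents J. \<forall>i\<in>J. \<alpha> i < b i} \<le> (\<Prod>i\<in>J. b i)"
proof -
  let ?X = "{\<alpha> \<in> exponents J. \<forall>i\<in>J. \<alpha> i < b i}" and ?P = "PiE J (\<lambda>i. {..<b i})"
  have fin: "finite ?P" using assms by (simp add: finite_PiE)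
  have inj: "inj_on (\<lambda>\<alpha>. restrict \<alpha> J) ?X"
  proof (rule inj_onI)
    fix \<alpha> \<beta> assume "\<alpha> \<in> ?X" "\<beta> \<in> ?X" and eq: "restrict \<alpha> J = restrict \<beta> J"
    moreover have "\<alpha> i = \<beta> i" if "i \<in> J" for i using fun_cong[OF eq, of i] that by simp
    ultimately show "\<alpha> = \<beta>" by (intro exponents_eqI[of \<alpha> J \<beta>]) auto
  qed
  have sub: "(\<lambda>\<alpha>. restrict \<alpha> J) ` ?X \<subseteq> ?P" by auto
  show "finite ?X" by (rule finite_imageD[OF finite_subset[OF sub fin] inj])
  show "card ?X \<le> (\<Prod>i\<in>J. b i)" using card_inj_on_le[OF inj sub fin] assms by (simp add: card_PiE)
qed

lemma finite_exponents_level_less: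
  assumes "finite J"
  shows "finite {\<alpha> \<in> exponents J. level J \<alpha> < S}"
proof -
  have "{\<alpha> \<in> exponents J. level J \<alpha> < S} \<subseteq> {\<alpha> \<in> exponents J. \<forall>i\<in>J. \<alpha> i < S}"
    using level_ge[OF assms] by (auto intro: le_less_trans)
  then show ?thesis by (rule finite_subset) (rule exponents_box(1)[OF assms])
qed

locale rewriting_system =
  fixes Y :: "'n::finite set" and J :: "'b set" and g :: "'b \<Rightarrow> ('n, 'k::field) mpoly"
    and w :: "'b \<Rightarrow> nat" and E :: nat and A H :: "('n, 'k) mpoly"
    and e :: "'n \<Rightarrow> nat" and M :: "('b \<Rightarrow> nat) set"
  assumes finite_generators: "finite J"
    and multiplier_in_poly_ring: "A \<in> poly_ring Y"
    and multiplier_degree: "deg_le UNIV E A"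
    and variable_rule: "i \<notin> Y \<Longrightarrow> rewrite_rule Y J g w E A H (single i (e i)) 0"
    and generator_rule: "\<mu> \<in> M \<Longrightarrow> rewrite_rule Y J g w E A H 0 \<mu>"
begin

abbreviation I :: "('n, 'k) mpoly set" where
  "I \<equiv> ideal_gen (g ` J)"

definition irreducible_exponents :: "nat \<Rightarrow> ('b \<Rightarrow> nat) set" where
  "irreducible_exponents S = {\<alpha> \<in> exponents J. level J \<alpha> < S \<and> (\<forall>\<mu>\<in>M. \<not> \<mu> \<le> \<alpha>)}"

definition scaled_term :: "nat \<Rightarrow> nat \<Rightarrow> ('n \<Rightarrow>\<^sub>0 nat) \<Rightarrow> ('b \<Rightarrow> nat) \<Rightarrow> ('n, 'k) mpoly" where
  "scaled_term N S \<gamma> \<alpha> = A ^ N * (H ^ (S - level J \<alpha>) * (monom \<gamma> * power_product J g \<alpha>))"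

definition normal_forms :: "nat \<Rightarrow> nat \<Rightarrow> ('n, 'k) mpoly set" where
  "normal_forms S d = {scaled_term 0 S \<gamma> \<alpha> | \<gamma> \<alpha>. \<alpha> \<in> irreducible_exponents S \<and>
     mdeg Y \<gamma> \<le> d \<and> (\<forall>i. i \<notin> Y \<longrightarrow> lookup \<gamma> i < e i)}"

definition reducible_to :: "nat \<Rightarrow> nat \<Rightarrow> ('n, 'k) mpoly set" where
  "reducible_to S d = {x. \<exists>z\<in>mpoly.span (normal_forms S d). x - z \<in> ideal_power I S}"

lemma subspace_reducible_to: "mpoly.subspace (reducible_to S d)"
  unfolding reducible_to_def
  by (intro mpoly.subspace_span_plus subspace_ideal is_ideal_ideal_power)

lemma reducible_to_mono:
  assumes "d \<le> d'"
  shows "reducible_to S d \<subseteq> reducible_to S d'"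
proof -
  have "normal_forms S d \<subseteq> normal_forms S d'" using assms unfolding normal_forms_def by fastforce
  from mpoly.span_mono[OF this] show ?thesis unfolding reducible_to_def by blast
qed

lemma ideal_power_subset_reducible_to: "ideal_power I S \<subseteq> reducible_to S d"
  unfolding reducible_to_def using mpoly.span_zero by force

lemma normal_forms_subset_reducible_to: "normal_forms S d \<subseteq> reducible_to S d"
  unfolding reducible_to_def using mpoly.span_base ideal_zero[OF is_ideal_ideal_power] by force

lemma high_level_reducible_to:
  assumes "S \<le> level J \<alpha>"
  shows "scaled_term N S \<gamma> \<alpha> \<in> reducible_to S d"
proof -
  have "power_product J g \<alpha> \<in> ideal_power I S"
    using power_product_in_ideal_power ideal_power_antimono[OF assms] by blast
  then have "scaled_term N S \<gamma> \<alpha> \<in> ideal_power I S"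
    unfolding scaled_term_def by (intro ideal_mult_left is_ideal_ideal_power)
  then show ?thesis using ideal_power_subset_reducible_to by blast
qed

lemma irreducible_reducible_to:
  assumes \<alpha>: "\<alpha> \<in> irreducible_exponents S" and \<gamma>: "\<And>i. i \<notin> Y \<Longrightarrow> lookup \<gamma> i < e i"
  shows "scaled_term N S \<gamma> \<alpha> \<in> reducible_to S (mdeg Y \<gamma> + E * N)"
  unfolding scaled_term_def
proof (rule subspace_mult_monoms[OF subspace_reducible_to])
  fix \<kappa> assume \<kappa>: "\<kappa> \<in> keys (A ^ N)"
  have "mdeg Y \<kappa> \<le> E * N"
    using deg_le_power[OF multiplier_degree, of N] \<kappa> mdeg_mono[of Y UNIV \<kappa>]
    by (fastforce simp: deg_le_def mult.commute)
  moreover have "lookup \<kappa> i = 0" if "i \<notin> Y" for i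
    using poly_ring_power[OF multiplier_in_poly_ring, of N] \<kappa> that
    by (auto simp: poly_ring_iff mdeg_eq_0_iff)
  ultimately have "scaled_term 0 S (\<kappa> + \<gamma>) \<alpha> \<in> normal_forms S (mdeg Y \<gamma> + E * N)"
    unfolding normal_forms_def
    using \<alpha> \<gamma> by (intro CollectI exI[of _ "\<kappa> + \<gamma>"] exI[of _ \<alpha>]) (simp add: lookup_add)
  moreover have "monom \<kappa> * (H ^ (S - level J \<alpha>) * (monom \<gamma> * power_product J g \<alpha>)) =
      scaled_term 0 S (\<kappa> + \<gamma>) \<alpha>"
    by (simp add: scaled_term_def monom_add ac_simps)
  ultimately show "monom \<kappa> * (H ^ (S - level J \<alpha>) * (monom \<gamma> * power_product J g \<alpha>)) \<in>
      reducible_to S (mdeg Y \<gamma> + E * N)"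
    using normal_forms_subset_reducible_to by auto
qed

lemma scaled_term_mult_reducible_to:
  assumes IH: "\<And>\<gamma> \<alpha>. \<alpha> \<in> exponents J \<Longrightarrow> mdeg (- Y) \<gamma> + weight J w \<alpha> + Suc E * (S - level J \<alpha>) \<le> N \<Longrightarrow>
      scaled_term N S \<gamma> \<alpha> \<in> reducible_to S (mdeg Y \<gamma> + Suc E * N)"
    and "\<nu> \<in> exponents J" "\<alpha> \<in> exponents J" and \<kappa>: "mdeg UNIV \<kappa> \<le> E"
    and bound: "mdeg (- Y) (\<kappa> + \<gamma>) + weight J w (\<nu> + \<alpha>) + Suc E * (S - level J (\<nu> + \<alpha>)) \<le> N"
  shows "A ^ N * (H ^ (S - level J (\<nu> + \<alpha>)) * (monom \<gamma> * power_product J g \<alpha>)) *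
    (monom \<kappa> * power_product J g \<nu>) \<in> reducible_to S (mdeg Y \<gamma> + E + Suc E * N)"
proof -
  have "scaled_term N S (\<kappa> + \<gamma>) (\<nu> + \<alpha>) \<in> reducible_to S (mdeg Y (\<kappa> + \<gamma>) + Suc E * N)"
    by (intro IH exponents_add assms(2,3) bound)
  moreover have "mdeg Y (\<kappa> + \<gamma>) + Suc E * N \<le> mdeg Y \<gamma> + E + Suc E * N"
    using \<kappa> mdeg_mono[of Y UNIV \<kappa>] by simp
  ultimately have "scaled_term N S (\<kappa> + \<gamma>) (\<nu> + \<alpha>) \<in> reducible_to S (mdeg Y \<gamma> + E + Suc E * N)"
    using reducible_to_mono by blast
  then show ?thesis by (simp add: scaled_term_def monom_add power_product_add ac_simps)
qed

lemma rule_reducible_to: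
  assumes rule: "rewrite_rule Y J g w E A H \<gamma> \<alpha>" and \<alpha>': "\<alpha>' \<in> exponents J"
    and level: "level J (\<alpha> + \<alpha>') < S"
    and bound: "mdeg (- Y) (\<gamma> + \<gamma>') + weight J w (\<alpha> + \<alpha>') + Suc E * (S - level J (\<alpha> + \<alpha>')) \<le> Suc N"
    and IH: "\<And>\<gamma> \<alpha>. \<alpha> \<in> exponents J \<Longrightarrow> mdeg (- Y) \<gamma> + weight J w \<alpha> + Suc E * (S - level J \<alpha>) \<le> N \<Longrightarrow>
      scaled_term N S \<gamma> \<alpha> \<in> reducible_to S (mdeg Y \<gamma> + Suc E * N)"
  shows "scaled_term (Suc N) S (\<gamma> + \<gamma>') (\<alpha> + \<alpha>') \<in> reducible_to S (mdeg Y (\<gamma> + \<gamma>') + Suc E * Suc N)"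
proof -
  let ?T = "reducible_to S (mdeg Y \<gamma>' + E + Suc E * N)"
  let ?lower = "power_terms J g (level J \<alpha>) (\<lambda>\<kappa> \<nu>. mdeg UNIV \<kappa> \<le> E \<and>
      mdeg (- Y) \<kappa> + weight J w \<nu> < mdeg (- Y) \<gamma> + weight J w \<alpha>)"
  let ?higher = "power_terms J g (Suc (level J \<alpha>)) (\<lambda>\<kappa> \<nu>. mdeg UNIV \<kappa> + weight J w \<nu> \<le> E)"
  obtain x y where x: "x \<in> mpoly.span ?lower" and y: "y \<in> mpoly.span ?higher"
    and eq: "A * H * (monom \<gamma> * power_product J g \<alpha>) = H * x + y"
    using rule unfolding rewrite_rule_def by blast
  obtain s where s: "S - level J (\<alpha> + \<alpha>') = Suc s" using level by (metis Suc_diff_Suc)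
  define u where "u = (\<lambda>r. A ^ N * (H ^ r * (monom \<gamma>' * power_product J g \<alpha>')))"
  have "u (Suc s) * x \<in> ?T"
  proof (rule subspace_mult_span[OF subspace_reducible_to x])
    fix t assume "t \<in> ?lower"
    then obtain \<kappa> \<nu> where t: "t = monom \<kappa> * power_product J g \<nu>" "\<nu> \<in> exponents J"
      "level J \<nu> = level J \<alpha>" "mdeg UNIV \<kappa> \<le> E"
      "mdeg (- Y) \<kappa> + weight J w \<nu> < mdeg (- Y) \<gamma> + weight J w \<alpha>"
      by (auto simp: power_terms_def)
    then have "S - level J (\<nu> + \<alpha>') = Suc s" using s by (simp add: level_add)
    then show "u (Suc s) * t \<in> ?T"
      using scaled_term_mult_reducible_to[OF IH t(2) \<alpha>' t(4)] t(5) bound s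
      by (simp add: u_def t(1) weight_add)
  qed
  moreover have "u s * y \<in> ?T"
  proof (rule subspace_mult_span[OF subspace_reducible_to y])
    fix t assume "t \<in> ?higher"
    then obtain \<kappa> \<nu> where t: "t = monom \<kappa> * power_product J g \<nu>" "\<nu> \<in> exponents J"
      "level J \<nu> = Suc (level J \<alpha>)" "mdeg UNIV \<kappa> + weight J w \<nu> \<le> E" by (auto simp: power_terms_def)
    then have "S - level J (\<nu> + \<alpha>') = s" using s by (simp add: level_add)
    then show "u s * t \<in> ?T"
      using scaled_term_mult_reducible_to[OF IH t(2) \<alpha>', where \<kappa> = \<kappa> and \<gamma> = \<gamma>'] t(4) bound s
        mdeg_mono[of "- Y" UNIV \<kappa>]
      by (simp add: u_def t(1) weight_add)
  qed
  ultimately have "u (Suc s) * x + u s * y \<in> ?T"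
    by (rule mpoly.subspace_add[OF subspace_reducible_to])
  also have "u (Suc s) * x + u s * y = u s * (A * H * (monom \<gamma> * power_product J g \<alpha>))"
    unfolding eq u_def by (simp add: algebra_simps)
  also have "\<dots> = scaled_term (Suc N) S (\<gamma> + \<gamma>') (\<alpha> + \<alpha>')"
    unfolding scaled_term_def s u_def by (simp add: monom_add power_product_add ac_simps)
  finally show ?thesis
    by (rule subsetD[OF reducible_to_mono, rotated]) simp
qed

theorem scaled_term_reducible_to:
  assumes "\<alpha> \<in> exponents J" "mdeg (- Y) \<gamma> + weight J w \<alpha> + Suc E * (S - level J \<alpha>) \<le> N"
  shows "scaled_term N S \<gamma> \<alpha> \<in> reducible_to S (mdeg Y \<gamma> + Suc E * N)"
  using assms
proof (induction N arbitrary: \<gamma> \<alpha>)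
  case 0
  then show ?case by (intro high_level_reducible_to) simp
next
  case (Suc N)
  consider (high) "S \<le> level J \<alpha>"
    | (irreducible) "\<alpha> \<in> irreducible_exponents S" "\<forall>i. i \<notin> Y \<longrightarrow> lookup \<gamma> i < e i"
    | (variable) i where "level J \<alpha> < S" "i \<notin> Y" "e i \<le> lookup \<gamma> i"
    | (generator) \<mu> where "level J \<alpha> < S" "\<mu> \<in> M" "\<mu> \<le> \<alpha>"
    using Suc.prems(1) unfolding irreducible_exponents_def by (force simp: not_less)
  then show ?case
  proof cases
    case high
    then show ?thesis by (rule high_level_reducible_to)
  next
    case irreducible
    then show ?thesis
      using irreducible_reducible_to[of \<alpha> S \<gamma> "Suc N"]
        reducible_to_mono[of "mdeg Y \<gamma> + E * Suc N" "mdeg Y \<gamma> + Suc E * Suc N" S] by auto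
  next
    case variable
    have "single i (e i) + (\<gamma> - single i (e i)) = \<gamma>"
      using variable(3) by (rule single_add_diff_exponent)
    then show ?thesis
      using rule_reducible_to[OF variable_rule[OF variable(2)] Suc.prems(1), of S
          "\<gamma> - single i (e i)" N]
        variable(1) Suc.prems(2) Suc.IH by simp
  next
    case generator
    have "\<mu> + (\<alpha> - \<mu>) = \<alpha>" using generator(3) by (auto simp: le_fun_def)
    moreover have "\<alpha> - \<mu> \<in> exponents J" using Suc.prems(1) by (simp add: exponents_def)
    ultimately show ?thesis
      using rule_reducible_to[OF generator_rule[OF generator(2)], of "\<alpha> - \<mu>" S \<gamma> N]
        generator(1) Suc.prems(2) Suc.IH by simp
  qed
qed

lemma normal_forms_card:
  shows "finite (normal_forms S d)"
    and "card (normal_forms S d) \<le> (d + 1) ^ card Y * (\<Prod>i\<in>-Y. e i) * card (irreducible_exponents S)"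
proof -
  let ?B = "{\<gamma> :: 'n \<Rightarrow>\<^sub>0 nat. \<forall>i. lookup \<gamma> i < (if i \<in> Y then d + 1 else e i)}"
  let ?X = "?B \<times> irreducible_exponents S"
  have "finite (irreducible_exponents S)"
    by (rule finite_subset[OF _ finite_exponents_level_less[OF finite_generators, of S]])
       (auto simp: irreducible_exponents_def)
  then have fin: "finite ?X" by (intro finite_cartesian_product box_card(1))
  have sub: "normal_forms S d \<subseteq> (\<lambda>(\<gamma>, \<alpha>). scaled_term 0 S \<gamma> \<alpha>) ` ?X"
  proof
    fix z assume "z \<in> normal_forms S d"
    then obtain \<gamma> \<alpha> where z: "z = scaled_term 0 S \<gamma> \<alpha>" "\<alpha> \<in> irreducible_exponents S"
      "mdeg Y \<gamma> \<le> d" "\<And>i. i \<notin> Y \<Longrightarrow> lookup \<gamma> i < e i" by (auto simp: normal_forms_def)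
    have "lookup \<gamma> i < d + 1" if "i \<in> Y" for i using lookup_le_mdeg[OF that, of \<gamma>] z(3) by simp
    then show "z \<in> (\<lambda>(\<gamma>, \<alpha>). scaled_term 0 S \<gamma> \<alpha>) ` ?X"
      using z by (intro image_eqI[of _ _ "(\<gamma>, \<alpha>)"]) auto
  qed
  show "finite (normal_forms S d)" by (rule finite_subset[OF sub finite_imageI[OF fin]])
  show "card (normal_forms S d) \<le> (d + 1) ^ card Y * (\<Prod>i\<in>-Y. e i) * card (irreducible_exponents S)"
    using surj_card_le[OF fin sub] by (simp only: card_cartesian_product box_card(2) prod_if_mem)
qed

definition growth :: "nat \<Rightarrow> nat" where
  "growth c = c + Suc E * (c + Suc E * c) + 1"

theorem linear_dependence_mod_ideal_power:
  assumes fin: "finite \<Omega>" and v: "\<And>i. i \<in> \<Omega> \<Longrightarrow> deg_le UNIV (c * \<tau>) (v i)"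
    and S: "S \<le> c * \<tau>" and \<tau>: "1 \<le> \<tau>"
    and card: "(growth c * \<tau>) ^ card Y * (\<Prod>i\<in>-Y. e i) * card (irreducible_exponents S) < card \<Omega>"
  shows "\<exists>a N. (\<exists>i\<in>\<Omega>. a i \<noteq> 0) \<and> A ^ N * H ^ S * (\<Sum>i\<in>\<Omega>. smult (a i) (v i)) \<in> ideal_power I S"
proof -
  define N where "N = c * \<tau> + Suc E * S"
  define d where "d = c * \<tau> + Suc E * N"
  have "Suc E * N \<le> Suc E * (c * \<tau> + Suc E * (c * \<tau>))"
    unfolding N_def by (intro mult_left_mono add_left_mono S) simp_all
  then have d: "d + 1 \<le> growth c * \<tau>" using \<tau> by (simp add: d_def growth_def algebra_simps)
  have "card (normal_forms S d) \<le>
      (growth c * \<tau>) ^ card Y * (\<Prod>i\<in>-Y. e i) * card (irreducible_exponents S)"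
    by (rule order_trans[OF normal_forms_card(2)]) (intro mult_right_mono power_mono d; simp)
  also note card
  finally have less: "card (normal_forms S d) < card \<Omega>" .
  have reduced: "A ^ N * H ^ S * v i \<in> reducible_to S d" if "i \<in> \<Omega>" for i
  proof -
    have "v i * (A ^ N * H ^ S) \<in> reducible_to S d"
    proof (rule subspace_mult_monoms[OF subspace_reducible_to])
      fix \<kappa> assume "\<kappa> \<in> keys (v i)"
      then have "mdeg UNIV \<kappa> \<le> c * \<tau>" using v[OF that] by (simp add: deg_le_def)
      then have "mdeg (- Y) \<kappa> + Suc E * S \<le> N" "mdeg Y \<kappa> + Suc E * N \<le> d"
        using mdeg_mono[of Y UNIV \<kappa>] mdeg_mono[of "- Y" UNIV \<kappa>] by (simp_all add: N_def d_def)
      then have "scaled_term N S \<kappa> 0 \<in> reducible_to S d"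
        using scaled_term_reducible_to[of 0 \<kappa> S N] reducible_to_mono by auto
      then show "monom \<kappa> * (A ^ N * H ^ S) \<in> reducible_to S d"
        by (simp add: scaled_term_def ac_simps)
    qed
    then show ?thesis by (simp only: mult.commute)
  qed
  have "\<exists>a. (\<exists>i\<in>\<Omega>. a i \<noteq> 0) \<and> (\<Sum>i\<in>\<Omega>. smult (a i) (A ^ N * H ^ S * v i)) \<in> ideal_power I S"
    using reduced unfolding reducible_to_def
    by (intro mpoly.nontrivial_relation_mod_subspace[OF normal_forms_card(1) fin less]
        subspace_ideal is_ideal_ideal_power) auto
  then show ?thesis by (simp only: smult_mult_right[symmetric] sum_distrib_left) blast
qed

end

section \<open>Independent sets of variables\<close>

definition indep_mod :: "('n::finite, 'k::comm_ring_1) mpoly set \<Rightarrow> 'n set \<Rightarrow> bool" where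
  "indep_mod Q Y \<longleftrightarrow> Q \<inter> poly_ring Y \<subseteq> {0}"

definition max_indep_mod :: "('n::finite, 'k::comm_ring_1) mpoly set \<Rightarrow> 'n set \<Rightarrow> bool" where
  "max_indep_mod Q Y \<longleftrightarrow> indep_mod Q Y \<and> (\<forall>i. i \<notin> Y \<longrightarrow> \<not> indep_mod Q (insert i Y))"

definition rewritable_at :: "('n::finite, 'k::field) mpoly set \<Rightarrow> 'n set \<Rightarrow> 'b set \<Rightarrow>
    ('b \<Rightarrow> ('n, 'k) mpoly) \<Rightarrow> ('b \<Rightarrow> nat) \<Rightarrow> ('n \<Rightarrow>\<^sub>0 nat) \<Rightarrow> ('b \<Rightarrow> nat) \<Rightarrow> bool" where
  "rewritable_at Q Y J g w \<gamma> \<alpha> \<longleftrightarrow>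
     (\<exists>E A H. A \<in> poly_ring Y \<and> A \<notin> Q \<and> H \<notin> Q \<and> rewrite_rule Y J g w E A H \<gamma> \<alpha>)"

lemma rewritable_atI:
  fixes g :: "'b \<Rightarrow> ('n::finite, 'k::field) mpoly"
  assumes fin: "finite J" and A: "A \<in> poly_ring Y" "A \<notin> Q" and H: "H \<notin> Q"
    and x: "x \<in> mpoly.span (power_terms J g (level J \<alpha>)
        (\<lambda>\<kappa> \<nu>. mdeg UNIV \<kappa> \<le> F \<and> mdeg (- Y) \<kappa> + weight J w \<nu> < mdeg (- Y) \<gamma> + weight J w \<alpha>))"
    and y: "A * H * (monom \<gamma> * power_product J g \<alpha>) - H * x \<in>
        ideal_power (ideal_gen (g ` J)) (Suc (level J \<alpha>))"
  shows "rewritable_at Q Y J g w \<gamma> \<alpha>"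
proof -
  let ?y = "A * H * (monom \<gamma> * power_product J g \<alpha>) - H * x"
  have "?y \<in> ideal_gen (power_product J g ` {\<nu> \<in> exponents J. level J \<nu> = Suc (level J \<alpha>)})"
    using y ideal_power_subset_power_products[OF fin] by blast
  then obtain G where "?y \<in> mpoly.span {monom \<kappa> * power_product J g \<nu> | \<kappa> \<nu>.
      \<nu> \<in> {\<nu> \<in> exponents J. level J \<nu> = Suc (level J \<alpha>)} \<and> mdeg UNIV \<kappa> + weight J w \<nu> \<le> G}"
    by (rule ideal_gen_image_bounded_span)
  then have "1 * ?y \<in> mpoly.span (power_terms J g (Suc (level J \<alpha>))
      (\<lambda>\<kappa> \<nu>. mdeg UNIV \<kappa> + weight J w \<nu> \<le> max F G))"
    by (intro span_power_terms_mult[of _ _ _ _ "\<lambda>\<kappa> \<nu>. mdeg UNIV \<kappa> + weight J w \<nu> \<le> G"])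
       (auto simp: power_terms_def conj_assoc)
  moreover have "1 * x \<in> mpoly.span (power_terms J g (level J \<alpha>)
      (\<lambda>\<kappa> \<nu>. mdeg UNIV \<kappa> \<le> max F G \<and> mdeg (- Y) \<kappa> + weight J w \<nu> < mdeg (- Y) \<gamma> + weight J w \<alpha>))"
    by (intro span_power_terms_mult[OF x]) auto
  moreover have "A * H * (monom \<gamma> * power_product J g \<alpha>) = H * (1 * x) + 1 * ?y" by simp
  ultimately have "rewrite_rule Y J g w (max F G) A H \<gamma> \<alpha>" unfolding rewrite_rule_def by blast
  then show ?thesis using A H unfolding rewritable_at_def by blast
qed

lemma common_multipliers:
  assumes Q: "is_prime_ideal Q" and fin: "finite K"
    and "\<And>\<gamma> \<alpha>. (\<gamma>, \<alpha>) \<in> K \<Longrightarrow> rewritable_at Q Y J g w \<gamma> \<alpha>"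
  obtains E A H where "A \<in> poly_ring Y" "A \<notin> Q" "H \<notin> Q" "deg_le UNIV E A"
    "\<And>\<gamma> \<alpha>. (\<gamma>, \<alpha>) \<in> K \<Longrightarrow> rewrite_rule Y J g w E A H \<gamma> \<alpha>"
proof -
  have "\<exists>E A H. A \<in> poly_ring Y \<and> A \<notin> Q \<and> H \<notin> Q \<and> deg_le UNIV E A \<and>
      (\<forall>(\<gamma>, \<alpha>)\<in>K. rewrite_rule Y J g w E A H \<gamma> \<alpha>)"
    using fin assms(3)
  proof (induction K rule: finite_induct)
    case empty
    show ?case using prime_ideal_one[OF Q] by (intro exI[of _ 0] exI[of _ 1]) simp
  next
    case (insert h K)
    obtain \<gamma>\<^sub>0 \<alpha>\<^sub>0 where h: "h = (\<gamma>\<^sub>0, \<alpha>\<^sub>0)" by (cases h)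
    obtain E A H where old: "A \<in> poly_ring Y" "A \<notin> Q" "H \<notin> Q" "deg_le UNIV E A"
      "\<And>\<gamma> \<alpha>. (\<gamma>, \<alpha>) \<in> K \<Longrightarrow> rewrite_rule Y J g w E A H \<gamma> \<alpha>"
      using insert.IH insert.prems by blast
    obtain E' A' H' where new: "A' \<in> poly_ring Y" "A' \<notin> Q" "H' \<notin> Q"
        "rewrite_rule Y J g w E' A' H' \<gamma>\<^sub>0 \<alpha>\<^sub>0"
      using insert.prems[of \<gamma>\<^sub>0 \<alpha>\<^sub>0] unfolding h rewritable_at_def by blast
    obtain F where F: "\<And>p. p \<in> {A, A * H, A', A' * H', A * A'} \<Longrightarrow> deg_le UNIV F p"
      by (rule finite_deg_le_bound[of "{A, A * H, A', A' * H', A * A'}"]) auto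
    let ?E = "F + max E E'"
    have "rewrite_rule Y J g w ?E (A * A') (H * H') \<gamma> \<alpha>" if "(\<gamma>, \<alpha>) \<in> K" for \<gamma> \<alpha>
      by (rule rewrite_rule_mult[OF rewrite_rule_mono[OF old(5)[OF that]] new(1)]) (auto intro: F)
    moreover have "rewrite_rule Y J g w ?E (A' * A) (H' * H) \<gamma>\<^sub>0 \<alpha>\<^sub>0"
      by (rule rewrite_rule_mult[OF rewrite_rule_mono[OF new(4)] old(1)]) (auto intro: F)
    moreover have "deg_le UNIV ?E (A * A')" by (rule deg_le_weaken[OF F]) auto
    ultimately show ?case
      using old(1-3) new(1-3) unfolding h
      by (intro exI[of _ ?E] exI[of _ "A * A'"] exI[of _ "H * H'"])
         (auto simp: poly_ring_mult prime_ideal_mult[OF Q] mult.commute)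
  qed
  then show thesis using that by blast
qed

locale independent_coordinates =
  fixes Q :: "('n::finite, 'k::field) mpoly set" and Y :: "'n set"
  assumes prime: "is_prime_ideal Q" and max_indep: "max_indep_mod Q Y"
begin

lemma indep: "indep_mod Q Y"
  using max_indep by (simp add: max_indep_mod_def)

lemma notin_if_in_poly_ring: "c \<in> poly_ring Y \<Longrightarrow> c \<noteq> 0 \<Longrightarrow> c \<notin> Q"
  using indep by (auto simp: indep_mod_def)

lemma exists_relation_for_variable:
  assumes "i \<notin> Y"
  shows "\<exists>p\<in>Q. p \<noteq> 0 \<and> p \<in> poly_ring (insert i Y)"
  using max_indep assms by (auto simp: max_indep_mod_def indep_mod_def)

lemma variable_rewritable:
  assumes fin: "finite J" and i: "i \<notin> Y" and p: "p \<in> poly_ring (insert i Y)" "p \<noteq> 0"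
    and H: "H \<notin> Q" "H * p ^ m \<in> ideal_gen (g ` J)"
  obtains e where "\<And>w. rewritable_at Q Y J g w (single i e) 0"
proof -
  obtain e a l where p_eq: "p = a * monom (single i e) + l" and a: "a \<noteq> 0" "a \<in> poly_ring Y"
    and l: "deg_lt (- Y) e l" using leading_term[OF p] by blast
  obtain l' where l': "(a * monom (single i e) + l) ^ m = a ^ m * monom (single i (m * e)) + l'"
    and deg: "deg_lt (- Y) (m * e) l'" by (rule leading_term_power[OF a(2) l i])
  have "a ^ m \<notin> Q" using notin_if_in_poly_ring[OF a(2,1)] prime_ideal_power[OF prime] by blast
  moreover have "- l' \<in> mpoly.span (power_terms J g 0 (\<lambda>\<kappa> \<nu>. mdeg UNIV \<kappa> \<le> total_degree l' \<and>
      mdeg (- Y) \<kappa> + weight J w \<nu> < m * e))" for w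
  proof -
    have "monom \<kappa> \<in> power_terms J g 0 (\<lambda>\<kappa> \<nu>. mdeg UNIV \<kappa> \<le> total_degree l' \<and>
        mdeg (- Y) \<kappa> + weight J w \<nu> < m * e)"
      if "\<kappa> \<in> keys l'" for \<kappa>
      using that deg deg_le_total_degree[of l'] unfolding power_terms_def deg_le_def deg_lt_def
      by (intro CollectI exI[of _ \<kappa>] exI[of _ 0]) simp
    then show ?thesis
      by (subst mpoly_expand[of l'])
        (intro mpoly.span_neg mpoly.span_sum mpoly.span_scale mpoly.span_base)
  qed
  moreover have "a ^ m * H * (monom (single i (m * e)) * power_product J g 0) - H * (- l') \<in>
      ideal_power (ideal_gen (g ` J)) (Suc (level J 0))"
    using H(2) unfolding p_eq l' by (simp add: ideal_power_one is_ideal_ideal_gen algebra_simps)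
  ultimately have "rewritable_at Q Y J g w (single i (m * e)) 0" for w
    using i by (intro rewritable_atI[OF fin poly_ring_power[OF a(2)] _ H(1),
          where x = "- l'" and F = "total_degree l'"])
      simp_all
  then show thesis by (rule that)
qed

lemma coordinate_rewriting_system:
  obtains p e E A H where "rewriting_system Y (- Y) p 0 E A H e {}"
    "p ` (- Y) \<subseteq> Q" "A \<notin> Q" "H \<notin> Q"
proof -
  obtain p where p: "\<And>i. i \<notin> Y \<Longrightarrow> p i \<in> Q \<and> p i \<noteq> 0 \<and> p i \<in> poly_ring (insert i Y)"
    using exists_relation_for_variable by metis
  have "\<exists>e. rewritable_at Q Y (- Y) p 0 (single i e) 0" if i: "i \<notin> Y" for i
  proof -
    have "1 * p i ^ 1 \<in> ideal_gen (p ` (- Y))" using i by (simp add: ideal_gen_base)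
    then obtain e where "\<And>w. rewritable_at Q Y (- Y) p w (single i e) 0"
      using variable_rewritable[OF finite i _ _ prime_ideal_one[OF prime]] p[OF i] by metis
    then show ?thesis by blast
  qed
  then obtain e where e: "\<And>i. i \<notin> Y \<Longrightarrow> rewritable_at Q Y (- Y) p 0 (single i (e i)) 0" by metis
  let ?K = "(\<lambda>i. (single i (e i), 0 :: 'n \<Rightarrow> nat)) ` (- Y)"
  obtain E A H where "A \<in> poly_ring Y" "A \<notin> Q" "H \<notin> Q" "deg_le UNIV E A"
    and "\<And>\<gamma> \<alpha>. (\<gamma>, \<alpha>) \<in> ?K \<Longrightarrow> rewrite_rule Y (- Y) p 0 E A H \<gamma> \<alpha>"
    by (rule common_multipliers[OF prime, of ?K Y "- Y" p 0]) (use e in auto)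
  then have "rewriting_system Y (- Y) p 0 E A H e {}"
    by unfold_locales auto
  then show thesis using that p \<open>A \<notin> Q\<close> \<open>H \<notin> Q\<close> by blast
qed

end

lemma exists_dominating_scale:
  fixes K B m :: nat
  obtains \<tau> where "\<tau> \<ge> 1" "(K * \<tau>) ^ m * B < \<tau> ^ Suc m"
proof
  let ?\<tau> = "K ^ m * B + 1"
  show "?\<tau> \<ge> 1" by simp
  have "(K * ?\<tau>) ^ m * B = (K ^ m * B) * ?\<tau> ^ m" by (simp only: power_mult_distrib ac_simps)
  also have "\<dots> < ?\<tau> * ?\<tau> ^ m" by (intro mult_strict_right_mono) auto
  finally show "(K * ?\<tau>) ^ m * B < ?\<tau> ^ Suc m" by simp
qed

lemma prime_polynomial_relation:
  assumes Q: "is_prime_ideal Q" and a: "a \<notin> Q" and "\<exists>u<\<tau>. q u \<noteq> 0" "(\<Sum>u<\<tau>. q u * a ^ u) \<in> Q"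
  shows "\<exists>u<\<tau>. \<exists>r. q u \<noteq> 0 \<and> q u + a * r \<in> Q"
  using assms(3,4)
proof (induction \<tau> arbitrary: q)
  case (Suc \<tau>)
  have split: "(\<Sum>u<Suc \<tau>. q u * a ^ u) = q 0 + a * (\<Sum>u<\<tau>. q (Suc u) * a ^ u)"
    by (simp add: sum.lessThan_Suc_shift sum_distrib_left algebra_simps del: sum.lessThan_Suc)
  show ?case
  proof (cases "q 0 = 0")
    case True
    then obtain v where "v < \<tau>" "q (Suc v) \<noteq> 0"
      using Suc.prems(1) by (auto simp: less_Suc_eq_0_disj)
    moreover have "(\<Sum>u<\<tau>. q (Suc u) * a ^ u) \<in> Q"
      using Suc.prems(2) a unfolding split True by (simp add: prime_ideal_mult[OF Q])
    ultimately show ?thesis using Suc.IH[of "q \<circ> Suc"] by auto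
  next
    case False
    then show ?thesis using Suc.prems(2) unfolding split by blast
  qed
qed simp

context independent_coordinates
begin

lemma dependent_multiples_of_powers:
  obtains \<tau> D b where "finite D" "\<forall>\<delta>\<in>D. mdeg (- Y) \<delta> = 0"
    "\<exists>i\<in>D \<times> {..<\<tau>}. b i \<noteq> 0" "(\<Sum>(\<delta>, u)\<in>D \<times> {..<\<tau>}. smult (b (\<delta>, u)) (monom \<delta> * a ^ u)) \<in> Q"
proof -
  obtain p e E A H where system: "rewriting_system Y (- Y) p 0 E A H e {}"
    and pQ: "p ` (- Y) \<subseteq> Q" and AH: "A \<notin> Q" "H \<notin> Q" by (rule coordinate_rewriting_system)
  interpret rewriting_system Y "- Y" p 0 E A H e "{}" by (rule system)
  define c where "c = CARD('n) + total_degree a + 1"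
  obtain \<tau> where \<tau>: "\<tau> \<ge> 1"
      "(growth c * \<tau>) ^ card Y * ((\<Prod>i\<in>-Y. e i) * card (irreducible_exponents 1)) < \<tau> ^ Suc (card Y)"
    by (rule exists_dominating_scale)
  define D where "D = {\<gamma> :: 'n \<Rightarrow>\<^sub>0 nat. \<forall>i. lookup \<gamma> i < (if i \<in> Y then \<tau> else 1)}"
  have D: "finite D" "card D = \<tau> ^ card Y"
    unfolding D_def box_card(2) prod_if_mem by (rule box_card(1), simp)
  have deg: "deg_le UNIV (c * \<tau>) (monom \<delta> * a ^ u)" if "\<delta> \<in> D" "u < \<tau>" for \<delta> u
  proof -
    have "lookup \<delta> i \<le> \<tau>" for i
      using that(1) \<tau>(1) by (auto simp: D_def split: if_splits dest!: spec[of _ i])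
    then have "mdeg UNIV \<delta> \<le> CARD('n) * \<tau>"
      unfolding mdeg_def using sum_bounded_above[of UNIV "lookup \<delta>" \<tau>] by simp
    moreover have "u * total_degree a \<le> \<tau> * total_degree a" using that(2) by simp
    moreover have "c * \<tau> = CARD('n) * \<tau> + \<tau> * total_degree a + \<tau>" by (simp add: c_def algebra_simps)
    ultimately have "mdeg UNIV \<delta> + u * total_degree a \<le> c * \<tau>" by linarith
    then show ?thesis
      by (rule deg_le_weaken[OF deg_le_mult[OF _ deg_le_power[OF deg_le_total_degree]], rotated])
         (simp add: deg_le_monom)
  qed
  let ?sum = "\<lambda>b. \<Sum>i\<in>D \<times> {..<\<tau>}. smult (b i) (case i of (\<delta>, u) \<Rightarrow> monom \<delta> * a ^ u)"
  have "1 \<le> c * \<tau>" using \<tau>(1) by (simp add: c_def)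
  then have "\<exists>b N. (\<exists>i\<in>D \<times> {..<\<tau>}. b i \<noteq> 0) \<and> A ^ N * H ^ 1 * ?sum b \<in> ideal_power I 1"
    by (intro linear_dependence_mod_ideal_power[of _ c \<tau>]) (use D \<tau> deg in \<open>auto simp: mult_ac\<close>)
  then obtain b N where b: "\<exists>i\<in>D \<times> {..<\<tau>}. b i \<noteq> 0"
    and mem: "A ^ N * H ^ 1 * ?sum b \<in> ideal_power I 1"
    by blast
  have "I \<subseteq> Q" by (rule ideal_gen_least[OF prime_is_ideal[OF prime] pQ])
  then have "A ^ N * H * ?sum b \<in> Q" using mem by (auto simp: ideal_power_one is_ideal_ideal_gen)
  then have "?sum b \<in> Q" using AH prime_ideal_mult[OF prime] prime_ideal_power[OF prime] by blast
  then have "(\<Sum>(\<delta>, u)\<in>D \<times> {..<\<tau>}. smult (b (\<delta>, u)) (monom \<delta> * a ^ u)) \<in> Q" by (simp add: split_def)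
  moreover have "\<forall>\<delta>\<in>D. mdeg (- Y) \<delta> = 0" by (auto simp: D_def mdeg_eq_0_iff split: if_splits)
  ultimately show thesis using D(1) b by (intro that)
qed

lemma polynomial_relation:
  obtains q \<tau> where "\<And>u. q u \<in> poly_ring Y" "\<exists>u<\<tau>. q u \<noteq> 0" "(\<Sum>u<\<tau>. q u * a ^ u) \<in> Q"
proof -
  obtain \<tau> D b where D: "finite D" "\<forall>\<delta>\<in>D. mdeg (- Y) \<delta> = 0" and b: "\<exists>i\<in>D \<times> {..<\<tau>}. b i \<noteq> 0"
    and mem: "(\<Sum>(\<delta>, u)\<in>D \<times> {..<\<tau>}. smult (b (\<delta>, u)) (monom \<delta> * a ^ u)) \<in> Q"
    by (rule dependent_multiples_of_powers[of a])
  define q where "q = (\<lambda>u. \<Sum>\<delta>\<in>D. smult (b (\<delta>, u)) (monom \<delta>))"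
  have "(\<Sum>(\<delta>, u)\<in>D \<times> {..<\<tau>}. smult (b (\<delta>, u)) (monom \<delta> * a ^ u)) =
      (\<Sum>\<delta>\<in>D. \<Sum>u<\<tau>. smult (b (\<delta>, u)) (monom \<delta>) * a ^ u)"
    by (simp add: sum.cartesian_product smult_mult_left)
  also have "\<dots> = (\<Sum>u<\<tau>. q u * a ^ u)"
    unfolding q_def sum_distrib_right by (rule sum.swap)
  finally have "(\<Sum>u<\<tau>. q u * a ^ u) \<in> Q" using mem by simp
  moreover have "q u \<in> poly_ring Y" for u
    unfolding q_def by (intro poly_ring_sum poly_ring_smult) (simp add: monom_in_poly_ring D(2))
  moreover have "\<exists>u<\<tau>. q u \<noteq> 0"
  proof -
    obtain \<delta> u where \<delta>: "\<delta> \<in> D" "u < \<tau>" "b (\<delta>, u) \<noteq> 0" using b by auto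
    then have "lookup (q u) \<delta> \<noteq> 0" unfolding q_def by (simp add: lookup_sum_smult_monom[OF D(1)])
    then show ?thesis using \<delta>(2) by auto
  qed
  ultimately show thesis by (intro that)
qed

theorem exists_multiple_in_poly_ring:
  assumes "a \<notin> Q"
  obtains c a' where "c \<in> poly_ring Y" "c \<noteq> 0" "c + a * a' \<in> Q"
proof -
  obtain q \<tau> where "\<And>u. q u \<in> poly_ring Y" "\<exists>u<\<tau>. q u \<noteq> 0" "(\<Sum>u<\<tau>. q u * a ^ u) \<in> Q"
    using polynomial_relation by blast
  then show thesis using prime_polynomial_relation[OF prime assms] that by blast
qed

end

section \<open>Height and independent variables\<close>

lemma indep_mod_mono: "indep_mod Q Y \<Longrightarrow> P \<subseteq> Q \<Longrightarrow> indep_mod P Y"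
  by (auto simp: indep_mod_def)

lemma indep_mod_empty:
  fixes Q :: "('n::finite, 'k::field) mpoly set"
  assumes Q: "is_prime_ideal Q"
  shows "indep_mod Q {}"
  unfolding indep_mod_def
proof
  fix p assume p: "p \<in> Q \<inter> poly_ring {}"
  have "lookup p \<gamma> = 0" if "\<gamma> \<noteq> 0" for \<gamma>
  proof (rule ccontr)
    assume "lookup p \<gamma> \<noteq> 0"
    then have "\<gamma> = 0"
      using p by (intro poly_mapping_eqI) (auto simp: poly_ring_iff mdeg_eq_0_iff in_keys_iff)
    then show False using that by simp
  qed
  then have p_eq: "p = const (lookup p 0)"
    by (intro poly_mapping_eqI) (simp add: const_def lookup_single when_def)
  have "lookup p 0 = 0"
  proof (rule ccontr)
    assume "lookup p 0 \<noteq> 0"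
    then have "const (inverse (lookup p 0)) * const (lookup p 0) = (1 :: ('n, 'k) mpoly)"
      by (simp add: const_def mult_single)
    then have "1 \<in> Q" using p p_eq ideal_mult_left[OF prime_is_ideal[OF Q]] by (metis IntD1)
    then show False using prime_ideal_one[OF Q] by simp
  qed
  then show "p \<in> {0}" using p_eq by (simp add: const_def)
qed

definition dimension :: "('n::finite, 'k::comm_ring_1) mpoly set \<Rightarrow> nat" where
  "dimension Q = Max (card ` {Y. indep_mod Q Y})"

lemma dimension_ge: "indep_mod Q Y \<Longrightarrow> card Y \<le> dimension Q"
  unfolding dimension_def by (intro Max_ge) auto

lemma dimension_attained:
  fixes Q :: "('n::finite, 'k::field) mpoly set"
  assumes "is_prime_ideal Q"
  obtains Y where "max_indep_mod Q Y" "card Y = dimension Q"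
proof -
  have "card ` {Y. indep_mod Q Y} \<noteq> {}" using indep_mod_empty[OF assms] by auto
  then have "dimension Q \<in> card ` {Y. indep_mod Q Y}" unfolding dimension_def by (intro Max_in) auto
  then obtain Y where Y: "indep_mod Q Y" "card Y = dimension Q" by auto
  moreover have "\<not> indep_mod Q (insert i Y)" if "i \<notin> Y" for i
    using dimension_ge[of Q "insert i Y"] Y that by auto
  ultimately show thesis using that by (auto simp: max_indep_mod_def)
qed

lemma dimension_le: "is_prime_ideal (Q :: ('n::finite, 'k::field) mpoly set) \<Longrightarrow>
    dimension Q \<le> CARD('n)"
  using dimension_attained by (metis card_mono finite top_greatest)

lemma dimension_strict_antimono:
  fixes P Q :: "('n::finite, 'k::field) mpoly set"
  assumes P: "is_prime_ideal P" and Q: "is_prime_ideal Q" and PQ: "P \<subset> Q"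
  shows "dimension Q < dimension P"
proof -
  obtain Y where Y: "max_indep_mod Q Y" "card Y = dimension Q" by (rule dimension_attained[OF Q])
  then have indep_Q: "indep_mod Q Y" by (simp add: max_indep_mod_def)
  have "\<not> max_indep_mod P Y"
  proof
    assume "max_indep_mod P Y"
    then interpret independent_coordinates P Y by (unfold_locales) (rule P)
    obtain a where a: "a \<in> Q" "a \<notin> P" using PQ by auto
    obtain c a' where c: "c \<in> poly_ring Y" "c \<noteq> 0" "c + a * a' \<in> P"
      by (rule exists_multiple_in_poly_ring[OF a(2)])
    have "(c + a * a') - a * a' \<in> Q"
      using c(3) PQ a(1) by (intro ideal_diff ideal_mult_right prime_is_ideal[OF Q]) auto
    then show False using indep_Q c(1,2) by (auto simp: indep_mod_def)
  qed
  moreover have "indep_mod P Y" using indep_Q PQ by (auto intro: indep_mod_mono)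
  ultimately obtain i where "i \<notin> Y" "indep_mod P (insert i Y)" by (auto simp: max_indep_mod_def)
  then show ?thesis using dimension_ge[of P "insert i Y"] Y by simp
qed

definition coeff_contraction :: "'n \<Rightarrow> ('n, 'k::comm_ring_1) mpoly set \<Rightarrow> ('n, 'k) mpoly set" where
  "coeff_contraction i P = {p. \<forall>a. var_coeff i a p \<in> P}"

lemma coeff_contraction_subset:
  fixes P :: "('n::finite, 'k::comm_ring_1) mpoly set"
  assumes "is_ideal P"
  shows "coeff_contraction i P \<subseteq> P"
proof
  fix p assume "p \<in> coeff_contraction i P"
  then have "(\<Sum>a\<le>total_degree p. var_coeff i a p * monom (single i a)) \<in> P"
    by (intro ideal_sum[OF assms] ideal_mult_right[OF assms]) (simp add: coeff_contraction_def)
  then show "p \<in> P"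
    using var_coeff_expand[OF deg_le_subset[OF deg_le_total_degree[of p]], of i] by simp
qed

lemma coeff_contraction_mult_cancel:
  fixes P :: "('n, 'k::comm_ring_1) mpoly set"
  assumes P: "is_prime_ideal P" and pq: "p * q \<in> coeff_contraction i P"
  shows "p \<in> coeff_contraction i P \<or> q \<in> coeff_contraction i P"
proof (rule ccontr)
  note ideal = prime_is_ideal[OF P]
  assume "\<not> ?thesis"
  then obtain a b where a: "var_coeff i a p \<notin> P" "\<And>a'. a' < a \<Longrightarrow> var_coeff i a' p \<in> P"
    and b: "var_coeff i b q \<notin> P" "\<And>b'. b' < b \<Longrightarrow> var_coeff i b' q \<in> P"
    using exists_least_iff[of "\<lambda>a. var_coeff i a p \<notin> P"]
      exists_least_iff[of "\<lambda>a. var_coeff i a q \<notin> P"]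
    unfolding coeff_contraction_def by blast
  let ?t = "\<lambda>c. var_coeff i c p * var_coeff i (a + b - c) q"
  have "?t c \<in> P" if "c \<in> {..a + b} - {a}" for c
  proof -
    have "c < a \<or> a + b - c < b" using that by auto
    then show ?thesis using a(2) b(2) ideal_mult_left[OF ideal] ideal_mult_right[OF ideal] by blast
  qed
  then have rest: "sum ?t ({..a + b} - {a}) \<in> P" by (rule ideal_sum[OF ideal])
  have "var_coeff i (a + b) (p * q) = ?t a + sum ?t ({..a + b} - {a})"
    unfolding var_coeff_mult by (subst sum.remove[of _ a]) auto
  then have "?t a = var_coeff i (a + b) (p * q) - sum ?t ({..a + b} - {a})" by simp
  also have "\<dots> \<in> P" using pq rest by (intro ideal_diff[OF ideal]) (auto simp: coeff_contraction_def)
  finally show False using a(1) b(1) by (simp add: prime_ideal_mult[OF P])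
qed

lemma prime_coeff_contraction:
  fixes P :: "('n::finite, 'k::comm_ring_1) mpoly set"
  assumes P: "is_prime_ideal P"
  shows "is_prime_ideal (coeff_contraction i P)"
proof -
  note ideal = prime_is_ideal[OF P]
  have "is_ideal (coeff_contraction i P)"
    unfolding is_ideal_def coeff_contraction_def
    by (auto simp: var_coeff_add var_coeff_mult ideal_zero[OF ideal]
        intro!: ideal_add[OF ideal] ideal_sum[OF ideal] ideal_mult_left[OF ideal])
  moreover have "coeff_contraction i P \<noteq> UNIV"
    using coeff_contraction_subset[OF ideal, of i] P by (auto simp: is_prime_ideal_def)
  ultimately show ?thesis
    unfolding is_prime_ideal_def using coeff_contraction_mult_cancel[OF P] by blast
qed

lemma coeff_contraction_step:
  fixes P :: "('n::finite, 'k::field) mpoly set"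
  assumes P: "is_prime_ideal P" and Y: "max_indep_mod P Y" and i: "i \<notin> Y"
  shows "coeff_contraction i P \<subset> P" "max_indep_mod (coeff_contraction i P) (insert i Y)"
proof -
  interpret independent_coordinates P Y using P Y by unfold_locales
  have vanish: "p = 0" if p: "p \<in> coeff_contraction i P" "p \<in> poly_ring (insert i Y)" for p
  proof -
    have "var_coeff i a p = 0" for a
      using p(1) notin_if_in_poly_ring[OF var_coeff_in_poly_ring[OF p(2)]]
      by (auto simp: coeff_contraction_def)
    then show ?thesis
      using var_coeff_expand[OF deg_le_subset[OF deg_le_total_degree[of p]], of i] by simp
  qed
  obtain p where "p \<in> P" "p \<noteq> 0" "p \<in> poly_ring (insert i Y)"
    using exists_relation_for_variable[OF i] by blast
  then show "coeff_contraction i P \<subset> P"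
    using vanish coeff_contraction_subset[OF prime_is_ideal[OF P], of i] by blast
  have "\<not> indep_mod (coeff_contraction i P) (insert j (insert i Y))" if j: "j \<notin> insert i Y" for j
  proof -
    obtain q where q: "q \<in> P" "q \<noteq> 0" "q \<in> poly_ring (insert j Y)"
      using exists_relation_for_variable[of j] j by blast
    have "q \<in> poly_ring (- {i})" using q(3) poly_ring_mono[of "insert j Y" "- {i}"] i j by auto
    then have "q \<in> coeff_contraction i P"
      using q(1) ideal_zero[OF prime_is_ideal[OF P]]
      by (simp add: coeff_contraction_def var_coeff_of_free)
    moreover have "q \<in> poly_ring (insert j (insert i Y))"
      using q(3) poly_ring_mono[of "insert j Y" "insert j (insert i Y)"] by auto
    ultimately show ?thesis using q(2) by (auto simp: indep_mod_def)
  qed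
  then show "max_indep_mod (coeff_contraction i P) (insert i Y)"
    using vanish by (auto simp: max_indep_mod_def indep_mod_def)
qed

lemma prime_chain_to_Suc:
  assumes "prime_chain_to P h" "P \<subset> Q" "is_prime_ideal Q"
  shows "prime_chain_to Q (Suc h)"
proof -
  obtain c where c: "\<forall>i\<le>h. is_prime_ideal (c i)" "\<forall>i<h. c i \<subset> c (Suc i)" "c h = P"
    using assms(1) by (auto simp: prime_chain_to_def)
  show ?thesis unfolding prime_chain_to_def
    by (rule exI[of _ "c(Suc h := Q)"]) (use c assms in \<open>auto simp: le_Suc_eq less_Suc_eq\<close>)
qed

lemma prime_chain_of_max_indep:
  fixes P :: "('n::finite, 'k::field) mpoly set"
  assumes "is_prime_ideal P" "max_indep_mod P Y"
  shows "prime_chain_to P (card (- Y))"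
  using assms
proof (induction "card (- Y)" arbitrary: P Y)
  case 0
  then show ?case by (auto simp: prime_chain_to_def)
next
  case (Suc n)
  then have "- Y \<noteq> {}" by (metis card.empty nat.distinct(1))
  then obtain i where i: "i \<notin> Y" by auto
  then have card: "card (- Y) = Suc (card (- insert i Y))"
    using card.remove[of "- Y" i] by (simp add: Compl_insert)
  then have "prime_chain_to (coeff_contraction i P) (card (- insert i Y))"
    using Suc.hyps coeff_contraction_step(2)[OF Suc.prems i]
      prime_coeff_contraction[OF Suc.prems(1)]
    by (intro Suc.hyps(1)) auto
  then show ?case
    unfolding card
    by (rule prime_chain_to_Suc[OF _ coeff_contraction_step(1)[OF Suc.prems i] Suc.prems(1)])
qed

lemma prime_chain_dimension:
  fixes P :: "('n::finite, 'k::field) mpoly set"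
  assumes "prime_chain_to P h"
  shows "h + dimension P \<le> CARD('n)"
proof -
  obtain c where c: "\<forall>i\<le>h. is_prime_ideal (c i)" "\<forall>i<h. c i \<subset> c (Suc i)" "c h = P"
    using assms by (auto simp: prime_chain_to_def)
  have "i + dimension (c i) \<le> CARD('n)" if "i \<le> h" for i
    using that
  proof (induction i)
    case 0
    then show ?case using c dimension_le by auto
  next
    case (Suc i)
    then have "dimension (c (Suc i)) < dimension (c i)"
      using c by (intro dimension_strict_antimono) auto
    then show ?case using Suc by simp
  qed
  then show ?thesis using c by blast
qed

lemma card_Compl: "card (- Y) = CARD('n) - card Y" for Y :: "'n::finite set"
  by (simp add: Compl_eq_Diff_UNIV card_Diff_subset)

theorem height_eq_codimension:
  fixes P :: "('n::finite, 'k::field) mpoly set"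
  assumes P: "is_prime_ideal P"
  shows "height P = enat (CARD('n) - dimension P)"
proof (rule antisym)
  show "height P \<le> enat (CARD('n) - dimension P)"
    unfolding height_def using prime_chain_dimension by (fastforce intro!: SUP_least)
  obtain Y where Y: "max_indep_mod P Y" "card Y = dimension P" by (rule dimension_attained[OF P])
  then have "prime_chain_to P (CARD('n) - dimension P)"
    using prime_chain_of_max_indep[OF P Y(1)] by (simp add: card_Compl)
  then show "enat (CARD('n) - dimension P) \<le> height P"
    unfolding height_def by (intro SUP_upper) simp
qed

section \<open>Derivatives and powers of prime ideals\<close>

definition partial_deriv :: "'n \<Rightarrow> ('n, 'k::comm_ring_1) mpoly \<Rightarrow> ('n, 'k) mpoly" where
  "partial_deriv i p = (\<Sum>\<gamma>\<in>keys p. single (\<gamma> - single i 1) (lookup p \<gamma> * of_nat (lookup \<gamma> i)))"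

lemma partial_deriv_zero [simp]: "partial_deriv i 0 = 0"
  by (simp add: partial_deriv_def)

lemma partial_deriv_add: "partial_deriv i (p + q) = partial_deriv i p + partial_deriv i q"
  unfolding partial_deriv_def
  by (rule setsum_keys_plus_distrib[where f = "\<lambda>\<gamma> c.
      single (\<gamma> - single i 1) (c * of_nat (lookup \<gamma> i))"])
     (simp_all add: distrib_right single_add)

lemma partial_deriv_single:
  "partial_deriv i (single \<gamma> c) = single (\<gamma> - single i 1) (c * of_nat (lookup \<gamma> i))"
  by (auto simp: partial_deriv_def)

lemma partial_deriv_mult:
  "partial_deriv i (p * q) = partial_deriv i p * q + p * partial_deriv i q"
  for p q :: "('n, 'k::comm_ring_1) mpoly"
proof (induction p q rule: mpoly_bilinear_induct)
  case (single \<gamma> c \<delta> d)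
  have shift: "single (\<gamma> - single i 1 + \<delta>) (a * of_nat (lookup \<gamma> i)) =
      single (\<gamma> + \<delta> - single i 1) (a * of_nat (lookup \<gamma> i))" for \<gamma> \<delta> :: "'n \<Rightarrow>\<^sub>0 nat" and a :: 'k
  proof (cases "lookup \<gamma> i = 0")
    case False
    then have "\<gamma> - single i 1 + \<delta> = \<gamma> + \<delta> - single i 1"
      by (intro poly_mapping_eqI) (auto simp: lookup_add lookup_minus lookup_single when_def)
    then show ?thesis by simp
  qed simp
  show ?case
    using shift[of \<gamma> \<delta> "c * d"] shift[of \<delta> \<gamma> "c * d"]
    by (simp add: partial_deriv_single mult_single single_add[symmetric] lookup_add algebra_simps)
qed (simp_all add: distrib_left distrib_right partial_deriv_add)

lemma lookup_partial_deriv: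
  "lookup (partial_deriv i p) \<delta> = lookup p (\<delta> + single i 1) * of_nat (lookup \<delta> i + 1)"
  for p :: "('n, 'k::comm_ring_1) mpoly"
proof (induction p rule: mpoly_induct)
  case (add p q)
  then show ?case by (simp add: partial_deriv_add lookup_add algebra_simps)
next
  case (single \<gamma> c)
  show ?case
  proof (cases "lookup \<gamma> i = 0")
    case True
    then have "\<gamma> \<noteq> \<delta> + single i 1" by (auto simp: lookup_add)
    then show ?thesis using True by (simp add: partial_deriv_single lookup_single)
  next
    case False
    then have "single i 1 + (\<gamma> - single i 1) = \<gamma>" by (intro single_add_diff_exponent) simp
    then have "\<gamma> - single i 1 = \<delta> \<longleftrightarrow> \<gamma> = \<delta> + single i 1" by (auto simp: add.commute)
    then show ?thesis by (auto simp: partial_deriv_single lookup_single when_def lookup_add)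
  qed
qed

lemma partial_deriv_ideal_power:
  "a \<in> ideal_power Q (Suc s) \<Longrightarrow> partial_deriv i a \<in> ideal_power Q s"
proof (induction s arbitrary: a)
  case (Suc s)
  note ideal = is_ideal_ideal_power
  let ?J = "{a \<in> ideal_power Q (Suc (Suc s)). partial_deriv i a \<in> ideal_power Q (Suc s)}"
  have "is_ideal ?J"
    unfolding is_ideal_def
  proof (intro conjI ballI allI)
    fix r a assume a: "a \<in> ?J"
    then have "a \<in> ideal_power Q (Suc s)" using ideal_power_Suc_subset by blast
    then show "r * a \<in> ?J" using a
      by (auto simp: partial_deriv_mult intro!: ideal_add[OF ideal] ideal_mult_left[OF ideal])
  qed (auto simp: partial_deriv_add ideal_zero[OF ideal] intro: ideal_add[OF ideal])
  then have "ideal_power Q (Suc (Suc s)) \<subseteq> ?J"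
  proof (rule ideal_power_Suc_least)
    fix a b assume ab: "a \<in> Q" "b \<in> ideal_power Q (Suc s)"
    then have "partial_deriv i a * b \<in> ideal_power Q (Suc s)"
        "a * partial_deriv i b \<in> ideal_power Q (Suc s)"
      using Suc.IH[of b] by (auto intro: ideal_mult_left[OF ideal] ideal_power_Suc_mult)
    then show "a * b \<in> ?J"
      using ab by (auto simp: partial_deriv_mult intro!: ideal_add[OF ideal] ideal_power_Suc_mult)
  qed
  then show ?case using Suc.prems by blast
qed simp

lemma exists_nonzero_partial_deriv:
  fixes f :: "('n::finite, 'k::field_char_0) mpoly"
  assumes "deg_le UNIV (Suc d) f" "\<not> deg_le UNIV d f"
  obtains i where "partial_deriv i f \<noteq> 0" "deg_le UNIV d (partial_deriv i f)"
proof -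
  obtain \<gamma> where \<gamma>: "\<gamma> \<in> keys f" "\<not> mdeg UNIV \<gamma> \<le> d" using assms(2) by (auto simp: deg_le_def)
  then obtain i where i: "lookup \<gamma> i \<noteq> 0" using mdeg_eq_0_iff[of UNIV \<gamma>] by auto
  then have "single i 1 + (\<gamma> - single i 1) = \<gamma>" by (intro single_add_diff_exponent) simp
  then have "lookup (partial_deriv i f) (\<gamma> - single i 1) \<noteq> 0"
    using \<gamma>(1) by (simp add: lookup_partial_deriv add.commute in_keys_iff del: of_nat_add
      of_nat_Suc)
  then have "partial_deriv i f \<noteq> 0" by auto
  moreover have "mdeg UNIV \<delta> \<le> d" if "\<delta> \<in> keys (partial_deriv i f)" for \<delta>
  proof -
    have "\<delta> + single i 1 \<in> keys f" using that by (auto simp: in_keys_iff lookup_partial_deriv)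
    then have "mdeg UNIV (\<delta> + single i 1) \<le> Suc d" using assms(1) unfolding deg_le_def by blast
    then show ?thesis by simp
  qed
  then have "deg_le UNIV d (partial_deriv i f)" by (simp add: deg_le_def)
  ultimately show thesis by (rule that)
qed

theorem symbolic_power_degree:
  fixes Q :: "('n::finite, 'k::field_char_0) mpoly set"
  assumes Q: "is_prime_ideal Q"
    and "f \<noteq> 0" "deg_le UNIV d f" "d < S" "h \<notin> Q"
  shows "h * f \<notin> ideal_power Q S"
  using assms(2-)
proof (induction d arbitrary: f S h)
  case 0
  show ?case
  proof
    assume "h * f \<in> ideal_power Q S"
    then have "h * f \<in> Q"
      using 0 ideal_power_antimono[of 1 S Q] ideal_power_one[OF prime_is_ideal[OF Q]] by auto
    then have "f \<in> Q" using 0 prime_ideal_mult[OF Q] by blast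
    then show False using indep_mod_empty[OF Q] 0 by (auto simp: indep_mod_def poly_ring_def)
  qed
next
  case (Suc d)
  show ?case
  proof (cases "deg_le UNIV d f")
    case True
    then show ?thesis using Suc by simp
  next
    case False
    then obtain i where i: "partial_deriv i f \<noteq> 0" "deg_le UNIV d (partial_deriv i f)"
      using exists_nonzero_partial_deriv[OF Suc.prems(2)] by blast
    obtain S' where S': "S = Suc S'" "d < S'" using Suc.prems by (cases S) auto
    show ?thesis
    proof
      note ideal = is_ideal_ideal_power[of Q S']
      assume hf: "h * f \<in> ideal_power Q S"
      then have "partial_deriv i (h * f) \<in> ideal_power Q S'" "h * f \<in> ideal_power Q S'"
        using partial_deriv_ideal_power[of "h * f" Q S'] ideal_power_Suc_subset[of Q S']
        by (auto simp: S')
      then have "h * partial_deriv i (h * f) - partial_deriv i h * (h * f) \<in> ideal_power Q S'"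
        by (intro ideal_diff[OF ideal ideal_mult_left[OF ideal] ideal_mult_left[OF ideal]])
      also have "h * partial_deriv i (h * f) - partial_deriv i h * (h * f) =
          (h * h) * partial_deriv i f"
        by (simp add: partial_deriv_mult algebra_simps)
      finally show False
        using Suc.IH[OF i S'(2), of "h * h"] Suc.prems prime_ideal_mult[OF Q] by blast
    qed
  qed
qed

section \<open>Relations between generators\<close>

definition analytic_indep :: "'a::comm_ring_1 set \<Rightarrow> 'b set \<Rightarrow> ('b \<Rightarrow> 'a) \<Rightarrow> 'b set \<Rightarrow> bool" where
  "analytic_indep Q J g B \<longleftrightarrow> (\<forall>s V c. finite V \<longrightarrow> V \<subseteq> exponents B \<longrightarrow> (\<forall>\<alpha>\<in>V. level J \<alpha> = s) \<longrightarrow>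
     (\<Sum>\<alpha>\<in>V. c \<alpha> * power_product J g \<alpha>) \<in> nilpotent_forms Q (ideal_gen (g ` J)) s \<longrightarrow> (\<forall>\<alpha>\<in>V. c \<alpha> \<in> Q))"

lemma not_analytic_indepD:
  assumes Q: "is_prime_ideal Q" and nil: "nilpotent_at Q (ideal_gen (g ` J))"
    and dep: "\<not> analytic_indep Q J g B"
  shows "\<exists>V s c. finite V \<and> V \<noteq> {} \<and> V \<subseteq> exponents B \<and> (\<forall>\<alpha>\<in>V. level J \<alpha> = s \<and> c \<alpha> \<notin> Q) \<and>
    (\<Sum>\<alpha>\<in>V. c \<alpha> * power_product J g \<alpha>) \<in> nilpotent_forms Q (ideal_gen (g ` J)) s"
proof -
  let ?N = "nilpotent_forms Q (ideal_gen (g ` J))"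
  obtain s V c where V: "finite V" "V \<subseteq> exponents B" "\<forall>\<alpha>\<in>V. level J \<alpha> = s"
    "(\<Sum>\<alpha>\<in>V. c \<alpha> * power_product J g \<alpha>) \<in> ?N s" "\<exists>\<alpha>\<in>V. c \<alpha> \<notin> Q"
    using dep unfolding analytic_indep_def by blast
  let ?V = "{\<alpha> \<in> V. c \<alpha> \<notin> Q}"
  have "(\<Sum>\<alpha>\<in>V - ?V. c \<alpha> * power_product J g \<alpha>) \<in> ?N s"
    using V(3) power_product_in_ideal_power[of J g]
    by (intro ideal_sum[OF is_ideal_nilpotent_forms[OF Q]]
      nilpotent_at_mult_nilpotent_forms[OF nil]) auto
  then have "(\<Sum>\<alpha>\<in>V. c \<alpha> * power_product J g \<alpha>) - (\<Sum>\<alpha>\<in>V - ?V. c \<alpha> * power_product J g \<alpha>) \<in> ?N s"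
    by (intro ideal_diff[OF is_ideal_nilpotent_forms[OF Q]] V(4))
  also have "(\<Sum>\<alpha>\<in>V. c \<alpha> * power_product J g \<alpha>) - (\<Sum>\<alpha>\<in>V - ?V. c \<alpha> * power_product J g \<alpha>) =
      (\<Sum>\<alpha>\<in>?V. c \<alpha> * power_product J g \<alpha>)"
    using sum.subset_diff[of ?V V "\<lambda>\<alpha>. c \<alpha> * power_product J g \<alpha>"] V(1) by simp
  finally show ?thesis using V by (intro exI[of _ ?V] exI[of _ s] exI[of _ c]) auto
qed

lemma leading_form_relation:
  assumes Q: "is_prime_ideal Q" and V: "finite V" "V \<noteq> {}" "V \<subseteq> exponents J"
    and level: "\<And>\<alpha>. \<alpha> \<in> V \<Longrightarrow> level J \<alpha> = s" and c: "\<And>\<alpha>. \<alpha> \<in> V \<Longrightarrow> c \<alpha> \<notin> Q"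
    and nilpotent: "(\<Sum>\<alpha>\<in>V. c \<alpha> * power_product J g \<alpha>) \<in> nilpotent_forms Q (ideal_gen (g ` J)) s"
    and inj: "inj_on (weight J w) V"
  obtains \<alpha> e a l where "\<alpha> \<in> V" "a \<notin> Q" "l \<in> lower_forms J g w (e * s) (e * weight J w \<alpha>)"
    "a * power_product J g (\<lambda>i. e * \<alpha> i) + l \<in> ideal_power (ideal_gen (g ` J)) (Suc (e * s))"
proof -
  have "Max (weight J w ` V) \<in> weight J w ` V" using V by (intro Max_in) auto
  then obtain \<alpha> where \<alpha>: "\<alpha> \<in> V" "weight J w \<alpha> = Max (weight J w ` V)" by auto
  have less: "weight J w \<beta> < weight J w \<alpha>" if "\<beta> \<in> V - {\<alpha>}" for \<beta>
  proof -
    have "weight J w \<beta> \<le> weight J w \<alpha>" unfolding \<alpha>(2) using V that by (intro Max_ge) auto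
    moreover have "weight J w \<beta> \<noteq> weight J w \<alpha>" using inj \<alpha>(1) that by (auto simp: inj_on_def)
    ultimately show ?thesis by simp
  qed
  define l where "l = (\<Sum>\<beta>\<in>V - {\<alpha>}. c \<beta> * power_product J g \<beta>)"
  have l: "l \<in> lower_forms J g w s (weight J w \<alpha>)"
    unfolding l_def using V level less
    by (intro ideal_sum ideal_mult_left is_ideal_lower_forms power_product_in_lower_forms) auto
  have sum_eq: "(\<Sum>\<alpha>\<in>V. c \<alpha> * power_product J g \<alpha>) = c \<alpha> * power_product J g \<alpha> + l"
    unfolding l_def using \<alpha>(1) V(1) by (rule sum.remove[rotated])
  obtain h e where h: "h \<notin> Q"
    "h * (c \<alpha> * power_product J g \<alpha> + l) ^ e \<in> ideal_power (ideal_gen (g ` J)) (e * s + 1)"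
    using nilpotent unfolding sum_eq by (rule nilpotent_formsE)
  obtain l' where l': "l' \<in> lower_forms J g w (e * s) (e * weight J w \<alpha>)"
    "(c \<alpha> * power_product J g \<alpha> + l) ^ e = c \<alpha> ^ e * power_product J g (\<lambda>i. e * \<alpha> i) + l'"
    using leading_form_power[OF _ level[OF \<alpha>(1)] l] \<alpha>(1) V(3) by blast
  have "h * c \<alpha> ^ e \<notin> Q"
    using h(1) c[OF \<alpha>(1)] prime_ideal_mult[OF Q] prime_ideal_power[OF Q] by blast
  moreover have "h * l' \<in> lower_forms J g w (e * s) (e * weight J w \<alpha>)"
    by (rule ideal_mult_left[OF is_ideal_lower_forms l'(1)])
  moreover have "h * c \<alpha> ^ e * power_product J g (\<lambda>i. e * \<alpha> i) + h * l' \<in>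
      ideal_power (ideal_gen (g ` J)) (Suc (e * s))"
    using h(2) unfolding l'(2) by (simp add: algebra_simps)
  ultimately show thesis using \<alpha>(1) by (intro that)
qed

context independent_coordinates
begin

lemma relation_rewritable:
  fixes g :: "'b \<Rightarrow> ('n, 'k) mpoly"
  assumes fin: "finite J" and nil: "nilpotent_at Q (ideal_gen (g ` J))" and a: "a \<notin> Q"
    and l: "l \<in> lower_forms J g w (level J \<mu>) (weight J w \<mu>)"
    and relation: "a * power_product J g \<mu> + l \<in> ideal_power (ideal_gen (g ` J)) (Suc (level J \<mu>))"
  shows "\<forall>\<^sub>F K in sequentially. rewritable_at Q Y J g (\<lambda>i. K * w i) 0 \<mu>"
proof -
  let ?I = "ideal_gen (g ` J)"
  note ideal = is_ideal_ideal_power[of ?I]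
  obtain d a' where d: "d \<in> poly_ring Y" "d \<noteq> 0" "d + a * a' \<in> Q"
    using exists_multiple_in_poly_ring[OF a] by blast
  obtain H m where H: "H \<notin> Q" "H * (d + a * a') ^ m \<in> ?I"
    using nil d(3) by (auto simp: nilpotent_at_def)
  obtain z where z: "(d + a * a') ^ m = d ^ m + a * a' * z" using power_add_expand by blast
  have dm: "d ^ m \<notin> Q" using notin_if_in_poly_ring[OF d(1,2)] prime_ideal_power[OF prime] by blast
  define x where "x = a' * z * l"
  have "x \<in> lower_forms J g w (level J \<mu>) (weight J w \<mu>)"
    unfolding x_def by (rule ideal_mult_left[OF is_ideal_lower_forms l])
  then obtain E where x: "x \<in> mpoly.span {monom \<kappa> * power_product J g \<nu> | \<kappa> \<nu>.
      \<nu> \<in> {\<nu> \<in> exponents J. level J \<nu> = level J \<mu> \<and> weight J w \<nu> < weight J w \<mu>} \<and>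
      mdeg UNIV \<kappa> + 0 \<le> E}"
    unfolding lower_forms_def by (rule ideal_gen_image_bounded_span)
  have y: "d ^ m * H * (monom 0 * power_product J g \<mu>) - H * x \<in> ideal_power ?I (Suc (level J \<mu>))"
  proof -
    have "d ^ m * H * (monom 0 * power_product J g \<mu>) - H * x =
        H * (d + a * a') ^ m * power_product J g \<mu> - (H * a' * z) * (a * power_product J g \<mu> + l)"
      unfolding z x_def by (simp add: algebra_simps)
    also have "\<dots> \<in> ideal_power ?I (Suc (level J \<mu>))"
      by (intro ideal_diff[OF ideal] ideal_power_Suc_mult[OF H(2) power_product_in_ideal_power]
          ideal_mult_left[OF ideal relation])
    finally show ?thesis .
  qed
  have "rewritable_at Q Y J g (\<lambda>i. K * w i) 0 \<mu>" if K: "E < K" for K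
  proof (rule rewritable_atI[OF fin poly_ring_power[OF d(1)] dm H(1) _ y, where F = E])
    have lower: "mdeg (- Y) \<kappa> + K * weight J w \<nu> < K * weight J w \<mu>"
      if "weight J w \<nu> < weight J w \<mu>" "mdeg UNIV \<kappa> \<le> E" for \<kappa> \<nu>
    proof -
      have "K * Suc (weight J w \<nu>) \<le> K * weight J w \<mu>" using that(1) by (intro mult_left_mono) auto
      then show ?thesis using K that(2) mdeg_mono[of "- Y" UNIV \<kappa>] by simp
    qed
    show "x \<in> mpoly.span (power_terms J g (level J \<mu>) (\<lambda>\<kappa> \<nu>. mdeg UNIV \<kappa> \<le> E \<and>
        mdeg (- Y) \<kappa> + weight J (\<lambda>i. K * w i) \<nu> < mdeg (- Y) 0 + weight J (\<lambda>i. K * w i) \<mu>))"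
      by (rule mpoly.span_mono[THEN subsetD, OF _ x])
         (auto simp: power_terms_def weight_scale_weights intro!: lower)
  qed
  then show ?thesis unfolding eventually_sequentially by (intro exI[of _ "Suc E"]) simp
qed

end

lemma separating_weights_bounded:
  assumes "finite J"
  shows "\<exists>w. \<forall>\<alpha> \<beta>. (\<forall>i\<in>J. \<alpha> i < b \<and> \<beta> i < b) \<longrightarrow> weight J w \<alpha> = weight J w \<beta> \<longrightarrow> (\<forall>i\<in>J. \<alpha> i = \<beta> i)"
  using assms
proof (induction J rule: finite_induct)
  case (insert j J)
  then obtain w where w: "\<And>\<alpha> \<beta>. \<forall>i\<in>J. \<alpha> i < b \<and> \<beta> i < b \<Longrightarrow> weight J w \<alpha> = weight J w \<beta> \<Longrightarrow>
      \<forall>i\<in>J. \<alpha> i = \<beta> i"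
    by blast
  let ?w = "(\<lambda>i. b * w i)(j := 1)"
  have weight_insert: "weight (insert j J) ?w \<alpha> = \<alpha> j + b * weight J w \<alpha>" for \<alpha>
  proof -
    have "weight J ?w \<alpha> = b * weight J w \<alpha>"
      unfolding weight_def sum_distrib_left using insert by (intro sum.cong) auto
    then show ?thesis using insert by (simp add: weight_def)
  qed
  show ?case
  proof (intro exI[of _ ?w] allI impI)
    fix \<alpha> \<beta> assume less: "\<forall>i\<in>insert j J. \<alpha> i < b \<and> \<beta> i < b"
      and "weight (insert j J) ?w \<alpha> = weight (insert j J) ?w \<beta>"
    then have eq: "\<alpha> j + b * weight J w \<alpha> = \<beta> j + b * weight J w \<beta>" by (simp only: weight_insert)
    then have "(\<alpha> j + b * weight J w \<alpha>) mod b = (\<beta> j + b * weight J w \<beta>) mod b" by (rule arg_cong)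
    then have j: "\<alpha> j = \<beta> j" using less by simp
    moreover have "b > 0" using less by auto
    ultimately have "weight J w \<alpha> = weight J w \<beta>" using eq by simp
    then show "\<forall>i\<in>insert j J. \<alpha> i = \<beta> i" using w[of \<alpha> \<beta>] less j by auto
  qed
qed simp

lemma separating_weights:
  assumes J: "finite J" and X: "finite X" "X \<subseteq> exponents J"
  obtains w where "inj_on (weight J w) X"
proof -
  have "finite (\<Union>\<alpha>\<in>X. \<alpha> ` J)" using J X(1) by simp
  then obtain b where "\<forall>m\<in>(\<Union>\<alpha>\<in>X. \<alpha> ` J). m < b" unfolding finite_nat_set_iff_bounded ..
  then have b: "\<alpha> i < b" if "\<alpha> \<in> X" "i \<in> J" for \<alpha> i using that by auto
  obtain w where w: "\<And>\<alpha> \<beta>. \<forall>i\<in>J. \<alpha> i < b \<and> \<beta> i < b \<Longrightarrow> weight J w \<alpha> = weight J w \<beta> \<Longrightarrow> \<forall>i\<in>J. \<alpha> i = \<beta> i"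
    using separating_weights_bounded[OF J] by blast
  have "inj_on (weight J w) X"
  proof (rule inj_onI)
    fix \<alpha> \<beta> assume \<alpha>\<beta>: "\<alpha> \<in> X" "\<beta> \<in> X" "weight J w \<alpha> = weight J w \<beta>"
    then have "\<forall>i\<in>J. \<alpha> i = \<beta> i" using b by (intro w) auto
    then show "\<alpha> = \<beta>" using X(2) \<alpha>\<beta> by (intro exponents_eqI[of \<alpha> J \<beta>]) auto
  qed
  then show thesis by (rule that)
qed

context independent_coordinates
begin

lemma dependent_sets_rewritable:
  fixes g :: "'b \<Rightarrow> ('n, 'k) mpoly"
  assumes fin: "finite J" and nil: "nilpotent_at Q (ideal_gen (g ` J))"
    and \<B>: "\<And>B. B \<in> \<B> \<Longrightarrow> B \<subseteq> J" "\<And>B. B \<in> \<B> \<Longrightarrow> \<not> analytic_indep Q J g B"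
  shows "\<exists>w \<mu>. \<forall>B\<in>\<B>. \<mu> B \<in> exponents B \<and> rewritable_at Q Y J g w 0 (\<mu> B)"
proof -
  have fin_\<B>: "finite \<B>" by (rule finite_subset[of _ "Pow J"]) (use \<B>(1) fin in auto)
  define R where "R =
      (\<lambda>B V s c. finite V \<and> V \<noteq> {} \<and> V \<subseteq> exponents B \<and> (\<forall>\<alpha>\<in>V. level J \<alpha> = s \<and> c \<alpha> \<notin> Q) \<and>
     (\<Sum>\<alpha>\<in>V. c \<alpha> * power_product J g \<alpha>) \<in> nilpotent_forms Q (ideal_gen (g ` J)) s)"
  have "\<exists>V s c. R B V s c" if "B \<in> \<B>" for B
    unfolding R_def by (rule not_analytic_indepD[OF prime nil \<B>(2)[OF that]])
  then obtain V where "\<And>B. B \<in> \<B> \<Longrightarrow> \<exists>s c. R B (V B) s c" by metis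
  note V = this[unfolded R_def]
  have sub: "V B \<subseteq> exponents J" if "B \<in> \<B>" for B
    using V[OF that] exponents_mono[OF \<B>(1)[OF that]] by blast
  have "finite (\<Union>B\<in>\<B>. V B)" using fin_\<B> V by blast
  then obtain w where w: "inj_on (weight J w) (\<Union>B\<in>\<B>. V B)"
    using separating_weights[OF fin] sub by (metis UN_least)
  have "\<exists>\<mu>\<in>exponents B. \<forall>\<^sub>F K in sequentially. rewritable_at Q Y J g (\<lambda>i. K * w i) 0 \<mu>"
    if B: "B \<in> \<B>" for B
  proof -
    obtain s c where VB: "finite (V B)" "V B \<noteq> {}" "V B \<subseteq> exponents B"
      "\<And>\<alpha>. \<alpha> \<in> V B \<Longrightarrow> level J \<alpha> = s" "\<And>\<alpha>. \<alpha> \<in> V B \<Longrightarrow> c \<alpha> \<notin> Q"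
      "(\<Sum>\<alpha>\<in>V B. c \<alpha> * power_product J g \<alpha>) \<in> nilpotent_forms Q (ideal_gen (g ` J)) s"
      using V[OF B] by blast
    have inj: "inj_on (weight J w) (V B)" using B by (intro inj_on_subset[OF w]) blast
    obtain \<alpha> e a l where \<alpha>: "\<alpha> \<in> V B" and a: "a \<notin> Q"
      and l: "l \<in> lower_forms J g w (e * s) (e * weight J w \<alpha>)"
      and relation: "a * power_product J g (\<lambda>i. e * \<alpha> i) + l \<in>
          ideal_power (ideal_gen (g ` J)) (Suc (e * s))"
      by (rule leading_form_relation[OF prime VB(1,2) sub[OF B] VB(4-6) inj])
    have "level J \<alpha> = s" by (rule VB(4)[OF \<alpha>])
    then have "\<forall>\<^sub>F K in sequentially. rewritable_at Q Y J g (\<lambda>i. K * w i) 0 (\<lambda>i. e * \<alpha> i)"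
      using l relation by (intro relation_rewritable[OF fin nil a])
        (simp_all add: level_scale weight_scale)
    moreover have "(\<lambda>i. e * \<alpha> i) \<in> exponents B" using VB(3) \<alpha> by (blast intro: exponents_scale)
    ultimately show ?thesis by blast
  qed
  then obtain \<mu> where \<mu>: "\<And>B. B \<in> \<B> \<Longrightarrow> \<mu> B \<in> exponents B"
    "\<And>B. B \<in> \<B> \<Longrightarrow> \<forall>\<^sub>F K in sequentially. rewritable_at Q Y J g (\<lambda>i. K * w i) 0 (\<mu> B)" by metis
  then have "\<forall>\<^sub>F K in sequentially. \<forall>B\<in>\<B>. rewritable_at Q Y J g (\<lambda>i. K * w i) 0 (\<mu> B)"
    using fin_\<B> by (simp add: eventually_ball_finite)
  then obtain K where "\<forall>B\<in>\<B>. rewritable_at Q Y J g (\<lambda>i. K * w i) 0 (\<mu> B)"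
    using eventually_happens'[OF sequentially_bot] by blast
  then show ?thesis using \<mu>(1) by blast
qed

lemma dependent_rewriting_system:
  fixes g :: "'b \<Rightarrow> ('n, 'k) mpoly"
  assumes fin: "finite J" and nil: "nilpotent_at Q (ideal_gen (g ` J))"
    and \<B>: "\<And>B. B \<in> \<B> \<Longrightarrow> B \<subseteq> J" "\<And>B. B \<in> \<B> \<Longrightarrow> \<not> analytic_indep Q J g B"
  obtains w E A H e \<mu> where "rewriting_system Y J g w E A H e (\<mu> ` \<B>)" "A \<notin> Q" "H \<notin> Q"
    "\<And>B. B \<in> \<B> \<Longrightarrow> \<mu> B \<in> exponents B"
proof -
  have fin_\<B>: "finite \<B>" by (rule finite_subset[of _ "Pow J"]) (use \<B>(1) fin in auto)
  obtain w \<mu> where \<mu>: "\<And>B. B \<in> \<B> \<Longrightarrow> \<mu> B \<in> exponents B"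
    "\<And>B. B \<in> \<B> \<Longrightarrow> rewritable_at Q Y J g w 0 (\<mu> B)"
    using dependent_sets_rewritable[OF fin nil \<B>] by metis
  have "\<exists>e. rewritable_at Q Y J g w (single i e) 0" if i: "i \<notin> Y" for i
  proof -
    obtain p where p: "p \<in> Q" "p \<noteq> 0" "p \<in> poly_ring (insert i Y)"
      using exists_relation_for_variable[OF i] by blast
    obtain H m where "H \<notin> Q" "H * p ^ m \<in> ideal_gen (g ` J)"
      using nil p(1) by (auto simp: nilpotent_at_def)
    from variable_rewritable[OF fin i p(3,2) this] show ?thesis by blast
  qed
  then obtain e where e: "\<And>i. i \<notin> Y \<Longrightarrow> rewritable_at Q Y J g w (single i (e i)) 0" by metis
  let ?K = "(\<lambda>i. (single i (e i), 0)) ` (- Y) \<union> (\<lambda>B. (0, \<mu> B)) ` \<B>"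
  obtain E A H where A: "A \<in> poly_ring Y" "A \<notin> Q" "deg_le UNIV E A" and H: "H \<notin> Q"
    and rules: "\<And>\<gamma> \<alpha>. (\<gamma>, \<alpha>) \<in> ?K \<Longrightarrow> rewrite_rule Y J g w E A H \<gamma> \<alpha>"
    by (rule common_multipliers[OF prime, of ?K Y J g w]) (use e \<mu>(2) fin_\<B> in auto)
  have "rewriting_system Y J g w E A H e (\<mu> ` \<B>)"
    by unfold_locales (use fin A rules in auto)
  then show thesis using A(2) H \<mu>(1) by (rule that)
qed

end

lemma card_exponents_few_large:
  assumes fin: "finite J" and \<beta>: "\<beta> \<ge> 1" and S: "S \<ge> 1"
  shows "card {\<alpha> \<in> exponents J. (\<forall>i\<in>J. \<alpha> i < S) \<and> card {i\<in>J. \<beta> \<le> \<alpha> i} < j} \<le>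
    2 ^ card J * (S ^ (j - 1) * \<beta> ^ card J)"
proof -
  let ?G = "{\<alpha> \<in> exponents J. (\<forall>i\<in>J. \<alpha> i < S) \<and> card {i\<in>J. \<beta> \<le> \<alpha> i} < j}"
  let ?\<X> = "{X. X \<subseteq> J \<and> card X < j}"
  let ?B = "\<lambda>X. {\<alpha> \<in> exponents J. \<forall>i\<in>J. \<alpha> i < (if i \<in> X then S else \<beta>)}"
  have finX: "finite ?\<X>" using fin by simp
  have sub: "?G \<subseteq> (\<Union>X\<in>?\<X>. ?B X)"
  proof
    fix \<alpha> assume "\<alpha> \<in> ?G"
    then show "\<alpha> \<in> (\<Union>X\<in>?\<X>. ?B X)" by (intro UN_I[of "{i\<in>J. \<beta> \<le> \<alpha> i}"]) auto
  qed
  have card_B: "card (?B X) \<le> S ^ (j - 1) * \<beta> ^ card J" if X: "X \<in> ?\<X>" for X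
  proof -
    have "card (?B X) \<le> (\<Prod>i\<in>J. if i \<in> X then S else \<beta>)" by (rule exponents_box(2)[OF fin])
    also have "\<dots> = S ^ card X * \<beta> ^ card (J - X)"
      using X fin by (simp add: prod.If_cases Int_absorb1 Diff_eq)
    also have "\<dots> \<le> S ^ (j - 1) * \<beta> ^ card J"
      using X \<beta> S fin by (intro mult_mono power_increasing card_mono) auto
    finally show ?thesis .
  qed
  have "card ?G \<le> card (\<Union>X\<in>?\<X>. ?B X)"
    by (intro card_mono[OF _ sub] finite_UN_I finX exponents_box(1)[OF fin])
  also have "\<dots> \<le> (\<Sum>X\<in>?\<X>. card (?B X))" by (rule card_UN_le[OF finX])
  also have "\<dots> \<le> card ?\<X> * (S ^ (j - 1) * \<beta> ^ card J)"
    using sum_bounded_above[of ?\<X> "\<lambda>X. card (?B X)"] card_B by simp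
  also have "card ?\<X> \<le> card (Pow J)" using fin by (intro card_mono) auto
  also have "card (Pow J) = 2 ^ card J" by (rule card_Pow[OF fin])
  finally show ?thesis by simp
qed

lemma (in rewriting_system) card_irreducible_exponents:
  assumes \<mu>: "\<And>B. B \<subseteq> J \<Longrightarrow> card B = j \<Longrightarrow> \<mu> B \<in> M \<inter> exponents B"
  obtains \<beta> where "\<And>S. S \<ge> 1 \<Longrightarrow>
      card (irreducible_exponents S) \<le> 2 ^ card J * (S ^ (j - 1) * \<beta> ^ card J)"
proof -
  have "finite (\<Union>B\<in>Pow J. \<mu> B ` J)" using finite_generators by simp
  then obtain b where "\<forall>m\<in>(\<Union>B\<in>Pow J. \<mu> B ` J). m < b" unfolding finite_nat_set_iff_bounded ..
  then have b: "\<mu> B i \<le> Suc b" if "B \<subseteq> J" "i \<in> J" for B i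
    using that by (auto intro: less_imp_le less_SucI)
  have "card (irreducible_exponents S) \<le> 2 ^ card J * (S ^ (j - 1) * Suc b ^ card J)"
    if "S \<ge> 1" for S
  proof -
    let ?G = "{\<alpha> \<in> exponents J. (\<forall>i\<in>J. \<alpha> i < S) \<and> card {i\<in>J. Suc b \<le> \<alpha> i} < j}"
    have "irreducible_exponents S \<subseteq> ?G"
    proof
      fix \<alpha> assume \<alpha>: "\<alpha> \<in> irreducible_exponents S"
      have "card {i\<in>J. Suc b \<le> \<alpha> i} < j"
      proof (rule ccontr)
        assume "\<not> card {i\<in>J. Suc b \<le> \<alpha> i} < j"
        then obtain B where B: "B \<subseteq> {i\<in>J. Suc b \<le> \<alpha> i}" "card B = j"
          by (meson not_less obtain_subset_with_card_n)
        then have \<mu>B: "\<mu> B \<in> M" "\<mu> B \<in> exponents B" using \<mu>[of B] by auto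
        have "\<mu> B i \<le> \<alpha> i" for i
          using B(1) b[of B i] \<mu>B(2) by (cases "i \<in> B") (force simp: exponents_def)+
        then show False using \<alpha> \<mu>B(1) by (auto simp: irreducible_exponents_def le_fun_def)
      qed
      then show "\<alpha> \<in> ?G"
        using \<alpha> level_ge[OF finite_generators]
        by (auto simp: irreducible_exponents_def intro: le_less_trans)
    qed
    moreover have "finite ?G"
      by (rule finite_subset[OF _ exponents_box(1)[OF finite_generators, of "\<lambda>_. S"]]) auto
    ultimately have "card (irreducible_exponents S) \<le> card ?G" by (intro card_mono)
    also have "\<dots> \<le> 2 ^ card J * (S ^ (j - 1) * Suc b ^ card J)"
      by (rule card_exponents_few_large[OF finite_generators _ that]) simp
    finally show ?thesis .
  qed
  then show thesis by (rule that)
qed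

lemma (in rewriting_system) exists_small_element_of_ideal_power:
  assumes Y: "Y \<noteq> UNIV" and \<mu>: "\<And>B. B \<subseteq> J \<Longrightarrow> card B = card (- Y) \<Longrightarrow> \<mu> B \<in> M \<inter> exponents B"
  obtains S N f where "f \<noteq> 0" "deg_le UNIV (S - 1) f" "S \<ge> 1" "A ^ N * H ^ S * f \<in> ideal_power I S"
proof -
  let ?n = "CARD('n)" and ?j = "card (- Y)"
  define c where "c = ?n + 1"
  have j: "?j \<ge> 1" using Y by (auto simp: Suc_le_eq card_gt_0_iff)
  then have n: "card Y + (?j - 1) = ?n - 1" "Suc (?n - 1) = ?n" by (simp_all add: card_Compl)
  obtain \<beta> where \<beta>: "\<And>S. S \<ge> 1 \<Longrightarrow>
      card (irreducible_exponents S) \<le> 2 ^ card J * (S ^ (?j - 1) * \<beta> ^ card J)"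
    using card_irreducible_exponents[OF \<mu>] by blast
  let ?P = "\<Prod>i\<in>-Y. e i"
  let ?B = "?P * (2 ^ card J * \<beta> ^ card J)"
  obtain \<tau> where \<tau>: "\<tau> \<ge> 1" "(growth c * \<tau>) ^ (?n - 1) * ?B < \<tau> ^ Suc (?n - 1)"
    by (rule exists_dominating_scale)
  define S where "S = ?n * \<tau> + 1"
  have S: "S \<le> c * \<tau>" "S \<ge> 1" using \<tau>(1) by (simp_all add: S_def c_def)
  have S_growth: "S \<le> growth c * \<tau>"
    by (rule order_trans[OF S(1)], rule mult_right_mono) (simp_all add: growth_def)
  define \<Omega> where "\<Omega> = {\<gamma> :: 'n \<Rightarrow>\<^sub>0 nat. \<forall>i. lookup \<gamma> i < \<tau>}"
  have \<Omega>: "finite \<Omega>" "card \<Omega> = \<tau> ^ ?n" unfolding \<Omega>_def using box_card[of "\<lambda>_. \<tau>"] by auto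
  have deg_\<Omega>: "mdeg UNIV \<gamma> \<le> ?n * \<tau>" if "\<gamma> \<in> \<Omega>" for \<gamma>
    unfolding mdeg_def
    using sum_bounded_above[of UNIV "lookup \<gamma>" \<tau>] that by (auto simp: \<Omega>_def less_imp_le)
  have "(growth c * \<tau>) ^ card Y * ?P * card (irreducible_exponents S) \<le>
      (growth c * \<tau>) ^ card Y * ?P * (2 ^ card J * ((growth c * \<tau>) ^ (?j - 1) * \<beta> ^ card J))"
    using S_growth by (intro mult_left_mono order_trans[OF \<beta>[OF S(2)]] mult_right_mono power_mono)
      auto
  also have "\<dots> = (growth c * \<tau>) ^ (card Y + (?j - 1)) * ?B" by (simp only: power_add ac_simps)
  also have "\<dots> < card \<Omega>" using \<tau>(2) unfolding n \<Omega>(2) .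
  finally have card: "(growth c * \<tau>) ^ card Y * ?P * card (irreducible_exponents S) < card \<Omega>" .
  have "deg_le UNIV (c * \<tau>) (monom \<gamma> :: ('n, 'k) mpoly)" if "\<gamma> \<in> \<Omega>" for \<gamma>
    using deg_\<Omega>[OF that] by (simp add: deg_le_monom c_def)
  from linear_dependence_mod_ideal_power[where v = monom, OF \<Omega>(1) this S(1) \<tau>(1) card]
  obtain a N where a: "\<exists>\<gamma>\<in>\<Omega>. a \<gamma> \<noteq> 0"
    and mem: "A ^ N * H ^ S * (\<Sum>\<gamma>\<in>\<Omega>. smult (a \<gamma>) (monom \<gamma>)) \<in> ideal_power I S" by blast
  have "(\<Sum>\<gamma>\<in>\<Omega>. smult (a \<gamma>) (monom \<gamma>)) \<noteq> 0"
    using a lookup_sum_smult_monom[OF \<Omega>(1), of _ a] by fastforce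
  moreover have "deg_le UNIV (S - 1) (\<Sum>\<gamma>\<in>\<Omega>. smult (a \<gamma>) (monom \<gamma>))"
    by (intro deg_le_sum deg_le_smult) (simp add: deg_le_monom deg_\<Omega> S_def)
  ultimately show thesis using S(2) mem by (rule that)
qed

theorem exists_analytic_indep:
  fixes g :: "'b \<Rightarrow> ('n::finite, 'k::field_char_0) mpoly"
  assumes Q: "is_prime_ideal Q" and Y: "max_indep_mod Q Y" "Y \<noteq> UNIV" and fin: "finite J"
    and gQ: "g ` J \<subseteq> Q" and nil: "nilpotent_at Q (ideal_gen (g ` J))"
  shows "\<exists>B\<subseteq>J. card B = card (- Y) \<and> analytic_indep Q J g B"
proof (rule ccontr)
  assume dependent: "\<not> ?thesis"
  interpret independent_coordinates Q Y using Q Y(1) by unfold_locales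
  let ?\<B> = "{B. B \<subseteq> J \<and> card B = card (- Y)}"
  obtain w E A H e \<mu> where system: "rewriting_system Y J g w E A H e (\<mu> ` ?\<B>)"
    and AH: "A \<notin> Q" "H \<notin> Q"
    and \<mu>: "\<And>B. B \<in> ?\<B> \<Longrightarrow> \<mu> B \<in> exponents B"
    by (rule dependent_rewriting_system[OF fin nil, of ?\<B>]) (use dependent in auto)
  interpret rewriting_system Y J g w E A H e "\<mu> ` ?\<B>" by (rule system)
  obtain S N f where f: "f \<noteq> 0" "deg_le UNIV (S - 1) f" "S \<ge> 1"
    and mem: "A ^ N * H ^ S * f \<in> ideal_power I S"
    by (rule exists_small_element_of_ideal_power[OF Y(2), of \<mu>]) (use \<mu> in auto)
  have "I \<subseteq> Q" by (rule ideal_gen_least[OF prime_is_ideal[OF Q] gQ])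
  then have "A ^ N * H ^ S * f \<in> ideal_power Q S" using mem ideal_power_mono by blast
  moreover have "A ^ N * H ^ S \<notin> Q" using AH prime_ideal_mult[OF Q] prime_ideal_power[OF Q] by blast
  ultimately show False using symbolic_power_degree[OF Q f(1,2)] f(3) by simp
qed

section \<open>Counting minimal primes of given height\<close>

lemma power_times_geometric_tendsto_0:
  fixes q :: real
  assumes "0 \<le> q" "q < 1"
  shows "(\<lambda>k. real k ^ n * q ^ k) \<longlonglongrightarrow> 0"
proof (cases "n = 0")
  case True
  then show ?thesis using LIMSEQ_realpow_zero assms by simp
next
  case False
  then have root: "root n q ^ n = q" "norm (root n q) < 1" using assms by simp_all
  have "(\<lambda>k. (real k * root n q ^ k) ^ n) \<longlonglongrightarrow> 0 ^ n"
    using powser_times_n_limit_0[OF root(2)] by (rule tendsto_power)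
  moreover have "(root n q ^ k) ^ n = q ^ k" for k
    by (metis mult.commute power_mult root(1))
  ultimately show ?thesis using False by (simp add: power_mult_distrib power_0_left)
qed

lemma ratio_le_of_polynomial_growth:
  fixes s :: "nat \<Rightarrow> nat"
  assumes step: "\<And>T. M * s T \<le> a * s (T + E)" and poly: "\<And>T. s T \<le> (T + 1) ^ n" and pos: "s 0 \<ge> 1"
  shows "M \<le> a"
proof (rule ccontr)
  assume "\<not> M \<le> a"
  define q where "q = real a / real M"
  have q: "0 \<le> q" "q < 1" using \<open>\<not> M \<le> a\<close> by (simp_all add: q_def)
  have iterate: "M ^ k * s 0 \<le> a ^ k * s (k * E)" for k
  proof (induction k)
    case (Suc k)
    have "M ^ Suc k * s 0 \<le> M * (a ^ k * s (k * E))"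
      using mult_left_mono[OF Suc, of M] by (simp add: mult.assoc)
    also have "\<dots> = a ^ k * (M * s (k * E))" by (simp only: ac_simps)
    also have "\<dots> \<le> a ^ k * (a * s (k * E + E))" by (rule mult_left_mono[OF step]) simp
    finally show ?case by (simp add: ac_simps)
  qed simp
  have lower: "1 \<le> real (E + 1) ^ n * (real k ^ n * q ^ k)" if "k \<ge> 1" for k
  proof -
    have "M ^ k \<le> M ^ k * s 0" using pos by simp
    also have "\<dots> \<le> a ^ k * (k * E + 1) ^ n"
      by (rule order_trans[OF iterate]) (intro mult_left_mono poly; simp)
    also have "\<dots> \<le> a ^ k * ((E + 1) * k) ^ n"
      using that by (intro mult_left_mono power_mono) (simp_all add: algebra_simps)
    also have "\<dots> = a ^ k * ((E + 1) ^ n * k ^ n)" by (simp only: power_mult_distrib)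
    finally have "real (M ^ k) \<le> real (a ^ k * ((E + 1) ^ n * k ^ n))" by (simp only: of_nat_le_iff)
    then show ?thesis
      using \<open>\<not> M \<le> a\<close> by (simp add: q_def power_divide pos_le_divide_eq ac_simps)
  qed
  have "(\<lambda>k. real (E + 1) ^ n * (real k ^ n * q ^ k)) \<longlonglongrightarrow> real (E + 1) ^ n * 0"
    by (intro tendsto_mult_left power_times_geometric_tendsto_0 q)
  moreover have "\<forall>\<^sub>F k in sequentially. 1 \<le> real (E + 1) ^ n * (real k ^ n * q ^ k)"
    using lower by (auto simp: eventually_sequentially)
  ultimately have "1 \<le> real (E + 1) ^ n * 0"
    by (rule tendsto_lowerbound) simp
  then show False by simp
qed

lemma finite_mdeg_le: "finite {\<gamma> :: 'n::finite \<Rightarrow>\<^sub>0 nat. mdeg UNIV \<gamma> \<le> d}"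
  and card_mdeg_le: "card {\<gamma> :: 'n::finite \<Rightarrow>\<^sub>0 nat. mdeg UNIV \<gamma> \<le> d} \<le> (d + 1) ^ CARD('n)"
proof -
  have sub: "{\<gamma> :: 'n \<Rightarrow>\<^sub>0 nat. mdeg UNIV \<gamma> \<le> d} \<subseteq> {\<gamma>. \<forall>i. lookup \<gamma> i < (\<lambda>_. d + 1) i}"
    using lookup_le_mdeg[of _ UNIV] by (auto simp: less_Suc_eq_le intro: le_trans)
  show "finite {\<gamma> :: 'n \<Rightarrow>\<^sub>0 nat. mdeg UNIV \<gamma> \<le> d}"
    by (rule finite_subset[OF sub box_card(1)])
  show "card {\<gamma> :: 'n \<Rightarrow>\<^sub>0 nat. mdeg UNIV \<gamma> \<le> d} \<le> (d + 1) ^ CARD('n)"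
    using card_mono[OF box_card(1) sub] unfolding box_card(2) by simp
qed

definition weighted_simplex ::
    "'b set \<Rightarrow> 'n set \<Rightarrow> nat \<Rightarrow> nat \<Rightarrow> (('b \<Rightarrow> nat) \<times> ('n::finite \<Rightarrow>\<^sub>0 nat)) set" where
  "weighted_simplex B Y D T =
     {(\<alpha>, \<beta>). \<alpha> \<in> exponents B \<and> mdeg (- Y) \<beta> = 0 \<and> mdeg UNIV \<beta> + D * level B \<alpha> \<le> T}"

lemma finite_weighted_simplex:
  assumes "finite B" "D \<ge> 1"
  shows "finite (weighted_simplex B Y D T)"
proof (rule finite_subset)
  show "weighted_simplex B Y D T \<subseteq> {\<alpha> \<in> exponents B. level B \<alpha> < Suc T} \<times> {\<beta>. mdeg UNIV \<beta> \<le> T}"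
  proof
    fix x assume "x \<in> weighted_simplex B Y D T"
    then obtain \<alpha> \<beta> where x: "x = (\<alpha>, \<beta>)" "\<alpha> \<in> exponents B" "mdeg UNIV \<beta> + D * level B \<alpha> \<le> T"
      by (auto simp: weighted_simplex_def)
    have "1 * level B \<alpha> \<le> D * level B \<alpha>" by (rule mult_right_mono[OF assms(2)]) simp
    then have "level B \<alpha> < Suc T" using x(3) by linarith
    then show "x \<in> {\<alpha> \<in> exponents B. level B \<alpha> < Suc T} \<times> {\<beta>. mdeg UNIV \<beta> \<le> T}" using x by simp
  qed
qed (intro finite_cartesian_product finite_exponents_level_less finite_mdeg_le assms)

definition restrict_exponent :: "'n set \<Rightarrow> ('n::finite \<Rightarrow>\<^sub>0 nat) \<Rightarrow> ('n \<Rightarrow>\<^sub>0 nat)" where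
  "restrict_exponent Y \<gamma> = Abs_poly_mapping (\<lambda>i. if i \<in> Y then lookup \<gamma> i else 0)"

lemma lookup_restrict_exponent:
    "lookup (restrict_exponent Y \<gamma>) i = (if i \<in> Y then lookup \<gamma> i else 0)"
  by (simp add: restrict_exponent_def)

text \<open>The exponent \<open>\<gamma>\<close> is determined by its part in \<open>Y\<close> together with the quotients and the remainders
  modulo \<open>D\<close> of its other entries.\<close>

lemma card_weighted_simplex:
  fixes Y :: "'n::finite set"
  assumes B: "finite B" "card B = card (- Y)" and D: "D \<ge> 1"
  shows "card {\<gamma> :: 'n \<Rightarrow>\<^sub>0 nat. mdeg UNIV \<gamma> \<le> T} \<le> D ^ card (- Y) * card (weighted_simplex B Y D T)"
proof -
  let ?S = "{\<gamma> :: 'n \<Rightarrow>\<^sub>0 nat. mdeg UNIV \<gamma> \<le> T}"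
  let ?R = "PiE (- Y) (\<lambda>_. {..<D})"
  obtain \<phi> where \<phi>: "bij_betw \<phi> B (- Y)" using finite_same_card_bij[OF B(1) finite B(2)] by blast
  let ?\<rho> = "\<lambda>\<gamma>. restrict (\<lambda>i. lookup \<gamma> i mod D) (- Y)" and ?\<beta> = "restrict_exponent Y"
  define \<alpha> where "\<alpha> = (\<lambda>(\<gamma> :: 'n \<Rightarrow>\<^sub>0 nat) b. if b \<in> B then lookup \<gamma> (\<phi> b) div D else 0)"
  have "inj_on (\<lambda>\<gamma>. (?\<rho> \<gamma>, \<alpha> \<gamma>, ?\<beta> \<gamma>)) ?S"
  proof (intro inj_onI poly_mapping_eqI)
    fix \<gamma> \<delta> i assume "(?\<rho> \<gamma>, \<alpha> \<gamma>, ?\<beta> \<gamma>) = (?\<rho> \<delta>, \<alpha> \<delta>, ?\<beta> \<delta>)"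
    then have eq: "?\<rho> \<gamma> = ?\<rho> \<delta>" "\<alpha> \<gamma> = \<alpha> \<delta>" "?\<beta> \<gamma> = ?\<beta> \<delta>" by (simp_all only: prod.inject)
    show "lookup \<gamma> i = lookup \<delta> i"
    proof (cases "i \<in> Y")
      case True
      then show ?thesis using lookup_restrict_exponent[of Y _ i] eq(3) by metis
    next
      case False
      then have "i \<in> \<phi> ` B" using \<phi> by (simp add: bij_betw_def)
      then obtain b where b: "b \<in> B" "\<phi> b = i" by blast
      have "lookup \<gamma> i div D = lookup \<delta> i div D"
        using fun_cong[OF eq(2), of b] b by (simp add: \<alpha>_def)
      moreover have "lookup \<gamma> i mod D = lookup \<delta> i mod D"
        using fun_cong[OF eq(1), of i] False by simp
      ultimately show ?thesis by (metis div_mult_mod_eq)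
    qed
  qed
  moreover have "(\<lambda>\<gamma>. (?\<rho> \<gamma>, \<alpha> \<gamma>, ?\<beta> \<gamma>)) ` ?S \<subseteq> ?R \<times> weighted_simplex B Y D T"
  proof (rule image_subsetI)
    fix \<gamma> assume "\<gamma> \<in> ?S"
    have "level B (\<alpha> \<gamma>) = (\<Sum>i\<in>-Y. lookup \<gamma> i div D)"
      by (simp add: level_def \<alpha>_def sum.reindex_bij_betw[OF \<phi>, symmetric])
    then have "D * level B (\<alpha> \<gamma>) \<le> mdeg (- Y) \<gamma>"
      by (auto simp: mdeg_def sum_distrib_left intro: sum_mono)
    moreover have "mdeg UNIV (?\<beta> \<gamma>) = mdeg Y \<gamma>" "mdeg (- Y) (?\<beta> \<gamma>) = 0"
      using mdeg_split[of "?\<beta> \<gamma>" Y] by (simp_all add: mdeg_def lookup_restrict_exponent)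
    ultimately show "(?\<rho> \<gamma>, \<alpha> \<gamma>, ?\<beta> \<gamma>) \<in> ?R \<times> weighted_simplex B Y D T"
      using \<open>\<gamma> \<in> ?S\<close> mdeg_split[of \<gamma> Y] D by (simp add: weighted_simplex_def exponents_def \<alpha>_def)
  qed
  ultimately have "card ?S \<le> card (?R \<times> weighted_simplex B Y D T)"
    by (rule card_inj_on_le)
      (intro finite_cartesian_product finite_PiE finite_weighted_simplex finite
        finite_lessThan B(1) D)
  then show ?thesis by (simp add: card_cartesian_product card_PiE)
qed

lemma monomial_products_independent:
  fixes g :: "'b \<Rightarrow> ('n::finite, 'k::field) mpoly"
  assumes analytic: "analytic_indep Q J g B" and indep: "indep_mod Q Y" and fin: "finite \<Psi>"
    and \<Psi>: "\<And>\<alpha> \<beta>. (\<alpha>, \<beta>) \<in> \<Psi> \<Longrightarrow> \<alpha> \<in> exponents B \<and> level J \<alpha> = s \<and> mdeg (- Y) \<beta> = 0"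
    and sum: "(\<Sum>(\<alpha>, \<beta>)\<in>\<Psi>. smult (c (\<alpha>, \<beta>)) (monom \<beta> * power_product J g \<alpha>)) \<in>
      nilpotent_forms Q (ideal_gen (g ` J)) s"
    and mem: "(\<alpha>, \<beta>) \<in> \<Psi>"
  shows "c (\<alpha>, \<beta>) = 0"
proof -
  define C where "C = (\<lambda>\<alpha>. \<Sum>\<beta>\<in>\<Psi> `` {\<alpha>}. smult (c (\<alpha>, \<beta>)) (monom \<beta>) :: ('n, 'k) mpoly)"
  have fin_fibre: "finite (\<Psi> `` {\<alpha>})" for \<alpha> using fin by (rule finite_Image)
  have "(\<Sum>\<alpha>\<in>fst ` \<Psi>. C \<alpha> * power_product J g \<alpha>) =
      (\<Sum>\<alpha>\<in>fst ` \<Psi>. \<Sum>\<beta>\<in>\<Psi> `` {\<alpha>}. smult (c (\<alpha>, \<beta>)) (monom \<beta> * power_product J g \<alpha>))"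
    by (simp add: C_def sum_distrib_right smult_mult_left)
  also have "\<dots> = (\<Sum>(\<alpha>, \<beta>)\<in>Sigma (fst ` \<Psi>) (\<lambda>\<alpha>. \<Psi> `` {\<alpha>}).
      smult (c (\<alpha>, \<beta>)) (monom \<beta> * power_product J g \<alpha>))"
    by (intro sum.Sigma ballI finite_imageI fin fin_fibre)
  also have "Sigma (fst ` \<Psi>) (\<lambda>\<alpha>. \<Psi> `` {\<alpha>}) = \<Psi>" by force
  finally have "(\<Sum>\<alpha>\<in>fst ` \<Psi>. C \<alpha> * power_product J g \<alpha>) \<in> nilpotent_forms Q (ideal_gen (g ` J)) s"
    using sum by simp
  moreover have "finite (fst ` \<Psi>)" "fst ` \<Psi> \<subseteq> exponents B" "\<forall>\<alpha>\<in>fst ` \<Psi>. level J \<alpha> = s"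
    using fin \<Psi> by auto
  ultimately have "\<forall>\<alpha>\<in>fst ` \<Psi>. C \<alpha> \<in> Q" using analytic unfolding analytic_indep_def by blast
  then have "C \<alpha> \<in> Q" using mem by force
  moreover have "C \<alpha> \<in> poly_ring Y"
    unfolding C_def using \<Psi> by (intro poly_ring_sum poly_ring_smult) (auto simp: monom_in_poly_ring)
  ultimately have "C \<alpha> = 0" using indep by (auto simp: indep_mod_def)
  moreover have "lookup (C \<alpha>) \<beta> = c (\<alpha>, \<beta>)"
    unfolding C_def using mem by (intro lookup_sum_smult_monom[OF fin_fibre]) simp
  ultimately show ?thesis by simp
qed

locale separated_primes =
  fixes J :: "'b set" and g :: "'b \<Rightarrow> ('n::finite, 'k::field) mpoly"
    and \<Q> :: "('n, 'k) mpoly set set"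
    and Y :: "('n, 'k) mpoly set \<Rightarrow> 'n set" and B :: "('n, 'k) mpoly set \<Rightarrow> 'b set"
    and b :: "('n, 'k) mpoly set \<Rightarrow> ('n, 'k) mpoly"
  assumes finite_generators: "finite J"
    and prime: "Q \<in> \<Q> \<Longrightarrow> is_prime_ideal Q"
    and nilpotent: "Q \<in> \<Q> \<Longrightarrow> nilpotent_at Q (ideal_gen (g ` J))"
    and indep: "Q \<in> \<Q> \<Longrightarrow> indep_mod Q (Y Q)"
    and generators_subset: "Q \<in> \<Q> \<Longrightarrow> B Q \<subseteq> J"
    and analytic: "Q \<in> \<Q> \<Longrightarrow> analytic_indep Q J g (B Q)"
    and separator: "Q \<in> \<Q> \<Longrightarrow> Q' \<in> \<Q> \<Longrightarrow> b Q \<in> Q' \<longleftrightarrow> Q \<noteq> Q'"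
begin

abbreviation I :: "('n, 'k) mpoly set" where
  "I \<equiv> ideal_gen (g ` J)"

definition indices :: "(('n, 'k) mpoly set \<times> ('b \<Rightarrow> nat) \<times> ('n \<Rightarrow>\<^sub>0 nat)) set" where
  "indices = {(Q, \<alpha>, \<beta>). Q \<in> \<Q> \<and> \<alpha> \<in> exponents (B Q) \<and> mdeg (- Y Q) \<beta> = 0}"

definition separated_product :: "('n, 'k) mpoly set \<times> ('b \<Rightarrow> nat) \<times> ('n \<Rightarrow>\<^sub>0 nat) \<Rightarrow> ('n, 'k) mpoly"
  where
  "separated_product = (\<lambda>(Q, \<alpha>, \<beta>). b Q * (monom \<beta> * power_product J g \<alpha>))"

lemma separated_product_nilpotent:
  assumes Q: "Q \<in> \<Q>" and w: "(R, \<alpha>, \<beta>) \<in> indices" and s: "s \<le> level J \<alpha>"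
    and other: "R \<noteq> Q \<or> level J \<alpha> \<noteq> s"
  shows "separated_product (R, \<alpha>, \<beta>) \<in> nilpotent_forms Q I s"
proof (cases "R = Q")
  case True
  then have "power_product J g \<alpha> \<in> ideal_power I (Suc s)"
    using s other power_product_in_ideal_power[of J g \<alpha>]
      ideal_power_antimono[of "Suc s" "level J \<alpha>"] by auto
  then have "power_product J g \<alpha> \<in> nilpotent_forms Q I s"
    using ideal_power_Suc_subset_nilpotent_forms[OF prime[OF Q]] by blast
  then show ?thesis
    unfolding separated_product_def prod.case
    by (intro ideal_mult_left is_ideal_nilpotent_forms[OF prime[OF Q]])
next
  case False
  then have "b R \<in> Q" using separator[OF _ Q, of R] w by (auto simp: indices_def)
  moreover have "monom \<beta> * power_product J g \<alpha> \<in> ideal_power I s"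
    using power_product_in_ideal_power[of J g \<alpha>] ideal_power_antimono[OF s, of I]
    by (intro ideal_mult_left is_ideal_ideal_power) auto
  ultimately show ?thesis
    unfolding separated_product_def prod.case
    by (rule nilpotent_at_mult_nilpotent_forms[OF nilpotent[OF Q]])
qed

lemma lowest_coefficient_vanishes:
  assumes fin: "finite \<Omega>" and \<Omega>: "\<Omega> \<subseteq> indices"
    and zero: "(\<Sum>w\<in>\<Omega>. smult (c w) (separated_product w)) = 0"
    and mem: "(Q, \<alpha>, \<beta>) \<in> \<Omega>"
    and lowest: "\<And>R \<alpha>' \<beta>'. (R, \<alpha>', \<beta>') \<in> \<Omega> \<Longrightarrow> c (R, \<alpha>', \<beta>') \<noteq> 0 \<Longrightarrow> level J \<alpha> \<le> level J \<alpha>'"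
  shows "c (Q, \<alpha>, \<beta>) = 0"
proof -
  let ?s = "level J \<alpha>" and ?t = "\<lambda>w. smult (c w) (separated_product w)"
  define \<Psi> where "\<Psi> = {(\<alpha>', \<beta>'). (Q, \<alpha>', \<beta>') \<in> \<Omega> \<and> level J \<alpha>' = ?s}"
  define F where "F = (\<Sum>(\<alpha>, \<beta>)\<in>\<Psi>. smult (c (Q, \<alpha>, \<beta>)) (monom \<beta> * power_product J g \<alpha>))"
  have Q: "Q \<in> \<Q>" using mem \<Omega> by (auto simp: indices_def)
  note ideal = is_ideal_nilpotent_forms[OF prime[OF Q], of I ?s]
  have sub: "Pair Q ` \<Psi> \<subseteq> \<Omega>" by (auto simp: \<Psi>_def)
  have fin_\<Psi>: "finite \<Psi>"
    by (rule finite_imageD[OF finite_subset[OF sub fin]]) (simp add: inj_on_def)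
  have "?t w \<in> nilpotent_forms Q I ?s" if w: "w \<in> \<Omega> - Pair Q ` \<Psi>" for w
  proof (cases "c w = 0")
    case True
    then show ?thesis using ideal_zero[OF ideal] by simp
  next
    case False
    obtain R \<alpha>' \<beta>' where w_eq: "w = (R, \<alpha>', \<beta>')" by (cases w)
    then have "separated_product w \<in> nilpotent_forms Q I ?s"
      using w False lowest \<Omega> by (auto simp: \<Psi>_def intro!: separated_product_nilpotent[OF Q])
    then show ?thesis unfolding smult_def by (rule ideal_mult_left[OF ideal])
  qed
  then have "(\<Sum>w\<in>\<Omega> - Pair Q ` \<Psi>. ?t w) \<in> nilpotent_forms Q I ?s" by (rule ideal_sum[OF ideal])
  moreover have "(\<Sum>w\<in>\<Omega> - Pair Q ` \<Psi>. ?t w) = - (\<Sum>w\<in>Pair Q ` \<Psi>. ?t w)"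
    using zero sum.subset_diff[OF sub fin, of ?t] by (simp add: eq_neg_iff_add_eq_0)
  moreover have "(\<Sum>w\<in>Pair Q ` \<Psi>. ?t w) = b Q * F"
    by (simp add: F_def sum.reindex inj_on_def separated_product_def smult_mult_right
      sum_distrib_left split_def)
  ultimately have bF: "b Q * F \<in> nilpotent_forms Q I ?s" using ideal_uminus[OF ideal] by force
  have "smult (c (Q, \<alpha>', \<beta>')) (monom \<beta>' * power_product J g \<alpha>') \<in> ideal_power I ?s"
    if "(\<alpha>', \<beta>') \<in> \<Psi>" for \<alpha>' \<beta>'
    using that power_product_in_ideal_power[of J g \<alpha>'] unfolding smult_def
    by (intro ideal_mult_left is_ideal_ideal_power) (auto simp: \<Psi>_def)
  then have F_level: "F \<in> ideal_power I ?s"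
    unfolding F_def by (intro ideal_sum[OF is_ideal_ideal_power]) auto
  have "b Q \<notin> Q" using separator[OF Q Q] by simp
  then have "F \<in> nilpotent_forms Q I ?s"
    using F_level bF by (rule nilpotent_forms_cancel[OF prime[OF Q]])
  then show ?thesis
    using \<Omega> mem unfolding F_def
    by (intro monomial_products_independent[OF analytic[OF Q] indep[OF Q] fin_\<Psi>,
        of ?s "\<lambda>p. c (Q, p)"])
       (auto simp: \<Psi>_def indices_def)
qed

theorem separated_products_independent:
  assumes fin: "finite \<Omega>" and \<Omega>: "\<Omega> \<subseteq> indices"
    and zero: "(\<Sum>w\<in>\<Omega>. smult (c w) (separated_product w)) = 0" and w: "w \<in> \<Omega>"
  shows "c w = 0"
proof (rule ccontr)
  assume nonzero: "c w \<noteq> 0"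
  let ?level = "\<lambda>(Q, \<alpha>, \<beta>). level J \<alpha>"
  obtain v where v: "v \<in> \<Omega>" "c v \<noteq> 0" "\<And>u. u \<in> \<Omega> \<Longrightarrow> c u \<noteq> 0 \<Longrightarrow> ?level v \<le> ?level u"
    using ex_has_least_nat[of "\<lambda>v. v \<in> \<Omega> \<and> c v \<noteq> 0" w ?level] w nonzero by blast
  obtain Q \<alpha> \<beta> where v_eq: "v = (Q, \<alpha>, \<beta>)" by (cases v)
  have "level J \<alpha> \<le> level J \<alpha>'" if "(R, \<alpha>', \<beta>') \<in> \<Omega>" "c (R, \<alpha>', \<beta>') \<noteq> 0" for R \<alpha>' \<beta>'
    using v(3)[OF that] by (simp add: v_eq)
  then have "c v = 0"
    using v(1) unfolding v_eq by (intro lowest_coefficient_vanishes[OF fin \<Omega> zero])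
  then show False using v(2) by contradiction
qed

lemma level_generators: "Q \<in> \<Q> \<Longrightarrow> \<alpha> \<in> exponents (B Q) \<Longrightarrow> level J \<alpha> = level (B Q) \<alpha>"
  unfolding level_def using generators_subset finite_generators
  by (intro sum.mono_neutral_right) (auto simp: exponents_def)

lemma deg_le_separated_product:
  assumes deg: "\<And>i. i \<in> J \<Longrightarrow> deg_le UNIV D (g i)" and E: "deg_le UNIV E (b Q)" and Q: "Q \<in> \<Q>"
    and w: "(\<alpha>, \<beta>) \<in> weighted_simplex (B Q) (Y Q) D T"
  shows "deg_le UNIV (T + E) (separated_product (Q, \<alpha>, \<beta>))"
proof -
  have "deg_le UNIV (\<Sum>i\<in>J. \<alpha> i * D) (power_product J g \<alpha>)"
    unfolding power_product_def by (intro deg_le_prod deg_le_power deg)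
  moreover have "(\<Sum>i\<in>J. \<alpha> i * D) = D * level (B Q) \<alpha>"
    using level_generators[OF Q, of \<alpha>] w
    by (simp add: weighted_simplex_def level_def sum_distrib_right[symmetric])
  ultimately have "deg_le UNIV
      (E + (mdeg UNIV \<beta> + D * level (B Q) \<alpha>)) (separated_product (Q, \<alpha>, \<beta>))"
    unfolding separated_product_def prod.case by (intro deg_le_mult E) (simp_all add: deg_le_monom)
  then show ?thesis by (rule deg_le_weaken) (use w in \<open>simp add: weighted_simplex_def\<close>)
qed

lemma card_primes_growth_step:
  assumes fin: "finite \<Q>" and D: "D \<ge> 1" and deg: "\<And>i. i \<in> J \<Longrightarrow> deg_le UNIV D (g i)"
    and E: "\<And>Q. Q \<in> \<Q> \<Longrightarrow> deg_le UNIV E (b Q)"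
    and card: "\<And>Q. Q \<in> \<Q> \<Longrightarrow> card (- Y Q) = j" "\<And>Q. Q \<in> \<Q> \<Longrightarrow> card (B Q) = j"
  shows "card \<Q> * card {\<gamma> :: 'n \<Rightarrow>\<^sub>0 nat. mdeg UNIV \<gamma> \<le> T} \<le>
      D ^ j * card {\<gamma> :: 'n \<Rightarrow>\<^sub>0 nat. mdeg UNIV \<gamma> \<le> T + E}"
proof -
  let ?S = "\<lambda>T. {\<gamma> :: 'n \<Rightarrow>\<^sub>0 nat. mdeg UNIV \<gamma> \<le> T}"
  let ?W = "\<lambda>Q. weighted_simplex (B Q) (Y Q) D T"
  define \<Omega> where "\<Omega> = Sigma \<Q> ?W"
  have fin_B: "finite (B Q)" if "Q \<in> \<Q>" for Q
    by (rule finite_subset[OF generators_subset[OF that] finite_generators])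
  then have fin_W: "finite (?W Q)" if "Q \<in> \<Q>" for Q using that by (intro finite_weighted_simplex D)
  have fin_\<Omega>: "finite \<Omega>" unfolding \<Omega>_def using fin fin_W by (rule finite_SigmaI)
  have \<Omega>: "\<Omega> \<subseteq> indices" by (auto simp: \<Omega>_def indices_def weighted_simplex_def)
  have "card \<Omega> \<le> card (monom ` ?S (T + E) :: ('n, 'k) mpoly set)"
  proof (rule ccontr)
    assume "\<not> ?thesis"
    moreover have "separated_product w \<in> mpoly.span (monom ` ?S (T + E))" if "w \<in> \<Omega>" for w
      using that deg E unfolding \<Omega>_def
      by (intro deg_le_imp_span_monom) (auto intro!: deg_le_separated_product)
    ultimately obtain c where "\<exists>w\<in>\<Omega>. c w \<noteq> 0" "(\<Sum>w\<in>\<Omega>. smult (c w) (separated_product w)) = 0"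
      using mpoly.nontrivial_relation[OF finite_imageI[OF finite_mdeg_le] fin_\<Omega>,
          of monom "T + E" separated_product]
      by auto
    then show False using separated_products_independent[OF fin_\<Omega> \<Omega>] by blast
  qed
  also have "\<dots> \<le> card (?S (T + E))" by (intro card_image_le finite_mdeg_le)
  finally have card_\<Omega>: "card \<Omega> \<le> card (?S (T + E))" .
  have "card (?S T) \<le> D ^ j * card (?W Q)" if "Q \<in> \<Q>" for Q
    using card_weighted_simplex[OF fin_B[OF that], of "Y Q" D T] card that D by simp
  then have "card \<Q> * card (?S T) \<le> (\<Sum>Q\<in>\<Q>. D ^ j * card (?W Q))"
    using sum_bounded_below[of \<Q> "card (?S T)"] by simp
  also have "\<dots> = D ^ j * card \<Omega>"
    unfolding \<Omega>_def using fin fin_W by (simp add: card_SigmaI sum_distrib_left)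
  also have "\<dots> \<le> D ^ j * card (?S (T + E))" using card_\<Omega> by (rule mult_left_mono) simp
  finally show ?thesis .
qed

end

lemma exists_separators:
  assumes fin: "finite \<Q>" and prime: "\<And>Q. Q \<in> \<Q> \<Longrightarrow> is_prime_ideal Q"
    and incomparable: "\<And>Q R. Q \<in> \<Q> \<Longrightarrow> R \<in> \<Q> \<Longrightarrow> R \<subseteq> Q \<Longrightarrow> R = Q"
  shows "\<exists>b. \<forall>Q\<in>\<Q>. \<forall>R\<in>\<Q>. b Q \<in> R \<longleftrightarrow> Q \<noteq> R"
proof -
  have "\<exists>b. \<forall>R\<in>\<Q>. b \<in> R \<longleftrightarrow> Q \<noteq> R" if Q: "Q \<in> \<Q>" for Q
  proof -
    have "\<exists>r. r \<in> R \<and> r \<notin> Q" if "R \<in> \<Q> - {Q}" for R using incomparable[OF Q, of R] that by blast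
    then obtain r where r: "\<And>R. R \<in> \<Q> - {Q} \<Longrightarrow> r R \<in> R \<and> r R \<notin> Q" by metis
    have "prod r (\<Q> - {Q}) \<in> R \<longleftrightarrow> Q \<noteq> R" if "R \<in> \<Q>" for R
      using r that fin prime_ideal_prod[OF prime[OF that], of "\<Q> - {Q}" r] by auto
    then show ?thesis by blast
  qed
  then show ?thesis by metis
qed

theorem card_minimal_primes_le:
  fixes g :: "'b \<Rightarrow> ('n::finite, 'k::field_char_0) mpoly" and \<Q> :: "('n, 'k) mpoly set set"
  assumes fin: "finite J" "finite \<Q>" and D: "D \<ge> 1" and j: "j \<ge> 1"
    and deg: "\<And>i. i \<in> J \<Longrightarrow> deg_le UNIV D (g i)"
    and prime: "\<And>Q. Q \<in> \<Q> \<Longrightarrow> is_prime_ideal Q"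
    and dim: "\<And>Q. Q \<in> \<Q> \<Longrightarrow> dimension Q + j = CARD('n)"
    and sub: "\<And>Q. Q \<in> \<Q> \<Longrightarrow> g ` J \<subseteq> Q"
    and minimal: "\<And>Q P. Q \<in> \<Q> \<Longrightarrow> is_prime_ideal P \<Longrightarrow> g ` J \<subseteq> P \<Longrightarrow> P \<subseteq> Q \<Longrightarrow> P = Q"
  shows "card \<Q> \<le> D ^ j"
proof -
  have nil: "nilpotent_at Q (ideal_gen (g ` J))" if "Q \<in> \<Q>" for Q
    using ideal_gen_superset[of "g ` J"]
    by (intro nilpotent_at_minimal_prime[OF prime[OF that] is_ideal_ideal_gen] minimal[OF that])
      auto
  have "\<exists>Y. max_indep_mod Q Y \<and> card (- Y) = j" if Q: "Q \<in> \<Q>" for Q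
  proof -
    obtain Y where "max_indep_mod Q Y" "card Y = dimension Q"
      by (rule dimension_attained[OF prime[OF Q]])
    then show ?thesis using dim[OF Q] by (auto simp: card_Compl)
  qed
  then obtain Y where Y: "\<And>Q. Q \<in> \<Q> \<Longrightarrow> max_indep_mod Q (Y Q)" "\<And>Q. Q \<in> \<Q> \<Longrightarrow> card (- Y Q) = j" by metis
  have "\<exists>B\<subseteq>J. card B = j \<and> analytic_indep Q J g B" if Q: "Q \<in> \<Q>" for Q
  proof -
    have "Y Q \<noteq> UNIV" using Y(2)[OF Q] j by auto
    from exists_analytic_indep[OF prime[OF Q] Y(1)[OF Q] this fin(1) sub[OF Q] nil[OF Q]]
    show ?thesis unfolding Y(2)[OF Q] .
  qed
  then obtain B where B: "\<And>Q. Q \<in> \<Q> \<Longrightarrow> B Q \<subseteq> J" "\<And>Q. Q \<in> \<Q> \<Longrightarrow> card (B Q) = j"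
     "\<And>Q. Q \<in> \<Q> \<Longrightarrow> analytic_indep Q J g (B Q)" by metis
  obtain b where b: "\<And>Q R. Q \<in> \<Q> \<Longrightarrow> R \<in> \<Q> \<Longrightarrow> b Q \<in> R \<longleftrightarrow> Q \<noteq> R"
    using exists_separators[OF fin(2) prime] minimal prime sub by metis
  obtain E where E: "\<And>p. p \<in> b ` \<Q> \<Longrightarrow> deg_le UNIV E p"
    by (rule finite_deg_le_bound[of "b ` \<Q>"]) (use fin(2) in auto)
  interpret separated_primes J g \<Q> Y B b
    using fin(1) prime nil Y(1) B(1,3) b by unfold_locales (auto simp: max_indep_mod_def)
  show ?thesis
  proof (rule ratio_le_of_polynomial_growth)
    fix T
    show "card \<Q> * card {\<gamma> :: 'n \<Rightarrow>\<^sub>0 nat. mdeg UNIV \<gamma> \<le> T} \<le>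
        D ^ j * card {\<gamma> :: 'n \<Rightarrow>\<^sub>0 nat. mdeg UNIV \<gamma> \<le> T + E}"
      by (rule card_primes_growth_step[OF fin(2) D deg _ Y(2) B(2)]) (auto intro: E)
  next
    have "card {0 :: 'n \<Rightarrow>\<^sub>0 nat} \<le> card {\<gamma> :: 'n \<Rightarrow>\<^sub>0 nat. mdeg UNIV \<gamma> \<le> 0}"
      by (intro card_mono finite_mdeg_le) auto
    then show "1 \<le> card {\<gamma> :: 'n \<Rightarrow>\<^sub>0 nat. mdeg UNIV \<gamma> \<le> 0}" by simp
  qed (rule card_mdeg_le)
qed

section \<open>Evaluation and the torus action\<close>

lemma mono_val_add: "mono_val z (\<alpha> + \<beta>) = mono_val z \<alpha> * mono_val z \<beta>"
  by (simp add: mono_val_def lookup_add power_add prod.distrib)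

lemma mono_val_mult: "mono_val (z * w) \<alpha> = mono_val z \<alpha> * mono_val w \<alpha>"
  by (simp add: mono_val_def power_mult_distrib prod.distrib)

lemma mono_val_one [simp]: "mono_val 1 \<alpha> = 1"
  by (simp add: mono_val_def)

lemma mono_val_zero [simp]: "mono_val z 0 = 1"
  by (simp add: mono_val_def)

lemma mono_val_nonzero: "(\<And>i. z i \<noteq> (0::'k::field)) \<Longrightarrow> mono_val z \<alpha> \<noteq> 0"
  by (simp add: mono_val_def)

lemma meval_add: "meval (p + q) z = meval p z + meval q z"
  unfolding meval_def
  by (rule setsum_keys_plus_distrib[where f = "\<lambda>\<gamma> c. c * mono_val z \<gamma>"])
    (simp_all add: distrib_right)

lemma meval_zero [simp]: "meval 0 z = 0"
  by (simp add: meval_def)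

lemma meval_single: "meval (single \<gamma> c) z = c * mono_val z \<gamma>"
  by (auto simp: meval_def)

lemma meval_one [simp]: "meval 1 z = 1"
  using meval_single[of 0 1 z] by simp

lemma meval_mult: "meval (p * q) z = meval p z * meval q z"
  for p q :: "('n::finite, 'k::comm_ring_1) mpoly"
  by (induction p q rule: mpoly_bilinear_induct)
     (simp_all add: meval_add meval_single mult_single mono_val_add algebra_simps)

lemma lookup_act: "lookup (act z g) \<alpha> = lookup g \<alpha> * mono_val z \<alpha>"
  by (simp add: act_def lookup_mapp when_def in_keys_iff)

lemma act_add: "act z (p + q) = act z p + act z q"
  by (rule poly_mapping_eqI) (simp add: lookup_act lookup_add distrib_right)

lemma act_zero [simp]: "act z 0 = 0"
  by (rule poly_mapping_eqI) (simp add: lookup_act)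

lemma act_single: "act z (single \<gamma> c) = single \<gamma> (c * mono_val z \<gamma>)"
  by (rule poly_mapping_eqI) (simp add: lookup_act lookup_single when_def)

lemma act_mult: "act z (p * q) = act z p * act z q"
  for p q :: "('n::finite, 'k::comm_ring_1) mpoly"
  by (induction p q rule: mpoly_bilinear_induct)
     (simp_all add: act_add act_single mult_single mono_val_add algebra_simps)

lemma act_act: "act z (act w g) = act (z * w) g"
  by (rule poly_mapping_eqI) (simp add: lookup_act mono_val_mult algebra_simps)

lemma act_one [simp]: "act 1 g = g"
  by (rule poly_mapping_eqI) (simp add: lookup_act)

lemma meval_act: "meval (act z g) w = meval g (z * w)"
  by (induction g rule: mpoly_induct)
     (simp_all add: act_add act_single meval_add meval_single mono_val_mult del: times_fun_apply)

lemma keys_act: "(\<And>i. z i \<noteq> (0::'k::field)) \<Longrightarrow> keys (act z g) = keys g"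
  by (auto simp: in_keys_iff lookup_act mono_val_nonzero)

lemma act_inverse:
  fixes z :: "'n::finite \<Rightarrow> 'k::field"
  assumes "\<And>i. z i \<noteq> 0"
  shows "act z (act (\<lambda>i. inverse (z i)) p) = p" "act (\<lambda>i. inverse (z i)) (act z p) = p"
proof -
  have "z * (\<lambda>i. inverse (z i)) = 1" using assms by (auto simp: fun_eq_iff)
  then show "act z (act (\<lambda>i. inverse (z i)) p) = p" "act (\<lambda>i. inverse (z i)) (act z p) = p"
    by (simp_all add: act_act mult.commute)
qed

lemma prime_act_image:
  fixes P :: "('n::finite, 'k::field) mpoly set"
  assumes P: "is_prime_ideal P" and z: "\<And>i. z i \<noteq> 0"
  shows "is_prime_ideal (act z ` P)"
proof -
  note ideal = prime_is_ideal[OF P]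
  define w where "w = (\<lambda>i. inverse (z i))"
  have inverse: "act z (act w p) = p" "act w (act z p) = p" for p
    unfolding w_def by (rule act_inverse[OF z])+
  have "act z ` P = {p. act w p \<in> P}"
  proof (intro equalityI subsetI)
    fix p assume "p \<in> {p. act w p \<in> P}"
    then show "p \<in> act z ` P" by (intro image_eqI[of _ _ "act w p"]) (simp_all add: inverse)
  qed (auto simp: inverse)
  moreover have "act w (act z 1) \<notin> P" unfolding inverse by (rule prime_ideal_one[OF P])
  ultimately show ?thesis
    unfolding is_prime_ideal_def is_ideal_def
    by (auto simp: act_add act_mult ideal_zero[OF ideal] ideal_add[OF ideal]
      ideal_mult_left[OF ideal]
        prime_ideal_mult[OF P])
qed

lemma dimension_act_image:
  fixes P :: "('n::finite, 'k::field) mpoly set"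
  assumes z: "\<And>i. z i \<noteq> 0"
  shows "dimension (act z ` P) = dimension P"
proof -
  have "act z p = 0 \<longleftrightarrow> p = 0" "act z p \<in> poly_ring Y \<longleftrightarrow> p \<in> poly_ring Y" for p Y
    using keys_act[of z p] z by (simp_all add: poly_ring_iff flip: keys_eq_empty)
  then have "indep_mod (act z ` P) Y = indep_mod P Y" for Y by (fastforce simp: indep_mod_def)
  then show ?thesis by (simp add: dimension_def)
qed

definition vanishing :: "('n::finite \<Rightarrow> 'k::comm_ring_1) \<Rightarrow> ('n, 'k) mpoly set" where
  "vanishing z = {p. meval p z = 0}"

lemma prime_vanishing: "is_prime_ideal (vanishing (z :: 'n::finite \<Rightarrow> 'k::field))"
proof -
  have "1 \<notin> vanishing z" by (simp add: vanishing_def)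
  then have "vanishing z \<noteq> UNIV" by blast
  then show ?thesis
    by (auto simp: is_prime_ideal_def is_ideal_def vanishing_def meval_add meval_mult)
qed

lemma ideal_prod_diff_one:
  fixes h :: "'i \<Rightarrow> 'a::comm_ring_1"
  assumes M: "is_ideal M" and "\<And>i. i \<in> F \<Longrightarrow> h i - 1 \<in> M"
  shows "prod h F - 1 \<in> M"
  using assms(2)
proof (induction F rule: infinite_finite_induct)
  case (insert i F)
  have "h i * prod h F - 1 = h i * (prod h F - 1) + (h i - 1)" by (simp add: algebra_simps)
  also have "\<dots> \<in> M" using insert by (intro ideal_add[OF M] ideal_mult_left[OF M]) auto
  finally show ?case using insert.hyps by simp
qed (simp_all add: ideal_zero[OF M])

lemma ideal_power_diff_one: "is_ideal M \<Longrightarrow> h - 1 \<in> M \<Longrightarrow> h ^ k - 1 \<in> M"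
  using ideal_prod_diff_one[of M "{..<k}" "\<lambda>_. h"] by simp

lemma monom_eq_prod_mvar:
  "monom \<gamma> = (\<Prod>i\<in>UNIV. mvar i ^ lookup \<gamma> i :: ('n::finite, 'k::comm_ring_1) mpoly)"
proof -
  have power: "mvar i ^ k = (monom (single i k) :: ('n, 'k) mpoly)" for i k
    by (induction k) (simp_all add: mvar_def monom_def mult_single single_add[symmetric])
  have prod: "monom (\<Sum>i\<in>F. single i (lookup \<gamma> i)) =
      (\<Prod>i\<in>F. monom (single i (lookup \<gamma> i)) :: ('n, 'k) mpoly)" for F
    by (induction F rule: infinite_finite_induct) (simp_all add: monom_add)
  have "(\<Sum>i\<in>UNIV. single i (lookup \<gamma> i)) = \<gamma>"
    by (rule poly_mapping_eqI) (simp add: lookup_sum lookup_single when_def)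
  then show ?thesis using prod[of UNIV] by (simp add: power)
qed

lemma vanishing_one_subset_max_ideal_one:
  "vanishing 1 \<subseteq> (max_ideal_one :: ('n::finite, 'k::field) mpoly set)"
proof
  let ?M = "max_ideal_one :: ('n, 'k) mpoly set"
  have M: "is_ideal ?M" unfolding max_ideal_one_def by (rule is_ideal_ideal_gen)
  have "mvar i - 1 \<in> ?M" for i unfolding max_ideal_one_def by (rule ideal_gen_base) simp
  then have monom: "monom \<gamma> - 1 \<in> ?M" for \<gamma>
    unfolding monom_eq_prod_mvar by (intro ideal_prod_diff_one ideal_power_diff_one M)
  have "p - const (meval p 1) \<in> ?M" for p
  proof (induction p rule: mpoly_induct)
    case (single \<gamma> c)
    have "single \<gamma> c - const (meval (single \<gamma> c) 1) = const c * (monom \<gamma> - 1)"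
      by (simp add: meval_single const_def monom_def algebra_simps mult_single)
    then show ?case using ideal_mult_left[OF M monom] by (simp only:)
  next
    case (add p q)
    have "p + q - const (meval (p + q) 1) = (p - const (meval p 1)) + (q - const (meval q 1))"
      by (simp add: meval_add const_def single_add)
    then show ?case using ideal_add[OF M add] by (simp only:)
  qed
  moreover fix p :: "('n, 'k) mpoly" assume "p \<in> vanishing 1"
  ultimately have "p - const 0 \<in> ?M" by (metis (mono_tags) mem_Collect_eq vanishing_def)
  then show "p \<in> ?M" by (simp add: const_def)
qed

section \<open>Ranks of sets of integer vectors\<close>

lemma common_denominator:
  fixes c :: "'a \<Rightarrow> rat"
  assumes "finite B"
  shows "\<exists>d c'. d \<noteq> 0 \<and> (\<forall>b\<in>B. rat_of_int (c' b) = of_int d * c b)"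
proof -
  let ?n = "\<lambda>b. fst (quotient_of (c b))" and ?q = "\<lambda>b. snd (quotient_of (c b))"
  have q: "?q b \<noteq> 0" for b using quotient_of_denom_pos'[of "c b"] by simp
  have "c b = of_int (?n b) / of_int (?q b)" for b by (rule quotient_of_div) simp
  then have c: "of_int (?n b) = of_int (?q b) * c b" for b
    using q[of b] by (metis mult.commute nonzero_eq_divide_eq of_int_eq_0_iff)
  show ?thesis
  proof (intro exI[of _ "prod ?q B"] exI[of _ "\<lambda>b. ?n b * prod ?q (B - {b})"] conjI ballI)
    fix b assume "b \<in> B"
    then show "of_int (?n b * prod ?q (B - {b})) = of_int (prod ?q B) * c b"
      using prod.remove[OF assms, of b ?q] by (simp add: c)
  qed (simp add: prod_zero_iff[OF assms] q)
qed

global_interpretation rat_fun: vector_space "\<lambda>(c::rat) (v :: 'm \<Rightarrow> rat) i. c * v i"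
  by unfold_locales (simp_all add: fun_eq_iff algebra_simps)

lemma sum_fun_apply: "(\<Sum>i\<in>F. h i) k = (\<Sum>i\<in>F. h i k)"
  by (induction F rule: infinite_finite_induct) simp_all

lemma rat_fun_span_units:
  fixes v :: "'m::finite \<Rightarrow> rat"
  shows "v \<in> rat_fun.span (range (\<lambda>i. 0(i := 1)))"
proof -
  have "v = (\<Sum>i\<in>UNIV. (\<lambda>k. v i * (0(i := 1)) k))"
  proof
    fix k
    have "(\<Sum>i\<in>UNIV. (\<lambda>k. v i * (0(i := 1)) k)) k = (\<Sum>i\<in>UNIV. if i = k then v i else 0)"
      unfolding sum_fun_apply by (intro sum.cong) auto
    then show "v k = (\<Sum>i\<in>UNIV. (\<lambda>k. v i * (0(i := 1)) k)) k" by simp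
  qed
  also have "\<dots> \<in> rat_fun.span (range (\<lambda>i. 0(i := 1)))"
    by (intro rat_fun.span_sum rat_fun.span_scale rat_fun.span_base rangeI)
  finally show ?thesis .
qed

lemma int_lin_indep_card_le:
  fixes B :: "('m::finite \<Rightarrow> int) set"
  assumes fin: "finite B" and indep: "int_lin_indep B"
  shows "card B \<le> CARD('m)"
proof (rule ccontr)
  assume "\<not> card B \<le> CARD('m)"
  then have "card (range (\<lambda>i :: 'm. 0(i := 1 :: rat))) < card B"
    using card_image_le[OF finite, of "\<lambda>i :: 'm. 0(i := 1 :: rat)" UNIV] by simp
  then obtain c where c: "\<exists>b\<in>B. c b \<noteq> 0" "(\<Sum>b\<in>B. (\<lambda>i. c b * rat_of_int (b i))) = 0"
    using rat_fun.nontrivial_relation[OF finite_imageI[OF finite] fin _ rat_fun_span_units,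
        of "\<lambda>b i. of_int (b i)"]
    by blast
  obtain d c' where d: "d \<noteq> 0" "\<And>b. b \<in> B \<Longrightarrow> of_int (c' b) = of_int d * c b"
    using common_denominator[OF fin, of c] by blast
  have "(\<Sum>b\<in>B. c' b * b i) = 0" for i
  proof -
    have "rat_of_int (\<Sum>b\<in>B. c' b * b i) = (\<Sum>b\<in>B. of_int d * (c b * of_int (b i)))"
      using d(2) by (simp add: mult.assoc)
    also have "\<dots> = of_int d * (\<Sum>b\<in>B. (\<lambda>i. c b * rat_of_int (b i))) i"
      by (simp add: sum_fun_apply sum_distrib_left)
    finally show ?thesis
      unfolding c(2) by (simp only: zero_fun_apply mult_zero_right of_int_eq_0_iff)
  qed
  then have "\<forall>b\<in>B. c' b = 0" using indep unfolding int_lin_indep_def by blast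
  then show False using c(1) d by force
qed

lemma zrank_ge:
  fixes S :: "('m::finite \<Rightarrow> int) set"
  assumes "B \<subseteq> S" "finite B" "int_lin_indep B"
  shows "card B \<le> zrank S"
  unfolding zrank_def
  by (rule Greatest_le_nat[where b = "CARD('m)"]) (use assms int_lin_indep_card_le in auto)

lemma zrank_le: "zrank (S :: ('m::finite \<Rightarrow> int) set) \<le> CARD('m)"
proof -
  have "\<exists>B\<subseteq>S. finite B \<and> card B = zrank S \<and> int_lin_indep B"
    unfolding zrank_def
  proof (rule GreatestI_nat[where b = "CARD('m)" and k = 0])
    show "\<exists>B\<subseteq>S. finite B \<and> card B = 0 \<and> int_lin_indep B"
      by (intro exI[of _ "{}"]) (simp add: int_lin_indep_def)
  qed (use int_lin_indep_card_le in auto)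
  then show ?thesis using int_lin_indep_card_le by metis
qed

lemma int_lin_indep_diagonal:
  fixes v :: "'m::finite \<Rightarrow> 'm \<Rightarrow> int"
  assumes diag: "\<And>i. i \<in> F \<Longrightarrow> v i i \<noteq> 0" and off: "\<And>i k. i \<in> F \<Longrightarrow> k \<in> F \<Longrightarrow> i \<noteq> k \<Longrightarrow> v i k = 0"
  shows "inj_on v F" "int_lin_indep (v ` F)"
proof -
  show inj: "inj_on v F" using diag off by (metis inj_onI)
  show "int_lin_indep (v ` F)"
    unfolding int_lin_indep_def
  proof (intro allI impI ballI)
    fix c b assume zero: "\<forall>i. (\<Sum>b\<in>v ` F. c b * b i) = 0" and "b \<in> v ` F"
    then obtain i where i: "i \<in> F" "b = v i" by auto
    have "(\<Sum>b\<in>v ` F. c b * b i) = (\<Sum>k\<in>F. c (v k) * v k i)" by (simp add: sum.reindex[OF inj])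
    also have "\<dots> = (\<Sum>k\<in>F. if k = i then c (v i) * v i i else 0)"
      using off i(1) by (intro sum.cong) auto
    also have "\<dots> = c (v i) * v i i" using i(1) by simp
    finally show "c b = 0" using zero diag[OF i(1)] i(2) by simp
  qed
qed

lemma exists_complementary_coordinates:
  fixes S :: "('m::finite \<Rightarrow> int) set"
  shows "\<exists>C. CARD('m) \<le> card C + zrank S \<and> (\<forall>v\<in>S. (\<forall>i. i \<notin> C \<longrightarrow> v i = 0) \<longrightarrow> v = 0)"
proof -
  let ?free = "\<lambda>C. \<forall>v\<in>S. (\<forall>i. i \<notin> C \<longrightarrow> v i = 0) \<longrightarrow> v = 0"
  have "{} \<in> {C. ?free C}" by (auto simp: fun_eq_iff)
  then have "{C. ?free C} \<noteq> {}" by blast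
  then have "\<exists>C\<in>{C. ?free C}. \<forall>C'\<in>{C. ?free C}. C \<subseteq> C' \<longrightarrow> C = C'"
    by (intro finite_has_maximal finite)
  then obtain C where "C \<in> {C. ?free C}" and maximal: "\<forall>C'\<in>{C. ?free C}. C \<subseteq> C' \<longrightarrow> C = C'"
    by (rule bexE)
  then have C: "?free C" by simp
  have "\<exists>v\<in>S. v i \<noteq> 0 \<and> (\<forall>k. k \<notin> insert i C \<longrightarrow> v k = 0)" if i: "i \<notin> C" for i
  proof -
    have "\<not> ?free (insert i C)" using bspec[OF maximal, of "insert i C"] i by auto
    then obtain v where v: "v \<in> S" "\<forall>k. k \<notin> insert i C \<longrightarrow> v k = 0" "v \<noteq> 0" by blast
    have "v i \<noteq> 0" using C v by (metis insert_iff)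
    then show ?thesis using v by blast
  qed
  then obtain v where v: "\<And>i. i \<notin> C \<Longrightarrow> v i \<in> S \<and> v i i \<noteq> 0 \<and> (\<forall>k. k \<notin> insert i C \<longrightarrow> v i k = 0)"
    by metis
  then have "inj_on v (- C)" "int_lin_indep (v ` (- C))" by (intro int_lin_indep_diagonal; auto)+
  then have "card (- C) \<le> zrank S"
    using zrank_ge[of "v ` (- C)" S] v by (auto simp: card_image)
  then show ?thesis using C by (intro exI[of _ C]) (auto simp: card_Compl)
qed

section \<open>The zero estimate\<close>

definition int_box :: "nat \<Rightarrow> ('m \<Rightarrow> int) set" where
  "int_box U = {a. \<forall>i. 0 \<le> a i \<and> a i \<le> int U}"

lemma finite_int_box: "finite (int_box U :: ('m::finite \<Rightarrow> int) set)"
proof -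
  have "int_box U = (PiE UNIV (\<lambda>_. {0..int U}) :: ('m \<Rightarrow> int) set)"
    by (auto simp: int_box_def PiE_iff)
  then show ?thesis by (simp add: finite_PiE)
qed

lemma zero_in_int_box [simp]: "0 \<in> int_box U"
  by (simp add: int_box_def)

lemma int_box_add: "a \<in> int_box U \<Longrightarrow> b \<in> int_box W \<Longrightarrow> a + b \<in> int_box (U + W)"
  by (auto simp: int_box_def intro: add_mono)

lemma card_int_box_supported_ge:
  fixes C :: "'m::finite set"
  shows "(U + 1) ^ card C \<le> card {b \<in> int_box U. \<forall>i. i \<notin> C \<longrightarrow> b i = 0}"
proof -
  let ?f = "\<lambda>b i. if i \<in> C then b i else (0 :: int)" and ?P = "PiE C (\<lambda>_. {0..int U})"
  have "inj_on ?f ?P"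
  proof (rule inj_onI)
    fix b b' assume b: "b \<in> ?P" "b' \<in> ?P" and eq: "?f b = ?f b'"
    have "b i = b' i" if "i \<in> C" for i using fun_cong[OF eq, of i] that by simp
    then show "b = b'" using b by (intro PiE_ext[of b C _ b']) auto
  qed
  moreover have "?f ` ?P \<subseteq> {b \<in> int_box U. \<forall>i. i \<notin> C \<longrightarrow> b i = 0}"
    by (auto simp: int_box_def PiE_iff)
  ultimately have "card ?P \<le> card {b \<in> int_box U. \<forall>i. i \<notin> C \<longrightarrow> b i = 0}"
    by (rule card_inj_on_le) (simp add: finite_int_box)
  then show ?thesis by (simp add: card_PiE nat_add_distrib)
qed

locale torus_points =
  fixes x :: "'m::finite \<Rightarrow> 'n::finite \<Rightarrow> 'k::field"
  assumes units: "x i j \<noteq> 0"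
begin

lemma xpow_nonzero: "xpow x a j \<noteq> 0"
  by (simp add: xpow_def units)

lemma xpow_zero: "xpow x 0 = 1"
  by (simp add: xpow_def fun_eq_iff)

lemma xpow_add: "xpow x (a + b) = xpow x a * xpow x b"
  by (simp add: xpow_def fun_eq_iff power_int_add units prod.distrib)

lemma act_xpow_image: "act (xpow x a) ` act (xpow x b) ` P = act (xpow x (a + b)) ` P"
  by (simp add: image_image act_act xpow_add)

abbreviation translate :: "('n, 'k) mpoly set \<Rightarrow> ('m \<Rightarrow> int) \<Rightarrow> ('n, 'k) mpoly set" where
  "translate P b \<equiv> act (xpow x (- b)) ` P"

lemma Stab_act_image:
  assumes z: "\<And>i. z i \<noteq> 0"
  shows "Stab x (act z ` P) = Stab x P"
proof -
  have "inj (act z)" by (rule inj_on_inverseI) (rule act_inverse(2)[OF z])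
  moreover have "act w ` act z ` P = act z ` act w ` P" for w
    by (simp add: image_image act_act mult.commute)
  ultimately show ?thesis unfolding Stab_def by (simp add: inj_image_eq_iff)
qed

lemma zrank_Stab_le_mprime:
  assumes P: "is_prime_ideal P" "P \<subseteq> vanishing (xpow x a)" and dim: "dimension P + j = CARD('n)"
  shows "zrank (Stab x P) \<le> mprime x j"
proof -
  let ?P = "act (xpow x a) ` P"
  have prime: "is_prime_ideal ?P" by (rule prime_act_image[OF P(1) xpow_nonzero])
  have "?P \<subseteq> vanishing 1" using P(2) by (auto simp: vanishing_def meval_act)
  then have "?P \<subseteq> max_ideal_one" using vanishing_one_subset_max_ideal_one by blast
  moreover have "height ?P = enat j"
    unfolding height_eq_codimension[OF prime] dimension_act_image[OF xpow_nonzero] using dim by simp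
  moreover have "finite {zrank (Stab x P) | P. is_prime_ideal P \<and> P \<subseteq> max_ideal_one \<and>
      height P = enat j}"
    by (rule finite_subset[of _ "{..CARD('m)}"]) (use zrank_le in auto)
  ultimately have "zrank (Stab x ?P) \<le> mprime x j"
    unfolding mprime_def using prime by (intro Max_ge) auto
  then show ?thesis unfolding Stab_act_image[OF xpow_nonzero] .
qed

lemma card_translates_ge:
  "(T + 1) ^ (CARD('m) - zrank (Stab x P)) \<le> card (translate P ` int_box T)"
proof -
  obtain C where C: "CARD('m) \<le> card C + zrank (Stab x P)"
    "\<forall>v\<in>Stab x P. (\<forall>i. i \<notin> C \<longrightarrow> v i = 0) \<longrightarrow> v = 0"
    using exists_complementary_coordinates by blast
  let ?B = "{b \<in> int_box T. \<forall>i. i \<notin> C \<longrightarrow> b i = 0} :: ('m \<Rightarrow> int) set"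
  have inj: "inj_on (translate P) ?B"
  proof (rule inj_onI)
    fix b b' assume b: "b \<in> ?B" "b' \<in> ?B" and "translate P b = translate P b'"
    then have "act (xpow x b) ` translate P b = act (xpow x b) ` translate P b'" by simp
    then have "P = act (xpow x (b + - b')) ` P" by (simp add: act_xpow_image xpow_zero)
    then have "b + - b' \<in> Stab x P" by (simp add: Stab_def)
    from bspec[OF C(2) this] show "b = b'" using b by simp
  qed
  have "(T + 1) ^ (CARD('m) - zrank (Stab x P)) \<le> (T + 1) ^ card C"
    using C(1) by (intro power_increasing) auto
  also have "\<dots> \<le> card ?B" by (rule card_int_box_supported_ge)
  also have "\<dots> = card (translate P ` ?B)" by (rule card_image[OF inj, symmetric])
  also have "\<dots> \<le> card (translate P ` int_box T)"
    by (intro card_mono finite_imageI finite_int_box image_mono) auto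
  finally show ?thesis .
qed

definition primes_through :: "('n, 'k) mpoly \<Rightarrow> nat \<Rightarrow> nat \<Rightarrow> ('n, 'k) mpoly set set" where
  "primes_through f U W = {P. is_prime_ideal P \<and> (\<lambda>a. act (xpow x a) f) ` int_box U \<subseteq> P \<and>
     (\<exists>a\<in>int_box W. P \<subseteq> vanishing (xpow x a))}"

lemma translate_in_primes_through:
  assumes P: "P \<in> primes_through f (U + T) W" and b: "b \<in> int_box T"
  shows "translate P b \<in> primes_through f U (T + W)"
proof -
  have prime: "is_prime_ideal P" and contains: "\<And>a. a \<in> int_box (U + T) \<Longrightarrow> act (xpow x a) f \<in> P"
    using P by (auto simp: primes_through_def)
  obtain a where a: "a \<in> int_box W" "P \<subseteq> vanishing (xpow x a)"
    using P by (auto simp: primes_through_def)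
  have "act (xpow x c) f \<in> translate P b" if "c \<in> int_box U" for c
  proof -
    have "act (xpow x (c + b)) f \<in> P" by (intro contains int_box_add that b)
    moreover have "act (xpow x c) f = act (xpow x (- b)) (act (xpow x (c + b)) f)"
      by (simp add: act_act flip: xpow_add)
    ultimately show ?thesis by (rule image_eqI[rotated])
  qed
  moreover have "translate P b \<subseteq> vanishing (xpow x (b + a))"
    using a(2) by (auto simp: vanishing_def meval_act simp flip: xpow_add)
  moreover have "b + a \<in> int_box (T + W)" by (intro int_box_add b a(1))
  ultimately show ?thesis
    using prime_act_image[OF prime xpow_nonzero] by (auto simp: primes_through_def)
qed

lemma vanishing_one_in_primes_through:
  assumes "\<And>a. a \<in> int_box U \<Longrightarrow> meval f (xpow x a) = 0"
  shows "vanishing 1 \<in> primes_through f U 0"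
proof -
  have "vanishing 1 \<subseteq> vanishing (xpow x 0)" by (simp add: xpow_zero)
  then show ?thesis
    using assms prime_vanishing[of 1] zero_in_int_box[of 0]
    by (auto simp: primes_through_def vanishing_def meval_act)
qed

lemma dimension_primes_through_less:
  assumes f: "f \<noteq> 0" and P: "P \<in> primes_through f U W"
  shows "dimension P < CARD('n)"
proof (rule ccontr)
  have prime: "is_prime_ideal P" and "(\<lambda>a. act (xpow x a) f) ` int_box U \<subseteq> P"
    using P by (auto simp: primes_through_def)
  then have "act (xpow x 0) f \<in> P" by (auto simp del: act_one)
  then have fP: "f \<in> P" by (simp add: xpow_zero)
  obtain Y where Y: "max_indep_mod P Y" "card Y = dimension P"
    by (rule dimension_attained[OF prime])
  assume "\<not> dimension P < CARD('n)"
  then have "card Y = CARD('n)" using Y(2) dimension_le[OF prime] by simp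
  then have "Y = UNIV" by (metis card_subset_eq finite subset_UNIV)
  then have "f \<in> poly_ring Y" by (simp add: poly_ring_iff mdeg_def)
  then show False using Y(1) f fP by (auto simp: max_indep_mod_def indep_mod_def)
qed

lemma exists_critical_index:
  assumes f: "f \<noteq> 0" and vanish: "\<And>a. a \<in> int_box (\<Sum>d=1..CARD('n). T d) \<Longrightarrow> meval f (xpow x a) = 0"
  obtains j U W P where "1 \<le> j" "j \<le> CARD('n)" "P \<in> primes_through f (U + T j) W"
    "dimension P + j = CARD('n)" "\<forall>R\<in>primes_through f U (T j + W). dimension R + j \<le> CARD('n)"
proof -
  let ?n = "CARD('n)"
  define U where "U = (\<lambda>j. \<Sum>d=1..j. T d)"
  define F where "F = (\<lambda>j. primes_through f (U j) (U ?n - U j))"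
  define crit where "crit = (\<lambda>j. \<exists>P\<in>F j. ?n \<le> dimension P + j)"
  have "crit ?n"
    using vanishing_one_in_primes_through[of "U ?n" f] vanish by (auto simp: crit_def F_def U_def)
  define j where "j = (LEAST j. crit j)"
  have j: "crit j" "j \<le> ?n" unfolding j_def using \<open>crit ?n\<close> by (auto intro: LeastI Least_le)
  then obtain P where P: "P \<in> F j" "?n \<le> dimension P + j" by (auto simp: crit_def)
  have "dimension P < ?n" using P(1) unfolding F_def by (rule dimension_primes_through_less[OF f])
  then have "j \<noteq> 0" using P(2) by auto
  then obtain i where i: "j = Suc i" by (cases j) auto
  have "U j \<le> U ?n" unfolding U_def using j(2) by (intro sum_mono2) auto
  then have U: "U j = U i + T j" "U ?n - U i = T j + (U ?n - U j)" by (simp_all add: i U_def)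
  have minimal: "dimension R + j \<le> ?n" if "R \<in> primes_through f (U i) (T j + (U ?n - U j))" for R
  proof -
    have "\<not> crit i" by (rule not_less_Least) (simp add: i flip: j_def)
    then show ?thesis using that i by (auto simp: crit_def F_def U(2))
  qed
  have "translate P 0 \<in> primes_through f (U i) (T j + (U ?n - U j))"
    using P(1) unfolding F_def U(1) by (rule translate_in_primes_through) simp
  from minimal[OF this] have "dimension P + j = ?n" using P(2) by (simp add: xpow_zero)
  then show thesis
    using that[of j P "U i" "U ?n - U j"] \<open>j \<noteq> 0\<close> j(2) P(1) minimal by (auto simp: F_def U(1))
qed

end

locale torus_points_char_0 = torus_points x
  for x :: "'m::finite \<Rightarrow> 'n::finite \<Rightarrow> 'k::field_char_0"
begin

lemma card_translates_le:
  assumes D: "D \<ge> 1" "deg_le UNIV D f" and j: "j \<ge> 1" and P: "P \<in> primes_through f (U + T) W"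
    and dim: "dimension P + j = CARD('n)"
    and minimal: "\<forall>R\<in>primes_through f U (T + W). dimension R + j \<le> CARD('n)"
  shows "card (translate P ` int_box T) \<le> D ^ j"
proof (rule card_minimal_primes_le[where g = "\<lambda>a. act (xpow x a) f" and J = "int_box U"])
  show "deg_le UNIV D (act (xpow x a) f)" for a
    using D(2) keys_act[of "xpow x a" f] xpow_nonzero by (simp add: deg_le_def)
  fix Q assume "Q \<in> translate P ` int_box T"
  then obtain b where b: "b \<in> int_box T" "Q = translate P b" by auto
  have Q: "Q \<in> primes_through f U (T + W)" using translate_in_primes_through[OF P b(1)] b(2) by simp
  then show prime: "is_prime_ideal Q" and "(\<lambda>a. act (xpow x a) f) ` int_box U \<subseteq> Q"
    by (auto simp: primes_through_def)
  show dim_Q: "dimension Q + j = CARD('n)"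
    using dim b(2) dimension_act_image[of "xpow x (- b)" P] xpow_nonzero by simp
  fix R assume R: "is_prime_ideal R" "(\<lambda>a. act (xpow x a) f) ` int_box U \<subseteq> R" "R \<subseteq> Q"
  then have "R \<in> primes_through f U (T + W)" using Q unfolding primes_through_def by blast
  then have "dimension R \<le> dimension Q" using bspec[OF minimal, of R] dim_Q by simp
  then show "R = Q" using dimension_strict_antimono[OF R(1) prime] R(3) by fastforce
qed (use D j in \<open>auto intro: finite_int_box\<close>)

theorem zero_estimate:
  assumes f: "f \<noteq> 0" and deg: "deg_le UNIV D f"
    and T: "\<And>j. 1 \<le> j \<Longrightarrow> j \<le> CARD('n) \<Longrightarrow> D ^ j < (T j + 1) ^ (CARD('m) - mprime x j)"
  shows "\<exists>a\<in>int_box (\<Sum>d=1..CARD('n). T d). meval f (xpow x a) \<noteq> 0"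
proof (rule ccontr)
  assume "\<not> ?thesis"
  then have vanish: "\<And>a. a \<in> int_box (\<Sum>d=1..CARD('n). T d) \<Longrightarrow> meval f (xpow x a) = 0" by blast
  have "D \<ge> 1"
  proof (rule ccontr)
    assume "\<not> D \<ge> 1"
    then have "D = 0" by simp
    then have "f \<in> poly_ring {}" using deg by (simp add: poly_ring_def)
    moreover have "f \<in> vanishing (xpow x 0)" using vanish[of 0] by (simp add: vanishing_def)
    ultimately show False using indep_mod_empty[OF prime_vanishing] f by (auto simp: indep_mod_def)
  qed
  obtain j U W P where j: "1 \<le> j" "j \<le> CARD('n)" and P: "P \<in> primes_through f (U + T j) W"
    and dim: "dimension P + j = CARD('n)"
    and minimal: "\<forall>R\<in>primes_through f U (T j + W). dimension R + j \<le> CARD('n)"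
    by (rule exists_critical_index[OF f vanish])
  have "zrank (Stab x P) \<le> mprime x j"
    using P dim by (auto simp: primes_through_def intro: zrank_Stab_le_mprime)
  then have "(T j + 1) ^ (CARD('m) - mprime x j) \<le> (T j + 1) ^ (CARD('m) - zrank (Stab x P))"
    by (intro power_increasing) auto
  also have "\<dots> \<le> card (translate P ` int_box (T j))" by (rule card_translates_ge)
  also have "\<dots> \<le> D ^ j" by (rule card_translates_le[OF \<open>D \<ge> 1\<close> deg j(1) P dim minimal])
  finally show False using T[OF j] by simp
qed

end

lemma power_less_floor_powr:
  fixes D j e :: nat
  assumes "j \<ge> 1" "e > 0"
  shows "D ^ j < (nat \<lfloor>real D powr (real j / real e)\<rfloor> + 1) ^ e"
proof -
  let ?r = "real D powr (real j / real e)"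
  have "real D ^ j = ?r ^ e"
  proof (cases "D = 0")
    case False
    have "?r ^ e = real D powr (real j / real e * real e)"
      using False by (simp add: powr_powr flip: powr_realpow)
    then show ?thesis using assms(2) False by (simp add: powr_realpow)
  qed (use assms in \<open>simp add: power_0_left\<close>)
  also have "?r ^ e < real (nat \<lfloor>?r\<rfloor> + 1) ^ e"
    using assms(2) by (intro power_strict_mono) (auto, linarith)
  finally show ?thesis by (simp only: of_nat_power[symmetric] of_nat_less_iff)
qed

theorem theorem5p11:
  fixes x :: "'m::finite \<Rightarrow> 'n::finite \<Rightarrow> 'k::field_char_0"
    and f :: "('n, 'k) mpoly"
  assumes x_units: "\<And>i j. x i j \<noteq> 0"
    and rank_lt: "\<And>d. 1 \<le> d \<Longrightarrow> d \<le> CARD('n) \<Longrightarrow> mprime x d < CARD('m)"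
    and f_nz: "f \<noteq> 0"
  shows "\<exists>a :: 'm \<Rightarrow> int.
           (\<forall>i. 0 \<le> a i \<and> real_of_int (a i) \<le>
              (\<Sum>d=1..CARD('n). real (total_degree f) powr
                  (real d / real (CARD('m) - mprime x d))))
         \<and> meval f (xpow x a) \<noteq> 0"
proof -
  interpret torus_points_char_0 x by unfold_locales (rule x_units)
  let ?r = "\<lambda>d. real (total_degree f) powr (real d / real (CARD('m) - mprime x d))"
  have "total_degree f ^ d < (nat \<lfloor>?r d\<rfloor> + 1) ^ (CARD('m) - mprime x d)"
    if "1 \<le> d" "d \<le> CARD('n)" for d
    using rank_lt[OF that] that(1) by (intro power_less_floor_powr) auto
  then obtain a where a: "a \<in> int_box (\<Sum>d=1..CARD('n). nat \<lfloor>?r d\<rfloor>)" "meval f (xpow x a) \<noteq> 0"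
    using zero_estimate[OF f_nz deg_le_total_degree, of "\<lambda>d. nat \<lfloor>?r d\<rfloor>"] by blast
  then have "0 \<le> a i" "a i \<le> int (\<Sum>d=1..CARD('n). nat \<lfloor>?r d\<rfloor>)" for i
    unfolding int_box_def by blast+
  moreover have "real (\<Sum>d=1..CARD('n). nat \<lfloor>?r d\<rfloor>) \<le> (\<Sum>d=1..CARD('n). ?r d)"
    unfolding of_nat_sum by (intro sum_mono) simp
  ultimately have "0 \<le> a i" "real_of_int (a i) \<le> (\<Sum>d=1..CARD('n). ?r d)" for i
    by (blast, smt (verit) of_int_of_nat_eq of_int_le_iff)
  then show ?thesis using a(2) by blast
qed

end
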